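(* Let $T>0$, and let the contours $\Gamma_0,\Gamma^\pm$ and the functionals $F_\lambda$ for Problems 1 and 2 be as in the context. (1) Let $f\in C^\infty[0,1]$ with $f(0)=f(1)=0$, $f'(0)=2f'(1)$, and let $q$ be the solution of Problem 1: $q_t+q_{xxx}=0$ on $(0,1)\times(0,T)$, $q(x,0)=f(x)$ for $x\in[0,1]$, $q(0,t)=q(1,t)=0$ and $q_x(1,t)=q_x(0,t)/2$ for $t\in[0,T]$. Then, with $F_\lambda$ the functionals of Problem 1, $$q(x,t)=f_x\left(e^{i\lambda^3t}F_\lambda(f)\right)=\left\{\int_{\Gamma_0}+\int_{\Gamma^+}+\int_{\Gamma^-}\right\}e^{i\lambda x+i\lambda^3t}F_\lambda(f)\,d\lambda,\qquad (x,t)\in(0,1)\times(0,T).$$ (2) Let $f\in C^\infty[0,1]$ with $f(0)=f(1)=f'(1)=0$, and let $q$ be the solution of Problem 2: $q_t+q_{xxx}=0$ on $(0,1)\times(0,T)$, $q(x,0)=f(x)$ for $x\in[0,1]$, $q(0,t)=q(1,t)=q_x(1,t)=0$ for $t\in[0,T]$. Then the same formula holds with $F_\lambda$ the functionals of Problem 2.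
   Context: **Solutions.** Both problems are well-posed (a unique solution exists); the solution $q$ is understood to be smooth, $q\in C^\infty([0,1]\times[0,T])$. **Contours.** $\mathbb C^{\pm}$ are the open upper/lower half-planes. $\Gamma_0$ is the circle of radius $\tfrac12$ centred at $0$; $\Gamma^\pm$ is the boundary of $\{\lambda\in\mathbb C^\pm:\operatorname{Im}(\lambda^3)>0,\ |\lambda|>1\}$. Each contour is oriented so that the enclosed region (the disc, respectively the stated domain) lies to its left. Integrals along infinite contours are understood as improper integrals. The inverse transform is $f_x(F)=\left\{\int_{\Gamma_0}+\int_{\Gamma^+}+\int_{\Gamma^-}\right\}e^{i\lambda x}F(\lambda)\,d\lambda$. **Functionals.** Let $\alpha=e^{2\pi i/3}$ and $$F_\lambda(f)=\begin{cases}\int_0^1\phi^+(x,\lambda)f(x)\,dx,&\lambda\in\Gamma^+\cup\Gamma_0,\\ \int_0^1\phi^-(x,\lambda)f(x)\,dx,&\lambda\in\Gamma^-,\end{cases}$$ where, for Problem 1, $\Delta(\lambda)=e^{i\lambda}+\alpha e^{i\alpha\lambda}+\alpha^2e^{i\alpha^2\lambda}+2(e^{-i\lambda}+\alpha e^{-i\alpha\lambda}+\alpha^2e^{-i\alpha^2\lambda})$ and $$\phi^+(x,\lambda)=\tfrac{1}{2\pi\Delta(\lambda)}\big[e^{-i\lambda x}(e^{i\lambda}+2\alpha e^{-i\alpha\lambda}+2\alpha^2e^{-i\alpha^2\lambda})+e^{-i\alpha\lambda x}(\alpha e^{i\alpha\lambda}-2\alpha e^{-i\lambda})+e^{-i\alpha^2\lambda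 x}(\alpha^2e^{i\alpha^2\lambda}-2\alpha^2e^{-i\lambda})\big],$$ $$\phi^-(x,\lambda)=\tfrac{-e^{-i\lambda}}{2\pi\Delta(\lambda)}\big[e^{-i\lambda x}(2+\alpha^2e^{-i\alpha\lambda}+\alpha e^{-i\alpha^2\lambda})+\alpha e^{-i\alpha\lambda x}(2-e^{-i\alpha^2\lambda})+\alpha^2e^{-i\alpha^2\lambda x}(2-e^{-i\alpha\lambda})\big];$$ and, for Problem 2, $\Delta(\lambda)=e^{-i\lambda}+\alpha e^{-i\alpha\lambda}+\alpha^2e^{-i\alpha^2\lambda}$ and $$\phi^+(x,\lambda)=\tfrac{1}{2\pi\Delta(\lambda)}\big[e^{-i\lambda x}(\alpha e^{-i\alpha\lambda}+\alpha^2e^{-i\alpha^2\lambda})-(\alpha e^{-i\alpha\lambda x}+\alpha^2e^{-i\alpha^2\lambda x})e^{-i\lambda}\big],$$ $$\phi^-(x,\lambda)=\tfrac{-e^{-i\lambda}}{2\pi\Delta(\lambda)}\big[e^{-i\lambda x}+\alpha e^{-i\alpha\lambda x}+\alpha^2e^{-i\alpha^2\lambda x}\big].$$ *)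

theory Defs
  imports "HOL-Complex_Analysis.Complex_Analysis"
begin

subsection \<open>Smooth functions and partial derivatives on closed intervals and rectangles\<close>

text \<open>
  Derivatives are taken within \<open>S\<close>, i.e. one-sidedly at boundary points. On a nondegenerate
  compact interval or rectangle the derivative within \<open>S\<close> is unique, so this is
  the usual space of functions that are infinitely differentiable up to the boundary.
\<close>

primrec times_differentiable_on ::
  "nat \<Rightarrow> 'a::real_normed_vector set \<Rightarrow> ('a \<Rightarrow> 'b::real_normed_vector) \<Rightarrow> bool" where
  "times_differentiable_on 0 S f \<longleftrightarrow> continuous_on S f"
| "times_differentiable_on (Suc n) S f \<longleftrightarrow>
     f differentiable_on S \<and>
     (\<forall>v. times_differentiable_on n S (\<lambda>p. frechet_derivative f (at p within S) v))"

definition smooth_on ::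
  "'a::real_normed_vector set \<Rightarrow> ('a \<Rightarrow> 'b::real_normed_vector) \<Rightarrow> bool" where
  "smooth_on S f \<longleftrightarrow> (\<forall>n. times_differentiable_on n S f)"

definition deriv01 :: "(real \<Rightarrow> complex) \<Rightarrow> real \<Rightarrow> complex" where
  "deriv01 g x = vector_derivative g (at x within {0..1})"

definition partial_x :: "(real \<Rightarrow> real \<Rightarrow> complex) \<Rightarrow> real \<Rightarrow> real \<Rightarrow> complex" where
  "partial_x q x t = deriv01 (\<lambda>y. q y t) x"

definition partial_t :: "real \<Rightarrow> (real \<Rightarrow> real \<Rightarrow> complex) \<Rightarrow> real \<Rightarrow> real \<Rightarrow> complex" where
  "partial_t T q x t = vector_derivative (\<lambda>s. q x s) (at t within {0..T})"


subsection \<open>The two initial-boundary value problems\<close>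

definition solves_ivp :: "real \<Rightarrow> (real \<Rightarrow> complex) \<Rightarrow> (real \<Rightarrow> real \<Rightarrow> complex) \<Rightarrow> bool" where
  "solves_ivp T f q \<longleftrightarrow>
     smooth_on ({0..1} \<times> {0..T}) (\<lambda>(x, t). q x t) \<and>
     (\<forall>x\<in>{0<..<1}. \<forall>t\<in>{0<..<T}.
        partial_t T q x t + partial_x (partial_x (partial_x q)) x t = 0) \<and>
     (\<forall>x\<in>{0..1}. q x 0 = f x)"

definition solution1 :: "real \<Rightarrow> (real \<Rightarrow> complex) \<Rightarrow> (real \<Rightarrow> real \<Rightarrow> complex) \<Rightarrow> bool" where
  "solution1 T f q \<longleftrightarrow> solves_ivp T f q \<and>
     (\<forall>t\<in>{0..T}. q 0 t = 0 \<and> q 1 t = 0 \<and> partial_x q 1 t = partial_x q 0 t / 2)"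

definition solution2 :: "real \<Rightarrow> (real \<Rightarrow> complex) \<Rightarrow> (real \<Rightarrow> real \<Rightarrow> complex) \<Rightarrow> bool" where
  "solution2 T f q \<longleftrightarrow> solves_ivp T f q \<and>
     (\<forall>t\<in>{0..T}. q 0 t = 0 \<and> q 1 t = 0 \<and> partial_x q 1 t = 0)"


subsection \<open>Contours and the inverse transform\<close>

definition Gamma_zero :: "complex set" where
  "Gamma_zero = sphere 0 (1/2)"

definition Gamma_plus :: "complex set" where
  "Gamma_plus = frontier {l. Im l > 0 \<and> Im (l ^ 3) > 0 \<and> norm l > 1}"

definition Gamma_minus :: "complex set" where
  "Gamma_minus = frontier {l. Im l < 0 \<and> Im (l ^ 3) > 0 \<and> norm l > 1}"

text \<open>
  For \<open>a < b\<close>, \<open>1 \<le> R\<close> and \<open>1 \<le> R'\<close>, the following path is a truncation of the boundary of the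
  sector \<open>a < arg l < b\<close>, \<open>\<bar>l\<bar> > 1\<close>, traversed with the sector on its left: inwards along
  the ray at angle \<open>b\<close>, clockwise along the unit circle from angle \<open>b\<close> to angle \<open>a\<close>, and
  outwards along the ray at angle \<open>a\<close>. The two infinite ends are cut off independently, at
  moduli \<open>R\<close> and \<open>R'\<close>.
\<close>

definition sector_path :: "real \<Rightarrow> real \<Rightarrow> real \<Rightarrow> real \<Rightarrow> real \<Rightarrow> complex" where
  "sector_path a b R R' =
     linepath (of_real R * cis b) (cis b) +++
     (part_circlepath 0 1 b a +++ linepath (cis a) (of_real R' * cis a))"

definition has_sector_integral :: "(complex \<Rightarrow> complex) \<Rightarrow> complex \<Rightarrow> real \<Rightarrow> real \<Rightarrow> bool" where
  "has_sector_integral h J a b \<longleftrightarrow>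
     (\<forall>R\<ge>1. \<forall>R'\<ge>1. h contour_integrable_on sector_path a b R R') \<and>
     ((\<lambda>(R, R'). contour_integral (sector_path a b R R') h) \<longlongrightarrow> J) (at_top \<times>\<^sub>F at_top)"

text \<open>
  Since \<open>Im (l ^ 3) = \<bar>l\<bar> ^ 3 * sin (3 * arg l)\<close>, the domain enclosed by \<open>\<Gamma>\<^sup>+\<close> consists of the two
  sectors \<open>\<bar>l\<bar> > 1\<close> with argument in \<open>(0, \<pi>/3)\<close> and \<open>(2\<pi>/3, \<pi>)\<close>, and the domain enclosed by
  \<open>\<Gamma>\<^sup>-\<close> is the one with argument in \<open>(-2\<pi>/3, -\<pi>/3)\<close>.
\<close>

definition has_Gamma_zero_integral :: "(complex \<Rightarrow> complex) \<Rightarrow> complex \<Rightarrow> bool" where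
  "has_Gamma_zero_integral h J \<longleftrightarrow> (h has_contour_integral J) (circlepath 0 (1/2))"

definition has_Gamma_plus_integral :: "(complex \<Rightarrow> complex) \<Rightarrow> complex \<Rightarrow> bool" where
  "has_Gamma_plus_integral h J \<longleftrightarrow>
     (\<exists>J1 J2. has_sector_integral h J1 0 (pi/3) \<and> has_sector_integral h J2 (2*pi/3) pi \<and>
              J = J1 + J2)"

definition has_Gamma_minus_integral :: "(complex \<Rightarrow> complex) \<Rightarrow> complex \<Rightarrow> bool" where
  "has_Gamma_minus_integral h J \<longleftrightarrow> has_sector_integral h J (-2*pi/3) (-pi/3)"

text \<open>
  \<open>has_inverse_transform F x v\<close> states that all the integrals defining \<open>f\<^sub>x(F)\<close> exist
  and that \<open>f\<^sub>x(F) = v\<close>.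
\<close>

definition has_inverse_transform :: "(complex \<Rightarrow> complex) \<Rightarrow> real \<Rightarrow> complex \<Rightarrow> bool" where
  "has_inverse_transform F x v \<longleftrightarrow>
     (let h = (\<lambda>l. exp (\<i> * l * of_real x) * F l) in
      \<exists>J0 Jp Jm. has_Gamma_zero_integral h J0 \<and> has_Gamma_plus_integral h Jp \<and>
                 has_Gamma_minus_integral h Jm \<and> v = J0 + Jp + Jm)"


subsection \<open>The functionals\<close>

definition \<alpha> :: complex where
  "\<alpha> = exp (2 * of_real pi * \<i> / 3)"

text \<open>The value 0 off the contours is a dummy.\<close>

definition transform ::
  "(real \<Rightarrow> complex \<Rightarrow> complex) \<Rightarrow> (real \<Rightarrow> complex \<Rightarrow> complex) \<Rightarrow> complex \<Rightarrow> (real \<Rightarrow> complex) \<Rightarrow> complex"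
  where
  "transform \<phi>p \<phi>m l f =
     (if l \<in> Gamma_plus \<union> Gamma_zero then integral {0..1} (\<lambda>x. \<phi>p x l * f x)
      else if l \<in> Gamma_minus then integral {0..1} (\<lambda>x. \<phi>m x l * f x)
      else 0)"

definition \<Delta>1 :: "complex \<Rightarrow> complex" where
  "\<Delta>1 l = exp (\<i>*l) + \<alpha> * exp (\<i>*\<alpha>*l) + \<alpha>^2 * exp (\<i>*\<alpha>^2*l)
     + 2 * (exp (-\<i>*l) + \<alpha> * exp (-\<i>*\<alpha>*l) + \<alpha>^2 * exp (-\<i>*\<alpha>^2*l))"

definition \<phi>1p :: "real \<Rightarrow> complex \<Rightarrow> complex" where
  "\<phi>1p x l = 1 / (2 * of_real pi * \<Delta>1 l) *
     (exp (-\<i>*l * of_real x) * (exp (\<i>*l) + 2*\<alpha> * exp (-\<i>*\<alpha>*l) + 2*\<alpha>^2 * exp (-\<i>*\<alpha>^2*l))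
      + exp (-\<i>*\<alpha>*l * of_real x) * (\<alpha> * exp (\<i>*\<alpha>*l) - 2*\<alpha> * exp (-\<i>*l))
      + exp (-\<i>*\<alpha>^2*l * of_real x) * (\<alpha>^2 * exp (\<i>*\<alpha>^2*l) - 2*\<alpha>^2 * exp (-\<i>*l)))"

definition \<phi>1m :: "real \<Rightarrow> complex \<Rightarrow> complex" where
  "\<phi>1m x l = - exp (-\<i>*l) / (2 * of_real pi * \<Delta>1 l) *
     (exp (-\<i>*l * of_real x) * (2 + \<alpha>^2 * exp (-\<i>*\<alpha>*l) + \<alpha> * exp (-\<i>*\<alpha>^2*l))
      + \<alpha> * exp (-\<i>*\<alpha>*l * of_real x) * (2 - exp (-\<i>*\<alpha>^2*l))
      + \<alpha>^2 * exp (-\<i>*\<alpha>^2*l * of_real x) * (2 - exp (-\<i>*\<alpha>*l)))"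

definition transform1 :: "complex \<Rightarrow> (real \<Rightarrow> complex) \<Rightarrow> complex" where
  "transform1 = transform \<phi>1p \<phi>1m"

definition \<Delta>2 :: "complex \<Rightarrow> complex" where
  "\<Delta>2 l = exp (-\<i>*l) + \<alpha> * exp (-\<i>*\<alpha>*l) + \<alpha>^2 * exp (-\<i>*\<alpha>^2*l)"

definition \<phi>2p :: "real \<Rightarrow> complex \<Rightarrow> complex" where
  "\<phi>2p x l = 1 / (2 * of_real pi * \<Delta>2 l) *
     (exp (-\<i>*l * of_real x) * (\<alpha> * exp (-\<i>*\<alpha>*l) + \<alpha>^2 * exp (-\<i>*\<alpha>^2*l))
      - (\<alpha> * exp (-\<i>*\<alpha>*l * of_real x) + \<alpha>^2 * exp (-\<i>*\<alpha>^2*l * of_real x)) * exp (-\<i>*l))"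

definition \<phi>2m :: "real \<Rightarrow> complex \<Rightarrow> complex" where
  "\<phi>2m x l = - exp (-\<i>*l) / (2 * of_real pi * \<Delta>2 l) *
     (exp (-\<i>*l * of_real x) + \<alpha> * exp (-\<i>*\<alpha>*l * of_real x) + \<alpha>^2 * exp (-\<i>*\<alpha>^2*l * of_real x))"

definition transform2 :: "complex \<Rightarrow> (real \<Rightarrow> complex) \<Rightarrow> complex" where
  "transform2 = transform \<phi>2p \<phi>2m"

end

theory Submission
  imports Defs
begin

text \<open>
  Both problems are the cases \<open>\<beta> = 1/2\<close> and \<open>\<beta> = 0\<close> of the boundary condition \<open>q_x(1,t) = \<beta> q_x(0,t)\<close>.
  On \<open>\<Gamma>\<^sup>+ \<union> \<Gamma>\<^sub>0\<close> the functional exceeds the one on \<open>\<Gamma>\<^sup>-\<close> by \<open>1/(2\<pi>)\<close> times the Fourier transform of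
  \<open>f\<close>, an entire function.

  Inversion at a fixed time: the zeros of \<open>\<Delta>\<close> other than \<open>0\<close> lie inside the sectors bounded by \<open>\<Gamma>\<^sup>\<plusminus>\<close>, and in the
  three complementary sectors \<open>exp(i l x) F\<close> is analytic and \<open>O(|l|^-2)\<close>. Hence \<open>\<Gamma>\<^sup>+\<close> and \<open>\<Gamma>\<^sup>-\<close> can be opened up onto the real
  axis, indented around the unit circle. The common part of the two functionals then only leaves a clockwise
  unit circle, which cancels against \<open>\<Gamma>\<^sub>0\<close>; the difference leaves the Fourier inversion integral.

  Evolution: transforming the equation shows that \<open>exp(i l^3 t) F(f)\<close> and \<open>F(q(\<cdot>,t))\<close> differ by
  an entire function of \<open>l\<close> built from boundary values of \<open>q\<close>, which is \<open>O(|l|^-2)\<close> inside the sectors bounded by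
  \<open>\<Gamma>\<^sup>\<plusminus>\<close>, so its integral vanishes by Cauchy's theorem.
\<close>

section \<open>Finite Laplace transforms\<close>

text \<open>That the contour integral solves the equation is never checked. Since \<open>q\<close>
  is given, inversion is applied to \<open>q(x,t)\<close> at each fixed \<open>t\<close>, so no
  integral over the contours is differentiated in \<open>x\<close> or \<open>t\<close> and no limit
  \<open>t -> 0\<close> is taken.

  Why there are two functionals: \<open>exp(i l x) Fm\<close> carries
  \<open>exp(-i l (1-x))\<close>, bounded in the lower half plane, and its evolution leaves
  right-end boundary values. Adding the Fourier transform trades these for left-end values without
  the factor \<open>exp(-i l)\<close>, which suits the upper half plane.

  The main obstacle is locating the zeros of the determinant. In each complementary sector one
  exponential should dominate, but on the bounding rays a term with coefficient \<beta> has the same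
  order, so domination rests on \<beta> being less than 1; the constants are tuned to
  \<open>\<beta> \<le> 1 / 2\<close>. Near the origin nothing dominates and a Taylor expansion takes
  over; the two estimates meet at \<open>|l| = 2\<close>.

  A second obstacle is that \<open>transform\<close> is defined by cases on the contours. It is
  compared there with the analytic functions \<open>Fm\<close> and \<open>Fp\<close>, and all
  deformations are done with those.\<close>

definition lap :: "real \<Rightarrow> real \<Rightarrow> (real \<Rightarrow> complex) \<Rightarrow> complex \<Rightarrow> complex" where
  "lap a b g w = integral {a..b} (\<lambda>y. exp (w * of_real y) * g y)"

lemma continuous_on_lap_integrand [continuous_intros]:
  assumes "continuous_on S g"
  shows "continuous_on S (\<lambda>y. exp (w * of_real y) * g y :: complex)"
  by (intro continuous_intros assms)

lemma lap_integrable: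
  assumes "continuous_on {a..b} g"
  shows "(\<lambda>y. exp (w * of_real y) * g y :: complex) integrable_on {a..b}"
  by (intro integrable_continuous_interval continuous_intros assms)

lemma lap_cong:
  assumes "\<And>y. y \<in> {a..b} \<Longrightarrow> g y = h y"
  shows "lap a b g w = lap a b h w"
  unfolding lap_def using assms by (intro Henstock_Kurzweil_Integration.integral_cong) simp

lemma lap_add:
  assumes "continuous_on {a..b} g" "continuous_on {a..b} h"
  shows "lap a b (\<lambda>y. g y + h y) w = lap a b g w + lap a b h w"
  unfolding lap_def distrib_left
  by (intro Henstock_Kurzweil_Integration.integral_add lap_integrable assms)

lemma lap_cmult: "lap a b (\<lambda>y. c * g y) w = c * lap a b g w"
  unfolding lap_def by (subst integral_mult_right[symmetric]) (simp add: mult_ac)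

lemma lap_combine:
  assumes "continuous_on {a..b} g" "a \<le> c" "c \<le> b"
  shows "lap a c g w + lap c b g w = lap a b g w"
  unfolding lap_def
  by (intro Henstock_Kurzweil_Integration.integral_combine assms lap_integrable)

lemma holomorphic_lap:
  assumes "continuous_on {a..b} g"
  shows "lap a b g holomorphic_on UNIV"
proof -
  have "(\<lambda>w. integral (cbox a b) (\<lambda>y. exp (w * of_real y) * g y)) holomorphic_on UNIV"
  proof (rule leibniz_rule_holomorphic[where fx = "\<lambda>w y. of_real y * exp (w * of_real y) * g y"])
    show "((\<lambda>w. exp (w * of_real y) * g y) has_field_derivative of_real y * exp (w * of_real y) * g y)
        (at w within UNIV)" for w and y :: real
      by (auto intro!: derivative_eq_intros)
    show "(\<lambda>y. exp (w * of_real y) * g y) integrable_on cbox a b" for w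
      using lap_integrable[OF assms] by simp
    have "continuous_on (UNIV \<times> {a..b}) (\<lambda>p. g (snd p))"
      by (rule continuous_on_compose2[OF assms]) (auto intro!: continuous_intros)
    then show "continuous_on (UNIV \<times> cbox a b) (\<lambda>(w, y). of_real y * exp (w * of_real y) * g y)"
      by (auto simp: split_beta intro!: continuous_intros)
  qed auto
  then show ?thesis
    by (simp add: lap_def[abs_def])
qed

text \<open>The modulus of the kernel is monotone in \<open>y\<close>, so it peaks at an end point.
  Keeping the maximum over both ends serves both signs of \<open>Re w\<close>, hence both half
  planes, at once.\<close>

lemma norm_lap_le:
  assumes g: "continuous_on {a..b} g" and "a \<le> b" and M: "\<And>y. y \<in> {a..b} \<Longrightarrow> norm (g y) \<le> M"
  shows "norm (lap a b g w) \<le> M * (b - a) * max (exp (Re w * a)) (exp (Re w * b))"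
proof -
  let ?m = "max (exp (Re w * a)) (exp (Re w * b))"
  have M0: "0 \<le> M"
    using M[of a] norm_ge_zero[of "g a"] \<open>a \<le> b\<close> by (auto simp del: norm_ge_zero)
  have "norm (lap a b g w) \<le> M * ?m * (b - a)"
    unfolding lap_def
  proof (rule integral_bound)
    show "continuous_on {a..b} (\<lambda>y. exp (w * of_real y) * g y)"
      by (intro continuous_intros g)
    fix y assume y: "y \<in> {a..b}"
    have "Re w * y \<le> max (Re w * a) (Re w * b)"
      using y by (cases "Re w \<ge> 0") (auto simp: le_max_iff_disj mult_left_mono mult_left_mono_neg)
    then have "exp (Re w * y) \<le> ?m"
      by (auto simp: le_max_iff_disj)
    then have "exp (Re w * y) * norm (g y) \<le> ?m * M"
      using M[OF y] M0 by (intro mult_mono) (auto simp: le_max_iff_disj)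
    then show "norm (exp (w * of_real y) * g y) \<le> M * ?m"
      by (simp add: norm_mult mult.commute)
  qed (use \<open>a \<le> b\<close> in auto)
  then show ?thesis by (simp add: mult_ac)
qed

lemma lap_by_parts:
  assumes "a \<le> b" and g': "\<And>y. y \<in> {a..b} \<Longrightarrow> (g has_vector_derivative g' y) (at y within {a..b})"
    and "continuous_on {a..b} g'"
  shows "w * lap a b g w = exp (w * of_real b) * g b - exp (w * of_real a) * g a - lap a b g' w"
proof -
  have g: "continuous_on {a..b} g"
    using continuous_on_vector_derivative g' by blast
  have "((\<lambda>y. exp (w * of_real y) * g' y + w * exp (w * of_real y) * g y) has_integral
      exp (w * of_real b) * g b - exp (w * of_real a) * g a) {a..b}"
  proof (rule fundamental_theorem_of_calculus[OF \<open>a \<le> b\<close>])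
    fix y assume "y \<in> {a..b}"
    then show "((\<lambda>y. exp (w * of_real y) * g y) has_vector_derivative
        exp (w * of_real y) * g' y + w * exp (w * of_real y) * g y) (at y within {a..b})"
      by (auto intro!: derivative_eq_intros g' has_vector_derivative_real_field)
  qed
  moreover have "((\<lambda>y. exp (w * of_real y) * g' y + w * exp (w * of_real y) * g y) has_integral
      lap a b g' w + w * lap a b g w) {a..b}"
    unfolding lap_def
    unfolding mult.assoc
    by (intro has_integral_add has_integral_mult_right integrable_integral[OF lap_integrable] assms g)
  ultimately have "lap a b g' w + w * lap a b g w
      = exp (w * of_real b) * g b - exp (w * of_real a) * g a"
    using has_integral_unique by blast
  then show ?thesis by (simp add: algebra_simps)
qed

text \<open>One integration by parts. It is meant for boundary values in time, where
  \<open>w\<close> is \<open>- (\<i> * l ^ 3)\<close>, so that a single power of \<open>w\<close> is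
  worth three powers of \<open>l\<close>.\<close>

lemma lap_bound1:
  assumes "a \<le> b" and g': "\<And>y. y \<in> {a..b} \<Longrightarrow> (g has_vector_derivative g' y) (at y within {a..b})"
    and "continuous_on {a..b} g'"
  obtains C where "C \<ge> 0"
    "\<And>w. norm (w * lap a b g w) \<le> C * max (exp (Re w * a)) (exp (Re w * b))"
proof -
  have "bounded (g' ` {a..b})"
    by (intro compact_imp_bounded compact_continuous_image assms) auto
  then obtain M where "\<forall>z\<in>g' ` {a..b}. norm z \<le> M"
    unfolding bounded_iff ..
  then have M: "\<And>y. y \<in> {a..b} \<Longrightarrow> norm (g' y) \<le> M"
    by simp
  have M0: "0 \<le> M"
    using M[of a] norm_ge_zero[of "g' a"] \<open>a \<le> b\<close> by (auto simp del: norm_ge_zero)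
  show ?thesis
  proof (rule that[of "norm (g b) + norm (g a) + M * (b - a)"])
    show "0 \<le> norm (g b) + norm (g a) + M * (b - a)"
      using M0 \<open>a \<le> b\<close> by auto
    fix w
    let ?m = "max (exp (Re w * a)) (exp (Re w * b))"
    have "norm (w * lap a b g w)
        \<le> norm (exp (w * of_real b) * g b) + norm (exp (w * of_real a) * g a) + norm (lap a b g' w)"
      by (subst lap_by_parts[OF assms])
        (auto intro: order_trans[OF norm_triangle_ineq4] add_right_mono[OF norm_triangle_ineq4])
    also have "\<dots> \<le> ?m * norm (g b) + ?m * norm (g a) + M * (b - a) * ?m"
      by (intro add_mono norm_lap_le M assms) (auto simp: norm_mult intro!: mult_right_mono)
    also have "\<dots> = (norm (g b) + norm (g a) + M * (b - a)) * ?m"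
      by (simp add: algebra_simps)
    finally show "norm (w * lap a b g w) \<le> (norm (g b) + norm (g a) + M * (b - a)) * ?m" .
  qed
qed

text \<open>The end-point terms of the first integration by parts stay explicit: they vanish when
  \<open>g\<close> is zero at both ends, but at an interior splitting point they are the source of
  the value \<open>g x\<close> in Fourier inversion.\<close>

lemma lap_bound2:
  assumes "a \<le> b" and g': "\<And>y. y \<in> {a..b} \<Longrightarrow> (g has_vector_derivative g' y) (at y within {a..b})"
    and g'': "\<And>y. y \<in> {a..b} \<Longrightarrow> (g' has_vector_derivative g'' y) (at y within {a..b})"
    and "continuous_on {a..b} g''"
  obtains C where "C \<ge> 0"
    "\<And>w. norm (w\<^sup>2 * lap a b g w - w * (exp (w * of_real b) * g b - exp (w * of_real a) * g a))
       \<le> C * max (exp (Re w * a)) (exp (Re w * b))"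
proof -
  have cont: "continuous_on {a..b} g'"
    using continuous_on_vector_derivative g'' by blast
  obtain C where C: "C \<ge> 0"
    "\<And>w. norm (w * lap a b g' w) \<le> C * max (exp (Re w * a)) (exp (Re w * b))"
    using lap_bound1[OF \<open>a \<le> b\<close> g'' assms(4)] by blast
  show ?thesis
  proof (rule that[OF C(1)])
    fix w
    have "w\<^sup>2 * lap a b g w - w * (exp (w * of_real b) * g b - exp (w * of_real a) * g a)
        = w * (w * lap a b g w - (exp (w * of_real b) * g b - exp (w * of_real a) * g a))"
      by (simp add: algebra_simps power2_eq_square)
    also have "\<dots> = - (w * lap a b g' w)"
      by (subst lap_by_parts[OF \<open>a \<le> b\<close> g' cont]) auto
    finally show "norm (w\<^sup>2 * lap a b g w - w * (exp (w * of_real b) * g b - exp (w * of_real a) * g a))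
        \<le> C * max (exp (Re w * a)) (exp (Re w * b))"
      using C(2)[of w] by simp
  qed
qed

section \<open>Contour integrals in polar coordinates\<close>

text \<open>Angles are plain reals rather than values of \<open>Arg\<close>, so that sectors in the
  lower half plane and full turns need no branch of the argument.\<close>

definition polar_region :: "real set \<Rightarrow> real set \<Rightarrow> complex set" where
  "polar_region A B = {of_real r * cis \<theta> | r \<theta>. r \<in> A \<and> \<theta> \<in> B}"

lemma polar_regionI [intro]: "r \<in> A \<Longrightarrow> \<theta> \<in> B \<Longrightarrow> of_real r * cis \<theta> \<in> polar_region A B"
  by (auto simp: polar_region_def)

lemma polar_regionI_cis [intro]: "1 \<in> A \<Longrightarrow> \<theta> \<in> B \<Longrightarrow> cis \<theta> \<in> polar_region A B"
  using polar_regionI[of 1 A \<theta> B] by simp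

lemma polar_region_mono: "A \<subseteq> A' \<Longrightarrow> B \<subseteq> B' \<Longrightarrow> polar_region A B \<subseteq> polar_region A' B'"
  by (auto simp: polar_region_def)

lemma linepath_ray:
  "linepath (of_real r * cis a) (of_real s * cis a) x = of_real ((1 - x) * r + x * s) * cis a"
  by (simp add: linepath_def scaleR_conv_of_real algebra_simps)

lemma segment_ray_subset:
  assumes "r \<in> {p..q}" "s \<in> {p..q}" "a \<in> B"
  shows "closed_segment (of_real r * cis a) (of_real s * cis a) \<subseteq> polar_region {p..q} B"
proof
  fix z assume "z \<in> closed_segment (of_real r * cis a) (of_real s * cis a)"
  then obtain x where x: "0 \<le> x" "x \<le> 1" "z = of_real ((1 - x) * r + x * s) * cis a"
    unfolding path_image_linepath[symmetric] path_image_def using linepath_ray by fastforce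
  have "(1 - x) * r + x * s \<in> {p..q}"
    using convexD_alt[OF convex_real_interval(5), of r p q s x] assms x by simp
  then show "z \<in> polar_region {p..q} B"
    using x(3) assms(3) by blast
qed

section \<open>Cauchy's theorem on annular sectors\<close>

lemma polar_Cauchy:
  assumes r: "0 < r" "r \<le> s" and "a < b"
    and h: "h analytic_on polar_region {r..s} {a..b}"
  shows "contour_integral (linepath (of_real r * cis a) (of_real s * cis a)) h
       + contour_integral (part_circlepath 0 s a b) h
       = contour_integral (part_circlepath 0 r a b) h
       + contour_integral (linepath (of_real r * cis b) (of_real s * cis b)) h"
proof -
  \<comment> \<open>In logarithmic coordinates the region is a rectangle, hence convex.\<close>
  define S where "S = cbox (Complex (ln r) a) (Complex (ln s) b)"
  define G where "G = (\<lambda>w. h (exp w) * exp w)"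
  have in_S: "Complex (ln q) \<theta> \<in> S" if "q \<in> {r..s}" "\<theta> \<in> {a..b}" for q \<theta>
    using that r by (auto simp: S_def in_cbox_complex_iff)
  have exp_S: "exp (Complex u v) = of_real (exp u) * cis v" for u v
    by (simp add: exp_eq_polar)
  have G_diff: "G field_differentiable at w" if "w \<in> S" for w
  proof -
    have "exp w \<in> polar_region {r..s} {a..b}"
    proof -
      have "exp (Re w) \<in> {r..s}"
        using that r exp_le_cancel_iff[of "ln r" "Re w"] exp_le_cancel_iff[of "Re w" "ln s"]
        by (auto simp: S_def in_cbox_complex_iff simp del: exp_le_cancel_iff)
      moreover have "Im w \<in> {a..b}"
        using that by (auto simp: S_def in_cbox_complex_iff)
      moreover have "exp w = of_real (exp (Re w)) * cis (Im w)"
        by (rule exp_eq_polar)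
      ultimately show ?thesis by auto
    qed
    then have "h field_differentiable at (exp w)"
      using h analytic_on_imp_differentiable_at by blast
    then have "(\<lambda>w. h (exp w)) field_differentiable at w"
      using field_differentiable_compose[of exp w h] field_differentiable_within_exp[of w UNIV]
      by (simp add: o_def)
    then show ?thesis
      unfolding G_def by (intro field_differentiable_mult field_differentiable_within_exp)
  qed
  \<comment> \<open>The primitive lives on the rectangle, not on its image under \<open>exp\<close>.
    Hence a full turn \<open>b - a = 2 * pi\<close> is allowed even if \<open>h\<close> has a
    residue inside the inner circle. Each of the four sides contributes a difference of
    \<open>P\<close> at two corners.\<close>
  obtain P where P: "\<And>w. w \<in> S \<Longrightarrow> (P has_field_derivative G w) (at w within S)"
  proof (rule holomorphic_convex_primitive[of S "{}" G])
    show "convex S" by (simp add: S_def convex_box)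
    show "continuous_on S G"
      using G_diff field_differentiable_imp_continuous_at continuous_at_imp_continuous_on by blast
    show "G field_differentiable at x" if "x \<in> interior S - {}" for x
      using that interior_subset G_diff by blast
  qed auto
  have ray: "(h has_contour_integral P (Complex (ln s) \<theta>) - P (Complex (ln r) \<theta>))
      (linepath (of_real r * cis \<theta>) (of_real s * cis \<theta>))" if \<theta>: "\<theta> \<in> {a..b}" for \<theta>
  proof -
    let ?q = "\<lambda>x. (1 - x) * r + x * s"
    let ?f = "\<lambda>x. Complex (ln (?q x)) \<theta>"
    have "((\<lambda>x. h (linepath (of_real r * cis \<theta>) (of_real s * cis \<theta>) x) * (of_real s * cis \<theta> - of_real r * cis \<theta>))
       has_integral (P \<circ> ?f) 1 - (P \<circ> ?f) 0) {0..1}"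
    proof (rule fundamental_theorem_of_calculus)
      fix x :: real assume x: "x \<in> {0..1}"
      have q_in: "?q y \<in> {r..s}" if "y \<in> {0..1}" for y
        using convexD_alt[OF convex_real_interval(5), of r r s s y] that r by simp
      have q0: "?q x > 0" using q_in[OF x] r by simp
      have "((\<lambda>x. of_real (ln (?q x)) + \<i> * of_real \<theta>) has_vector_derivative of_real ((s - r) / ?q x)) (at x within {0..1})"
        using q0 by (auto intro!: derivative_eq_intros simp: has_real_derivative_iff_has_vector_derivative[symmetric])
      then have "(?f has_vector_derivative of_real ((s - r) / ?q x)) (at x within {0..1})"
        by (simp add: Complex_eq)
      moreover have "(P has_field_derivative G (?f x)) (at (?f x) within ?f ` {0..1})"
        by (rule DERIV_subset[OF P]) (use q_in in_S x \<theta> in auto)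
      ultimately have "((P \<circ> ?f) has_vector_derivative of_real ((s - r) / ?q x) * G (?f x)) (at x within {0..1})"
        by (rule field_vector_diff_chain_within)
      moreover have "of_real ((s - r) / ?q x) * G (?f x)
          = h (linepath (of_real r * cis \<theta>) (of_real s * cis \<theta>) x) * (of_real s * cis \<theta> - of_real r * cis \<theta>)"
      proof -
        have e: "exp (?f x) = of_real (?q x) * cis \<theta>"
          unfolding exp_S using q0 by simp
        have "of_real ((s - r) / ?q x) * (of_real (?q x) * cis \<theta>) = of_real s * cis \<theta> - of_real r * cis \<theta>"
        proof -
          have *: "u / v * v = u" if "v > 0" for u v :: real
            using that by simp
          have "of_real ((s - r) / ?q x) * of_real (?q x) = (of_real (s - r) :: complex)"
            unfolding of_real_mult[symmetric] by (intro arg_cong[of _ _ of_real] *[OF q0])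
          then show ?thesis
            unfolding mult.assoc[symmetric] by (simp add: left_diff_distrib)
        qed
        then show ?thesis
          unfolding G_def e linepath_ray by (simp only: mult.left_commute[of _ "h _"])
      qed
      ultimately show "((P \<circ> ?f) has_vector_derivative
         h (linepath (of_real r * cis \<theta>) (of_real s * cis \<theta>) x) * (of_real s * cis \<theta> - of_real r * cis \<theta>)) (at x within {0..1})"
        by simp
    qed auto
    then show ?thesis
      by (simp add: has_contour_integral_linepath)
  qed
  have arc: "(h has_contour_integral P (Complex (ln q) b) - P (Complex (ln q) a)) (part_circlepath 0 q a b)"
    if q: "q \<in> {r..s}" for q
  proof -
    let ?f = "\<lambda>x. Complex (ln q) x"
    have q0: "q > 0" using q r by auto
    have "((\<lambda>t. h (0 + q * cis t) * q * \<i> * cis t) has_integral (P \<circ> ?f) b - (P \<circ> ?f) a) {a..b}"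
    proof (rule fundamental_theorem_of_calculus)
      fix t assume t: "t \<in> {a..b}"
      have "((\<lambda>t. of_real (ln q) + \<i> * of_real t) has_vector_derivative \<i>) (at t within {a..b})"
        by (auto intro!: derivative_eq_intros)
      then have "(?f has_vector_derivative \<i>) (at t within {a..b})"
        by (simp add: Complex_eq)
      moreover have "(P has_field_derivative G (?f t)) (at (?f t) within ?f ` {a..b})"
        by (rule DERIV_subset[OF P]) (use q in_S t in auto)
      ultimately have "((P \<circ> ?f) has_vector_derivative \<i> * G (?f t)) (at t within {a..b})"
        by (rule field_vector_diff_chain_within)
      moreover have "\<i> * G (?f t) = h (0 + q * cis t) * q * \<i> * cis t"
        unfolding G_def exp_S using q0 by simp
      ultimately show "((P \<circ> ?f) has_vector_derivative h (0 + q * cis t) * q * \<i> * cis t) (at t within {a..b})"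
        by simp
    qed (use \<open>a < b\<close> in auto)
    then show ?thesis
      using \<open>a < b\<close> by (simp add: has_contour_integral_part_circlepath_iff)
  qed
  have "a \<in> {a..b}" "b \<in> {a..b}" "r \<in> {r..s}" "s \<in> {r..s}"
    using assms by auto
  then show ?thesis
    using ray[THEN contour_integral_unique] arc[THEN contour_integral_unique] by simp
qed

section \<open>Improper integrals along rays and limits over large arcs\<close>

definition has_ray_integral :: "(complex \<Rightarrow> complex) \<Rightarrow> complex \<Rightarrow> real \<Rightarrow> bool" where
  "has_ray_integral h I a \<longleftrightarrow>
     ((\<lambda>R. contour_integral (linepath (cis a) (of_real R * cis a)) h) \<longlongrightarrow> I) at_top"

lemma has_contour_integral_ray_iff:
  assumes "r < s"
  shows "(h has_contour_integral I) (linepath (of_real r * cis a) (of_real s * cis a)) \<longleftrightarrow>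
    ((\<lambda>x. h (of_real x * cis a) * cis a) has_integral I) {r..s}"
proof -
  have "((\<lambda>x. h (of_real x * cis a) * cis a) has_integral I) {r..s} \<longleftrightarrow>
    ((\<lambda>z. h (z * cis a) * cis a) has_contour_integral I) (linepath (of_real r) (of_real s))"
    by (subst has_contour_integral_linepath_Reals_iff) (use assms in auto)
  also have "\<dots> \<longleftrightarrow> (h has_contour_integral I) (linepath (of_real r * cis a) (of_real s * cis a))"
    unfolding has_contour_integral_linepath
    by (intro has_integral_cong) (simp add: linepath_def scaleR_conv_of_real algebra_simps)
  finally show ?thesis ..
qed

lemma contour_integral_ray:
  assumes "r \<le> s" and "continuous_on (polar_region {r..s} {a}) h"
  shows "contour_integral (linepath (of_real r * cis a) (of_real s * cis a)) h
     = integral {r..s} (\<lambda>x. h (of_real x * cis a) * cis a)"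
proof (cases "r = s")
  case False
  then have "r < s" using assms by simp
  have "(\<lambda>x. h (of_real x * cis a) * cis a) integrable_on {r..s}"
    by (intro integrable_continuous_interval continuous_intros continuous_on_compose2[OF assms(2)]) auto
  then show ?thesis
    using has_contour_integral_ray_iff[OF \<open>r < s\<close>] contour_integral_unique integrable_integral by blast
qed simp

text \<open>Comparison with \<open>C / x\<^sup>2\<close> bounds the tail beyond \<open>R\<close> by
  \<open>C / R\<close>. Completeness gives a limit along the integers, and the same tail bound
  carries it over to real \<open>R\<close>.\<close>

lemma ray_integral_exists:
  assumes cont: "continuous_on (polar_region {1..} {a}) h"
    and bound: "\<And>l. l \<in> polar_region {1..} {a} \<Longrightarrow> norm (h l) \<le> C / (norm l)\<^sup>2"
  obtains I where "has_ray_integral h I a"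
proof -
  define f where "f = (\<lambda>x. h (of_real x * cis a) * cis a)"
  define F where "F = (\<lambda>R. integral {1..R} f)"
  have f: "continuous_on {1..R} f" for R
    unfolding f_def by (intro continuous_intros continuous_on_compose2[OF cont]) auto
  have C0: "C \<ge> 0"
    using order_trans[OF norm_ge_zero bound[OF polar_regionI_cis, of a]] by simp
  have diff: "norm (F S - F R) \<le> C / R" if "1 \<le> R" "R \<le> S" for R S
  proof -
    have fi: "f integrable_on {R..S}" and fi': "f integrable_on {1..S}"
      using that f[of S] by (auto intro!: integrable_continuous_interval elim: continuous_on_subset)
    have "F S - F R = integral {R..S} f"
      unfolding F_def using Henstock_Kurzweil_Integration.integral_combine[OF that fi'] by (simp add: algebra_simps)
    moreover have "((\<lambda>x. C / x\<^sup>2) has_integral (- C / S) - (- C / R)) {R..S}"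
    proof (rule fundamental_theorem_of_calculus)
      fix x assume "x \<in> {R..S}"
      then have "x \<noteq> 0" using that by auto
      then show "((\<lambda>x. - C / x) has_vector_derivative C / x\<^sup>2) (at x within {R..S})"
        unfolding has_real_derivative_iff_has_vector_derivative[symmetric]
        by (auto intro!: derivative_eq_intros simp: power2_eq_square)
    qed (use that in auto)
    moreover have "norm (f x) \<le> C / x\<^sup>2" if "x \<in> {R..S}" for x
      using bound[OF polar_regionI[of x "{1..}" a]] that \<open>1 \<le> R\<close> by (auto simp: f_def norm_mult)
    ultimately have "norm (F S - F R) \<le> (- C / S) - (- C / R)"
      using integral_norm_bound_integral[OF fi, of "\<lambda>x. C / x\<^sup>2"]
      by (metis (no_types, lifting) has_integral_integrable integral_unique)
    also have "\<dots> \<le> C / R"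
      using C0 that by simp
    finally show ?thesis .
  qed
  have "Cauchy (\<lambda>n. F (1 + real n))"
  proof (rule CauchyI')
    fix e :: real assume "e > 0"
    obtain M :: nat where M: "C / e < real M"
      using reals_Archimedean2 by blast
    show "\<exists>M. \<forall>m\<ge>M. \<forall>n>m. dist (F (1 + real m)) (F (1 + real n)) < e"
    proof (intro exI allI impI)
      fix m n :: nat assume mn: "m \<ge> M" "n > m"
      have "norm (F (1 + real m) - F (1 + real n)) \<le> C / (1 + real m)"
        using diff[of "1 + real m" "1 + real n"] mn by (simp add: norm_minus_commute)
      also have "\<dots> < e"
      proof -
        have "C < e * real M" using M \<open>e > 0\<close> by (simp add: field_simps)
        also have "\<dots> \<le> e * (1 + real m)" using mn \<open>e > 0\<close> by (intro mult_left_mono) auto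
        finally show ?thesis by (simp add: field_simps)
      qed
      finally show "dist (F (1 + real m)) (F (1 + real n)) < e"
        by (simp add: dist_norm)
    qed
  qed
  then obtain L where L: "(\<lambda>n. F (1 + real n)) \<longlonglongrightarrow> L"
    using Cauchy_convergent convergent_def by blast
  have "norm (F R - L) \<le> C / R" if "R \<ge> 1" for R
  proof -
    have "(\<lambda>n. norm (F (1 + real n) - F R)) \<longlonglongrightarrow> norm (L - F R)"
      by (intro tendsto_intros L)
    moreover have "eventually (\<lambda>n. norm (F (1 + real n) - F R) \<le> C / R) sequentially"
    proof (rule eventually_mono[OF eventually_ge_at_top[of "nat \<lceil>R\<rceil>"]])
      fix n assume "nat \<lceil>R\<rceil> \<le> n"
      then have "R \<le> 1 + real n" by linarith
      then show "norm (F (1 + real n) - F R) \<le> C / R"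
        using diff that by blast
    qed
    ultimately show ?thesis
      using tendsto_upperbound[of _ _ sequentially "C / R"] by (simp add: norm_minus_commute)
  qed
  then have "eventually (\<lambda>R. norm (F R - L) \<le> C / R) at_top"
    by (intro eventually_mono[OF eventually_ge_at_top[of 1]]) auto
  moreover have "((\<lambda>R. C / R) \<longlongrightarrow> 0) at_top"
    by (intro tendsto_divide_0[OF tendsto_const] filterlim_at_top_imp_at_infinity filterlim_ident)
  ultimately have "((\<lambda>R. F R - L) \<longlongrightarrow> 0) at_top"
    by (rule Lim_null_comparison)
  then have "(F \<longlongrightarrow> L) at_top"
    by (simp add: LIM_zero_iff)
  moreover have "eventually (\<lambda>R. F R = contour_integral (linepath (cis a) (of_real R * cis a)) h) at_top"
  proof (rule eventually_mono[OF eventually_ge_at_top[of 1]])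
    fix R :: real assume "1 \<le> R"
    then show "F R = contour_integral (linepath (cis a) (of_real R * cis a)) h"
      unfolding F_def f_def
      using contour_integral_ray[of 1 R a h] continuous_on_subset[OF cont polar_region_mono[of "{1..R}" "{1..}" "{a}" "{a}"]]
      by auto
  qed
  ultimately have "has_ray_integral h L a"
    unfolding has_ray_integral_def by (rule Lim_transform_eventually)
  then show ?thesis
    by (rule that)
qed

text \<open>On large arcs \<open>h\<close> behaves like \<open>m / l\<close>, whose integral is
  exactly \<open>m * \<i> * (b - a)\<close>; the error is at most \<open>C / R\<^sup>2\<close> on an
  arc of length \<open>R * (b - a)\<close>.\<close>

lemma arc_integral_limit:
  assumes "a < b"
    and cont: "continuous_on (polar_region {1..} {a..b}) h"
    and bound: "\<And>l. l \<in> polar_region {1..} {a..b} \<Longrightarrow> norm (l * h l - m) \<le> C / norm l"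
  shows "((\<lambda>R. contour_integral (part_circlepath 0 R a b) h) \<longlongrightarrow> m * \<i> * of_real (b - a)) at_top"
proof -
  have "norm (contour_integral (part_circlepath 0 R a b) h - m * \<i> * of_real (b - a)) \<le> C * (b - a) / R"
    if "R \<ge> 1" for R
  proof -
    let ?f = "\<lambda>t. h (0 + R * cis t) * R * \<i> * cis t"
    have cont': "continuous_on {a..b} (\<lambda>t. h (0 + R * cis t))"
      by (intro continuous_intros continuous_on_compose2[OF cont]) (use that in auto)
    have f: "?f integrable_on {a..b}"
      by (intro integrable_continuous_interval continuous_intros cont')
    have eq: "contour_integral (part_circlepath 0 R a b) h = integral {a..b} ?f"
      using f has_contour_integral_part_circlepath_iff[OF \<open>a < b\<close>] contour_integral_unique
        integrable_integral by blast
    have "norm (integral {a..b} (\<lambda>t. ?f t - m * \<i>)) \<le> (C / R) * (b - a)"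
    proof (rule integral_bound)
      show "continuous_on {a..b} (\<lambda>t. ?f t - m * \<i>)"
        by (intro continuous_intros cont')
      fix t assume t: "t \<in> {a..b}"
      have "?f t - m * \<i> = \<i> * ((R * cis t) * h (R * cis t) - m)"
        by (simp add: algebra_simps)
      then have "norm (?f t - m * \<i>) = norm ((R * cis t) * h (R * cis t) - m)"
        by (simp add: norm_mult)
      also have "\<dots> \<le> C / R"
        using bound[OF polar_regionI[of R "{1..}" t]] t that by (auto simp: norm_mult)
      finally show "norm (?f t - m * \<i>) \<le> C / R" .
    qed (use \<open>a < b\<close> in auto)
    moreover have "integral {a..b} (\<lambda>t. ?f t - m * \<i>) = integral {a..b} ?f - m * \<i> * of_real (b - a)"
      using \<open>a < b\<close> f by (subst Henstock_Kurzweil_Integration.integral_diff)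
        (auto simp: scaleR_conv_of_real mult_ac)
    ultimately show ?thesis by (simp add: eq)
  qed
  then have "eventually (\<lambda>R. norm (contour_integral (part_circlepath 0 R a b) h - m * \<i> * of_real (b - a)) \<le> C * (b - a) / R) at_top"
    by (intro eventually_mono[OF eventually_ge_at_top[of 1]]) auto
  moreover have "((\<lambda>R. C * (b - a) / R) \<longlongrightarrow> 0) at_top"
    by (intro tendsto_divide_0[OF tendsto_const] filterlim_at_top_imp_at_infinity filterlim_ident)
  ultimately have "((\<lambda>R. contour_integral (part_circlepath 0 R a b) h - m * \<i> * of_real (b - a)) \<longlongrightarrow> 0) at_top"
    by (rule Lim_null_comparison)
  then show ?thesis
    by (simp add: LIM_zero_iff)
qed

text \<open>The limit is taken of the difference of the two rays at a common radius. For nonzero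
  \<open>m\<close> each ray integral alone diverges logarithmically.\<close>

lemma sector_Cauchy:
  assumes "a < b"
    and h: "h analytic_on polar_region {1..} {a..b}"
    and bound: "\<And>l. l \<in> polar_region {1..} {a..b} \<Longrightarrow> norm (l * h l - m) \<le> C / norm l"
  shows "((\<lambda>R. contour_integral (linepath (cis a) (of_real R * cis a)) h
             - contour_integral (linepath (cis b) (of_real R * cis b)) h)
         \<longlongrightarrow> contour_integral (part_circlepath 0 1 a b) h - m * \<i> * of_real (b - a)) at_top"
proof -
  have "((\<lambda>R. contour_integral (part_circlepath 0 1 a b) h - contour_integral (part_circlepath 0 R a b) h)
         \<longlongrightarrow> contour_integral (part_circlepath 0 1 a b) h - m * \<i> * of_real (b - a)) at_top"
    by (intro tendsto_intros arc_integral_limit[OF \<open>a < b\<close> _ bound]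
        analytic_imp_holomorphic[OF h, THEN holomorphic_on_imp_continuous_on])
  moreover have "eventually (\<lambda>R.
      contour_integral (part_circlepath 0 1 a b) h - contour_integral (part_circlepath 0 R a b) h =
      contour_integral (linepath (cis a) (of_real R * cis a)) h
             - contour_integral (linepath (cis b) (of_real R * cis b)) h) at_top"
  proof (rule eventually_mono[OF eventually_ge_at_top[of 1]])
    fix R :: real assume "1 \<le> R"
    moreover have "h analytic_on polar_region {1..R} {a..b}"
      by (rule analytic_on_subset[OF h polar_region_mono]) auto
    ultimately show "contour_integral (part_circlepath 0 1 a b) h - contour_integral (part_circlepath 0 R a b) h =
      contour_integral (linepath (cis a) (of_real R * cis a)) h
             - contour_integral (linepath (cis b) (of_real R * cis b)) h"
      using polar_Cauchy[of 1 R a b h] \<open>a < b\<close> by (simp add: algebra_simps)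
  qed
  ultimately show ?thesis
    by (rule Lim_transform_eventually)
qed

lemma sector_Cauchy_zero:
  assumes "a < b"
    and h: "h analytic_on polar_region {1..} {a..b}"
    and bound: "\<And>l. l \<in> polar_region {1..} {a..b} \<Longrightarrow> norm (h l) \<le> C / (norm l)\<^sup>2"
    and I: "has_ray_integral h I a" "has_ray_integral h J b"
  shows "I - J = contour_integral (part_circlepath 0 1 a b) h"
proof -
  have "norm (l * h l - 0) \<le> C / norm l" if "l \<in> polar_region {1..} {a..b}" for l
  proof -
    have "norm l > 0" using that by (auto simp: polar_region_def norm_mult)
    then show ?thesis
      using mult_left_mono[OF bound[OF that], of "norm l"]
      by (simp add: norm_mult power2_eq_square)
  qed
  from sector_Cauchy[OF \<open>a < b\<close> h this]
  have "((\<lambda>R. contour_integral (linepath (cis a) (of_real R * cis a)) h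
             - contour_integral (linepath (cis b) (of_real R * cis b)) h)
         \<longlongrightarrow> contour_integral (part_circlepath 0 1 a b) h) at_top"
    by simp
  moreover have "((\<lambda>R. contour_integral (linepath (cis a) (of_real R * cis a)) h
             - contour_integral (linepath (cis b) (of_real R * cis b)) h) \<longlongrightarrow> I - J) at_top"
    using I unfolding has_ray_integral_def by (intro tendsto_diff)
  ultimately show ?thesis
    using tendsto_unique trivial_limit_at_top_linorder by blast
qed

section \<open>Improper integrals over sector contours\<close>

definition sector_boundary :: "real \<Rightarrow> real \<Rightarrow> complex set" where
  "sector_boundary a b = polar_region {1..} {a} \<union> polar_region {1} {a..b} \<union> polar_region {1..} {b}"

lemma part_circlepath_unit_image:
  assumes "a \<le> b"
  shows "path_image (part_circlepath 0 1 a b) = polar_region {1} {a..b}"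
  using assms by (auto simp: path_image_part_circlepath' polar_region_def closed_segment_eq_real_ivl)

lemma sector_path_image:
  assumes "a \<le> b" "R \<ge> 1" "R' \<ge> 1"
  shows "path_image (sector_path a b R R') \<subseteq> sector_boundary a b"
proof -
  have "path_image (part_circlepath 0 1 b a) = polar_region {1} {a..b}"
    using part_circlepath_unit_image[OF \<open>a \<le> b\<close>] path_image_reversepath[of "part_circlepath 0 1 a b"]
    by simp
  moreover have "closed_segment (of_real R * cis b) (cis b) \<subseteq> polar_region {1..} {b}"
    using segment_ray_subset[of R 1 R 1 b "{b}"] assms polar_region_mono[of "{1..R}" "{1..}" "{b}" "{b}"] by auto
  moreover have "closed_segment (cis a) (of_real R' * cis a) \<subseteq> polar_region {1..} {a}"
    using segment_ray_subset[of 1 1 R' R' a "{a}"] assms polar_region_mono[of "{1..R'}" "{1..}" "{a}" "{a}"] by auto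
  ultimately show ?thesis
    by (auto simp: sector_path_def sector_boundary_def path_image_join cis_conv_exp)
qed

text \<open>The integrand of the theorem contains \<open>transform\<close>, which has a dummy value
  off the contours. This lemma replaces it by an analytic function from agreement on the contour
  alone.\<close>

lemma has_sector_integral_cong:
  assumes "a \<le> b" and eq: "\<And>l. l \<in> sector_boundary a b \<Longrightarrow> g l = h l" and h: "has_sector_integral h J a b"
  shows "has_sector_integral g J a b"
proof -
  have *: "path_image (sector_path a b R R') \<subseteq> sector_boundary a b" if "R \<ge> 1" "R' \<ge> 1" for R R'
    by (rule sector_path_image[OF \<open>a \<le> b\<close> that])
  have "(g has_contour_integral c) (sector_path a b R R') \<longleftrightarrow> (h has_contour_integral c) (sector_path a b R R')"
    if "R \<ge> 1" "R' \<ge> 1" for R R' c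
    using *[OF that] eq has_contour_integral_eq[of g c "sector_path a b R R'" h]
      has_contour_integral_eq[of h c "sector_path a b R R'" g] by (metis subsetD)
  then have i: "g contour_integrable_on sector_path a b R R' \<longleftrightarrow> h contour_integrable_on sector_path a b R R'"
    and c: "contour_integral (sector_path a b R R') h = contour_integral (sector_path a b R R') g"
    if "R \<ge> 1" "R' \<ge> 1" for R R'
    using that by (auto simp: contour_integrable_on_def contour_integral_def)
  have "eventually (\<lambda>p. contour_integral (sector_path a b (fst p) (snd p)) h
      = contour_integral (sector_path a b (fst p) (snd p)) g) (at_top \<times>\<^sub>F at_top)"
    using eventually_prodI[OF eventually_ge_at_top[of 1] eventually_ge_at_top[of 1]]
    by (rule eventually_mono) (auto intro: c)
  then show ?thesis
    using h i unfolding has_sector_integral_def case_prod_beta' by (auto simp: tendsto_cong)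
qed

text \<open>Both rays converge separately, so the two cut-off radii may tend to infinity
  independently. The path comes in along \<open>b\<close>, turns clockwise and leaves along
  \<open>a\<close>, hence the two minus signs.\<close>

lemma has_sector_integralI:
  assumes "a < b" and h: "continuous_on (sector_boundary a b) h"
    and I: "has_ray_integral h I a" "has_ray_integral h J b"
  shows "has_sector_integral h (I - J - contour_integral (part_circlepath 0 1 a b) h) a b"
proof -
  have ca: "h contour_integrable_on linepath (cis a) (of_real R * cis a)"
    and cb: "h contour_integrable_on linepath (cis b) (of_real R * cis b)" if "R \<ge> 1" for R
    using that segment_ray_subset[of 1 1 R R a "{a}"] segment_ray_subset[of 1 1 R R b "{b}"]
      polar_region_mono[of "{1..R}" "{1..}" "{a}" "{a}"] polar_region_mono[of "{1..R}" "{1..}" "{b}" "{b}"]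
    by (auto intro!: contour_integrable_continuous_linepath continuous_on_subset[OF h]
        simp: sector_boundary_def)
  have cc: "h contour_integrable_on part_circlepath 0 1 a b"
    using part_circlepath_unit_image[of a b] \<open>a < b\<close>
    by (auto intro!: contour_integrable_continuous_part_circlepath continuous_on_subset[OF h]
        simp: sector_boundary_def)
  have cb': "h contour_integrable_on linepath (of_real R * cis b) (cis b)" if "R \<ge> 1" for R
    using contour_integrable_reversepath[OF valid_path_linepath cb[OF that]] by simp
  have cc': "h contour_integrable_on part_circlepath 0 1 b a"
    using contour_integrable_reversepath[OF valid_path_part_circlepath cc] by simp
  have int: "h contour_integrable_on sector_path a b R R'" and
    eq: "contour_integral (sector_path a b R R') h =
      contour_integral (linepath (cis a) (of_real R' * cis a)) h
      - contour_integral (linepath (cis b) (of_real R * cis b)) h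
      - contour_integral (part_circlepath 0 1 a b) h" if "R \<ge> 1" "R' \<ge> 1" for R R'
    unfolding sector_path_def
    using ca[OF that(2)] cb'[OF that(1)] cc' contour_integral_reversepath[OF valid_path_linepath, of "cis b" "of_real R * cis b" h]
      contour_integral_part_circlepath_reverse[of 0 1 b a h]
    by (auto simp: valid_path_join cis_conv_exp)
  have "((\<lambda>p. contour_integral (linepath (cis a) (of_real (snd p) * cis a)) h
      - contour_integral (linepath (cis b) (of_real (fst p) * cis b)) h
      - contour_integral (part_circlepath 0 1 a b) h)
     \<longlongrightarrow> I - J - contour_integral (part_circlepath 0 1 a b) h) (at_top \<times>\<^sub>F at_top)"
    using filterlim_compose[OF I(1)[unfolded has_ray_integral_def] filterlim_snd, of at_top]
      filterlim_compose[OF I(2)[unfolded has_ray_integral_def] filterlim_fst, of at_top]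
    by (intro tendsto_intros)
  moreover have "eventually (\<lambda>p. contour_integral (linepath (cis a) (of_real (snd p) * cis a)) h
      - contour_integral (linepath (cis b) (of_real (fst p) * cis b)) h
      - contour_integral (part_circlepath 0 1 a b) h
      = contour_integral (sector_path a b (fst p) (snd p)) h) (at_top \<times>\<^sub>F at_top)"
    using eventually_prodI[OF eventually_ge_at_top[of 1] eventually_ge_at_top[of 1]]
    by (rule eventually_mono) (auto simp: eq)
  ultimately show ?thesis
    using int unfolding has_sector_integral_def case_prod_beta' by (auto simp: tendsto_cong)
qed

lemma has_sector_integral_add:
  assumes "has_sector_integral g I a b" "has_sector_integral h J a b"
  shows "has_sector_integral (\<lambda>l. g l + h l) (I + J) a b"
proof -
  have "eventually (\<lambda>p. contour_integral (sector_path a b (fst p) (snd p)) g + contour_integral (sector_path a b (fst p) (snd p)) h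
      = contour_integral (sector_path a b (fst p) (snd p)) (\<lambda>l. g l + h l)) (at_top \<times>\<^sub>F at_top)"
    using eventually_prodI[OF eventually_ge_at_top[of 1] eventually_ge_at_top[of 1]]
    by (rule eventually_mono)
      (use assms in \<open>auto simp: has_sector_integral_def contour_integral_add\<close>)
  moreover have "((\<lambda>p. contour_integral (sector_path a b (fst p) (snd p)) g + contour_integral (sector_path a b (fst p) (snd p)) h)
      \<longlongrightarrow> I + J) (at_top \<times>\<^sub>F at_top)"
    using assms by (intro tendsto_add) (auto simp: has_sector_integral_def case_prod_beta')
  ultimately show ?thesis
    using assms unfolding has_sector_integral_def case_prod_beta'
    by (auto simp: tendsto_cong intro!: contour_integrable_add)
qed

text \<open>The sector lies free of singularities outside the unit circle, so its boundary can be
  closed by a large arc whose contribution tends to zero. It will dispose of the boundary terms of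
  the evolution.\<close>

lemma has_sector_integral_zero:
  assumes "a < b"
    and h: "h analytic_on polar_region {1..} {a..b}"
    and bound: "\<And>l. l \<in> polar_region {1..} {a..b} \<Longrightarrow> norm (h l) \<le> C / (norm l)\<^sup>2"
  shows "has_sector_integral h 0 a b"
proof -
  have sub: "polar_region {1..} {a} \<subseteq> polar_region {1..} {a..b}" "polar_region {1..} {b} \<subseteq> polar_region {1..} {a..b}"
    "sector_boundary a b \<subseteq> polar_region {1..} {a..b}"
    using \<open>a < b\<close> unfolding sector_boundary_def by (intro Un_least polar_region_mono; auto)+
  have cont: "continuous_on (polar_region {1..} {a..b}) h"
    using h analytic_imp_holomorphic holomorphic_on_imp_continuous_on by blast
  obtain I where I: "has_ray_integral h I a"
    using ray_integral_exists[of a h C] continuous_on_subset[OF cont sub(1)] bound sub(1) by blast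
  obtain J where J: "has_ray_integral h J b"
    using ray_integral_exists[of b h C] continuous_on_subset[OF cont sub(2)] bound sub(2) by blast
  show ?thesis
    using has_sector_integralI[OF \<open>a < b\<close> continuous_on_subset[OF cont sub(3)] I J]
      sector_Cauchy_zero[OF \<open>a < b\<close> h bound I J] by simp
qed

section \<open>The characteristic determinant\<close>

lemma alpha_cis: "\<alpha> = cis (2 * pi / 3)"
  by (simp add: \<alpha>_def cis_conv_exp mult_ac)

lemma alpha_Complex: "\<alpha> = Complex (- 1 / 2) (sqrt 3 / 2)"
  by (simp add: alpha_cis cis.ctr cos_120 sin_120)

lemma alpha_sum: "1 + \<alpha> + \<alpha>\<^sup>2 = 0"
  by (simp add: alpha_Complex complex_eq_iff power2_eq_square)

lemma alpha_square: "\<alpha>\<^sup>2 = - 1 - \<alpha>"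
  using alpha_sum by (simp add: algebra_simps eq_neg_iff_add_eq_0)

lemma alpha_cube: "\<alpha> ^ 3 = 1"
  by (simp add: alpha_cis Complex.DeMoivre)

lemma norm_alpha [simp]: "norm \<alpha> = 1"
  by (simp add: alpha_cis)

lemma Im_alpha_sum: "Im l + Im (\<alpha> * l) + Im (\<alpha>\<^sup>2 * l) = 0"
  using alpha_sum by (metis distrib_right mult_1 mult_zero_left plus_complex.sel(2) zero_complex.sel(2))

lemma alpha_polar:
  "\<alpha> * (of_real r * cis \<theta>) = of_real r * cis (\<theta> + 2 * pi / 3)"
  "\<alpha>\<^sup>2 * (of_real r * cis \<theta>) = of_real r * cis (\<theta> + 4 * pi / 3)"
  by (simp_all add: alpha_cis cis_mult Complex.DeMoivre mult.left_commute[of "cis _"] add.commute)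

text \<open>\<open>\<Delta>1 = 2 * Delta (1/2)\<close> and \<open>\<Delta>2 = Delta 0\<close>; the parameter \<open>\<beta>\<close> is the one in the boundary
  condition \<open>q_x(1,t) = \<beta> q_x(0,t)\<close>.\<close>

definition Delta :: "real \<Rightarrow> complex \<Rightarrow> complex" where
  "Delta \<beta> l = \<beta> * (exp (\<i>*l) + \<alpha> * exp (\<i>*\<alpha>*l) + \<alpha>^2 * exp (\<i>*\<alpha>^2*l))
     + (exp (-\<i>*l) + \<alpha> * exp (-\<i>*\<alpha>*l) + \<alpha>^2 * exp (-\<i>*\<alpha>^2*l))"

text \<open>Multiplication by \<alpha> permutes the three exponentials cyclically. Up to modulus one
  factors this reduces the three complementary sectors to the one around the positive imaginary
  axis.\<close>

lemma Delta_rotate: "Delta \<beta> (\<alpha> * l) = \<alpha>\<^sup>2 * Delta \<beta> l"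
proof -
  have a: "\<alpha> * (\<alpha> * \<alpha>) = 1" "\<alpha> * (\<alpha> * (\<alpha> * w)) = w" for w
    using alpha_cube by (simp_all add: power3_eq_cube mult.assoc[symmetric])
  show ?thesis
    unfolding Delta_def by (simp add: power2_eq_square algebra_simps a)
qed

section \<open>Lower bounds for the determinant\<close>

lemma norm_exp_i: "norm (exp (- \<i> * w)) = exp (Im w)" "norm (exp (\<i> * w)) = exp (- Im w)"
  by simp_all

lemma exp_2_le: "exp (2::real) \<le> 7.4"
proof -
  have "exp (2::real) = (exp 1)\<^sup>2"
    by (simp add: exp_double[symmetric])
  also have "\<dots> \<le> (2.72)\<^sup>2"
    using e_less_272 by (intro power_mono) auto
  also have "\<dots> \<le> 7.4" by (simp add: power2_eq_square)
  finally show ?thesis .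
qed

text \<open>The determinant has a double zero at the origin with leading term
  \<open>3 * (1 + \<beta>) / 2 * z\<^sup>2\<close>. Degree 6 of the Taylor polynomial is just enough
  for that term to win on the whole disc of radius 2.\<close>

lemma Delta_lower_near:
  assumes \<beta>: "0 \<le> \<beta>" "\<beta> \<le> 1" and l: "norm l \<le> 2"
  shows "norm (Delta \<beta> l) \<ge> 0.3 * (norm l)\<^sup>2"
proof -
  define T :: "complex \<Rightarrow> complex" where "T = (\<lambda>w. \<Sum>k\<le>6. w ^ k / fact k)"
  define R where "R = (\<lambda>w. exp w - T w)"
  define z where "z = - \<i> * l"
  define r where "r = norm l"
  have r: "0 \<le> r" "r \<le> 2" "norm z = r"
    using l by (auto simp: r_def z_def norm_mult)
  have bnd: "norm (R w) \<le> exp r * r ^ 7 / 720" if "norm w = r" for w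
    using Taylor_exp_field[of w 6] that unfolding R_def T_def by (simp add: fact_numeral)
  have a: "\<alpha> ^ 3 = 1" "\<alpha> ^ 4 = \<alpha>" "\<alpha> ^ 5 = \<alpha>\<^sup>2" "\<alpha> ^ 6 = 1" "\<alpha> ^ 7 = \<alpha>" "\<alpha> ^ 8 = \<alpha>\<^sup>2"
     "\<alpha> ^ 10 = \<alpha>" "\<alpha> ^ 12 = 1" "\<alpha> ^ 14 = \<alpha>\<^sup>2"
    using alpha_cube power_add[of \<alpha> 3 1] power_add[of \<alpha> 3 2] power_add[of \<alpha> 3 3] power_add[of \<alpha> 6 1]
      power_add[of \<alpha> 6 2] power_add[of \<alpha> 6 4] power_add[of \<alpha> 6 6] power_add[of \<alpha> 12 2]
    by (simp_all add: power_add)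
  have poly: "of_real \<beta> * (T (- z) + \<alpha> * T (- (\<alpha> * z)) + \<alpha>\<^sup>2 * T (- (\<alpha>\<^sup>2 * z)))
      + (T z + \<alpha> * T (\<alpha> * z) + \<alpha>\<^sup>2 * T (\<alpha>\<^sup>2 * z))
      = of_real (3 * (1 + \<beta>) / 2) * z\<^sup>2 + of_real ((1 - \<beta>) / 40) * z ^ 5"
  proof -
    \<comment> \<open>A filter by cube roots of unity:
      \<open>1 + \<alpha> ^ (k + 1) + (\<alpha> ^ (k + 1))\<^sup>2\<close> is 3 when 3 divides
      \<open>k + 1\<close> and 0 otherwise. Only \<open>k = 2\<close> and \<open>k = 5\<close>
      survive, with coefficients \<open>3 / 2!\<close> and \<open>3 / 5!\<close>.\<close>
    have s: "T w + \<alpha> * T (\<alpha> * w) + \<alpha>\<^sup>2 * T (\<alpha>\<^sup>2 * w) = 3 / 2 * w\<^sup>2 + 1 / 40 * w ^ 5" for w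
    proof -
      have "T w + \<alpha> * T (\<alpha> * w) + \<alpha>\<^sup>2 * T (\<alpha>\<^sup>2 * w)
        = (\<Sum>k\<le>6. (1 + \<alpha> ^ (k + 1) + (\<alpha> ^ (k + 1))\<^sup>2) * (w ^ k / fact k))"
        unfolding T_def sum_distrib_left sum.distrib[symmetric]
        by (intro sum.cong refl) (simp add: power_mult_distrib power2_eq_square algebra_simps)
      also have "\<dots> = 3 / 2 * w\<^sup>2 + 1 / 40 * w ^ 5"
      proof -
        have c: "1 + \<alpha> ^ 2 + (\<alpha> ^ 2)\<^sup>2 = 0" "1 + \<alpha> ^ 3 + (\<alpha> ^ 3)\<^sup>2 = 3" "1 + \<alpha> ^ 4 + (\<alpha> ^ 4)\<^sup>2 = 0"
          "1 + \<alpha> ^ 5 + (\<alpha> ^ 5)\<^sup>2 = 0" "1 + \<alpha> ^ 6 + (\<alpha> ^ 6)\<^sup>2 = 3" "1 + \<alpha> ^ 7 + (\<alpha> ^ 7)\<^sup>2 = 0"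
          using alpha_sum by (simp_all add: a power_mult[symmetric] add_ac)
        have a': "1 + \<alpha>\<^sup>2 + \<alpha> = 0"
          using alpha_sum by (simp add: add_ac)
        have p: "\<alpha> * \<alpha> = \<alpha>\<^sup>2" "\<alpha> * \<alpha>\<^sup>2 = \<alpha> ^ 3" "\<alpha> * \<alpha> ^ 3 = \<alpha> ^ 4" "\<alpha> * \<alpha> ^ 4 = \<alpha> ^ 5"
          "\<alpha> * \<alpha> ^ 5 = \<alpha> ^ 6" "\<alpha> * \<alpha> ^ 6 = \<alpha> ^ 7"
          by (simp_all add: eval_nat_numeral mult_ac)
        have set: "{..6::nat} = {0,1,2,3,4,5,6}" by auto
        show ?thesis
          unfolding set by (simp add: p a a' c alpha_sum fact_numeral)
      qed
      finally show ?thesis .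
    qed
    have s': "T (- z) + \<alpha> * T (- (\<alpha> * z)) + \<alpha>\<^sup>2 * T (- (\<alpha>\<^sup>2 * z)) = 3 / 2 * z\<^sup>2 - 1 / 40 * z ^ 5"
      using s[of "- z"] by simp
    show ?thesis
      unfolding s s' by (simp add: field_simps)
  qed
  have "Delta \<beta> l = of_real \<beta> * (exp (- z) + \<alpha> * exp (- (\<alpha> * z)) + \<alpha>\<^sup>2 * exp (- (\<alpha>\<^sup>2 * z)))
      + (exp z + \<alpha> * exp (\<alpha> * z) + \<alpha>\<^sup>2 * exp (\<alpha>\<^sup>2 * z))"
    by (simp add: Delta_def z_def mult_ac)
  also have "\<dots> = of_real (3 * (1 + \<beta>) / 2) * z\<^sup>2 + of_real ((1 - \<beta>) / 40) * z ^ 5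
      + (of_real \<beta> * (R (- z) + \<alpha> * R (- (\<alpha> * z)) + \<alpha>\<^sup>2 * R (- (\<alpha>\<^sup>2 * z)))
      + (R z + \<alpha> * R (\<alpha> * z) + \<alpha>\<^sup>2 * R (\<alpha>\<^sup>2 * z)))" (is "_ = ?A + ?B + (?D + ?E)")
    unfolding poly[symmetric] R_def by (simp add: algebra_simps)
  finally have eq: "?A = Delta \<beta> l - ?B - ?D - ?E" by simp
  have sum3: "norm (R w + \<alpha> * R w' + \<alpha>\<^sup>2 * R w'') \<le> 3 * (exp r * r ^ 7 / 720)"
    if "norm w = r" "norm w' = r" "norm w'' = r" for w w' w''
  proof -
    have "norm (R w + \<alpha> * R w' + \<alpha>\<^sup>2 * R w'') \<le> norm (R w) + norm (\<alpha> * R w') + norm (\<alpha>\<^sup>2 * R w'')"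
      by (intro order_trans[OF norm_triangle_ineq] add_mono norm_triangle_ineq order_refl)
    also have "\<dots> = norm (R w) + norm (R w') + norm (R w'')"
      by (simp add: norm_mult norm_power)
    also have "\<dots> \<le> 3 * (exp r * r ^ 7 / 720)"
      using bnd[OF that(1)] bnd[OF that(2)] bnd[OF that(3)] by simp
    finally show ?thesis .
  qed
  have D: "norm ?D \<le> \<beta> * (3 * (exp r * r ^ 7 / 720))"
    unfolding norm_mult norm_of_real abs_of_nonneg[OF \<beta>(1)]
    using r by (intro mult_left_mono \<beta> sum3) (auto simp: norm_mult norm_power)
  have E: "norm ?E \<le> 3 * (exp r * r ^ 7 / 720)"
    using r by (intro sum3) (auto simp: norm_mult norm_power)
  have B: "norm ?B = (1 - \<beta>) / 40 * r ^ 5"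
    unfolding norm_mult norm_of_real norm_power using \<beta> r by simp
  have A: "norm ?A = 3 * (1 + \<beta>) / 2 * r\<^sup>2"
    using \<beta> r by (simp add: norm_mult norm_power flip: of_real_add)
  have "norm ?A \<le> norm (Delta \<beta> l) + norm ?B + norm ?D + norm ?E"
    unfolding eq by (intro order_trans[OF norm_triangle_ineq4] add_mono order_refl norm_triangle_ineq4)
  then have "norm (Delta \<beta> l) \<ge> 3 * (1 + \<beta>) / 2 * r\<^sup>2 - (1 - \<beta>) / 40 * r ^ 5 - (1 + \<beta>) * (3 * (exp r * r ^ 7 / 720))"
    using A B D E distrib_right[of 1 \<beta> "3 * (exp r * r ^ 7 / 720)"] by linarith
  moreover have "(1 - \<beta>) / 40 * r ^ 5 \<le> (1 + \<beta>) / 5 * r\<^sup>2"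
  proof -
    have "r ^ 5 = r ^ 3 * r\<^sup>2" by (simp add: power_add[symmetric])
    also have "\<dots> \<le> 2 ^ 3 * r\<^sup>2"
      using r by (intro mult_right_mono power_mono) auto
    finally have "(1 - \<beta>) / 40 * r ^ 5 \<le> (1 + \<beta>) / 40 * (8 * r\<^sup>2)"
      using \<beta> r by (intro mult_mono) auto
    then show ?thesis by simp
  qed
  \<comment> \<open>The radius 2 is tuned here: \<open>3 * 7.4 * 32 / 720 < 1\<close>, so the Taylor
    remainder costs at most \<open>(1 + \<beta>) * r\<^sup>2\<close>.\<close>
  moreover have "exp r * r ^ 7 \<le> 7.4 * (32 * r\<^sup>2)"
  proof (rule mult_mono)
    have "exp r \<le> exp 2" using r by simp
    then show "exp r \<le> 7.4" using exp_2_le by linarith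
    have "r ^ 7 = r ^ 5 * r\<^sup>2" by (simp add: power_add[symmetric])
    also have "\<dots> \<le> 2 ^ 5 * r\<^sup>2"
      using r by (intro mult_right_mono power_mono) auto
    finally show "r ^ 7 \<le> 32 * r\<^sup>2" by simp
  qed (use r in auto)
  then have "3 * (exp r * r ^ 7 / 720) \<le> r\<^sup>2"
    using zero_le_power2[of r] by linarith
  then have "(1 + \<beta>) * (3 * (exp r * r ^ 7 / 720)) \<le> (1 + \<beta>) * (r\<^sup>2)"
    using \<beta> by (intro mult_left_mono) auto
  \<comment> \<open>In units of \<open>(1 + \<beta>) * r\<^sup>2\<close>: leading term 3/2,
    fifth-order term 1/5, remainder 1, which leaves 0.3.\<close>
  moreover have "3 * (1 + \<beta>) / 2 * r\<^sup>2 = 3 / 2 * ((1 + \<beta>) * r\<^sup>2)" "(1 + \<beta>) / 5 * r\<^sup>2 = 1 / 5 * ((1 + \<beta>) * r\<^sup>2)"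
    "(1 + \<beta>) * (0.3 * r\<^sup>2) = 0.3 * ((1 + \<beta>) * r\<^sup>2)"
    by simp_all
  ultimately have "norm (Delta \<beta> l) \<ge> (1 + \<beta>) * (0.3 * r\<^sup>2)"
    by linarith
  moreover have "(1 + \<beta>) * (0.3 * r\<^sup>2) \<ge> 1 * (0.3 * r\<^sup>2)"
    using \<beta> by (intro mult_right_mono) auto
  ultimately show ?thesis by (simp add: r_def)
qed

text \<open>\<open>X\<close>, \<open>u\<close>, \<open>v\<close> are the moduli of the three
  exponentials with negative exponent; their product is 1 and \<open>u\<close>, \<open>v\<close> are
  at most 1. The terms with \<beta> have moduli such as
  \<open>\<beta> / u = \<beta> * X * v\<close>, which reaches the order of \<open>X\<close> on a
  bounding ray, so \<open>exp (-\<i>*l)\<close> wins only by the smallness of \<beta>.\<close>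

lemma Delta_lower_far:
  assumes \<beta>: "0 \<le> \<beta>" "\<beta> \<le> 1 / 2" and l: "norm l \<ge> 2"
    and Im: "Im (\<alpha> * l) \<le> 0" "Im (\<alpha>\<^sup>2 * l) \<le> 0"
  shows "norm (exp (- \<i> * l)) \<le> 32 * norm (Delta \<beta> l)"
proof -
  define X u v where "X = exp (Im l)" and "u = exp (Im (\<alpha> * l))" and "v = exp (Im (\<alpha>\<^sup>2 * l))"
  have pos: "X > 0" "u > 0" "v > 0" and le: "u \<le> 1" "v \<le> 1"
    using Im by (auto simp: X_def u_def v_def)
  have Xuv: "X * u * v = 1"
    using Im_alpha_sum[of l] by (simp add: X_def u_def v_def flip: exp_add)
  \<comment> \<open>The sector conditions say \<open>\<bar>sqrt 3 * Re l\<bar> \<le> Im l\<close>,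
    so \<open>norm l \<ge> 2\<close> forces \<open>Im l \<ge> sqrt 3\<close>. The value 1.7 lies
    just below and still gives \<open>X \<ge> 4\<close>.\<close>
  have "Im l \<ge> 17 / 10"
  proof (rule ccontr)
    assume "\<not> ?thesis"
    have "\<bar>sqrt 3 * Re l\<bar> \<le> Im l"
      using Im by (simp add: alpha_Complex power2_eq_square algebra_simps)
    then have "(sqrt 3 * Re l)\<^sup>2 \<le> (Im l)\<^sup>2"
      by (intro power2_le_iff_abs_le[THEN iffD2]) auto
    then have "3 * (Re l)\<^sup>2 \<le> (Im l)\<^sup>2"
      by (simp add: power_mult_distrib)
    moreover have "0 \<le> Im l"
      using \<open>\<bar>sqrt 3 * Re l\<bar> \<le> Im l\<close> by linarith
    then have "(Im l)\<^sup>2 \<le> (17 / 10)\<^sup>2"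
      using \<open>\<not> 17 / 10 \<le> Im l\<close> by (intro power_mono) auto
    moreover have "2\<^sup>2 \<le> (Re l)\<^sup>2 + (Im l)\<^sup>2"
      using power_mono[OF l, of 2] by (simp add: cmod_power2)
    moreover have "(17 / 10)\<^sup>2 + (17 / 10)\<^sup>2 / 3 < (2\<^sup>2 :: real)"
      by (simp add: power2_eq_square)
    ultimately show False by linarith
  qed
  then have "exp (17 / 10) \<le> X"
    by (simp add: X_def)
  moreover have "exp (17 / 10 :: real) \<ge> 1 + 17 / 10 + (17 / 10)\<^sup>2 / 2"
    by (rule exp_lower_Taylor_quadratic) auto
  moreover have "1 + 17 / 10 + (17 / 10)\<^sup>2 / 2 \<ge> (4 :: real)"
    by (simp add: power2_eq_square)
  ultimately have X4: "X \<ge> 4"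
    by linarith
  have n: "norm (exp (-\<i>*\<alpha>*l)) = u" "norm (exp (-\<i>*\<alpha>\<^sup>2*l)) = v" "norm (exp (-\<i>*l)) = X"
    "norm (exp (\<i>*\<alpha>*l)) = 1 / u" "norm (exp (\<i>*\<alpha>\<^sup>2*l)) = 1 / v" "norm (exp (\<i>*l)) = 1 / X"
    by (simp_all only: X_def u_def v_def mult.assoc norm_exp_i exp_minus inverse_eq_divide)
  have "exp (-\<i>*l) = Delta \<beta> l - \<beta> * exp (\<i>*l) - \<beta> * (\<alpha> * exp (\<i>*\<alpha>*l)) - \<beta> * (\<alpha>^2 * exp (\<i>*\<alpha>^2*l))
     - \<alpha> * exp (-\<i>*\<alpha>*l) - \<alpha>^2 * exp (-\<i>*\<alpha>^2*l)"
    by (simp add: Delta_def algebra_simps)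
  also have "norm \<dots> \<le> norm (Delta \<beta> l) + norm (\<beta> * exp (\<i>*l)) + norm (\<beta> * (\<alpha> * exp (\<i>*\<alpha>*l)))
     + norm (\<beta> * (\<alpha>^2 * exp (\<i>*\<alpha>^2*l)))
     + norm (\<alpha> * exp (-\<i>*\<alpha>*l)) + norm (\<alpha>^2 * exp (-\<i>*\<alpha>^2*l))"
    by (intro order_trans[OF norm_triangle_ineq4] add_mono order_refl norm_triangle_ineq4)
  finally have "X \<le> norm (Delta \<beta> l) + \<beta> / X + \<beta> / u + \<beta> / v + u + v"
    using n \<beta> by (simp add: norm_mult norm_power)
  moreover have inv: "1 / X = u * v" "1 / u = X * v" "1 / v = X * u"
    using Xuv pos by (simp_all add: field_simps)
  have "\<beta> / X \<le> 1 / 8"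
    using \<beta> X4 by (simp add: field_simps)
  moreover have "\<beta> / u + \<beta> / v \<le> (1 / 2) * (X * (u + v))"
  proof -
    have "\<beta> / u + \<beta> / v = \<beta> * (1 / u) + \<beta> * (1 / v)"
      by simp
    also have "\<dots> = \<beta> * (X * (u + v))"
      unfolding inv by (simp add: algebra_simps)
    also have "\<dots> \<le> (1 / 2) * (X * (u + v))"
      using \<beta> pos by (intro mult_right_mono) auto
    finally show ?thesis .
  qed
  \<comment> \<open>From \<open>(1 - u) * (1 - v) \<ge> 0\<close>. Multiplied by \<open>X\<close> it
    shows that the two large terms together cost at most \<open>(X + 1) / 2\<close> rather than
    \<open>X\<close>.\<close>
  moreover have uv: "u + v \<le> 1 + u * v"
    using mult_nonneg_nonneg[of "1 - u" "1 - v"] le by (simp add: algebra_simps)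
  then have "X * (u + v) \<le> X + 1"
    using mult_left_mono[OF uv, of X] pos Xuv by (simp add: algebra_simps)
  moreover have "u * v \<le> 1 / 4"
    unfolding inv(1)[symmetric] using X4 by (simp add: field_simps)
  ultimately have "X / 2 \<le> norm (Delta \<beta> l) + 1 / 8 + 1 / 2 + 1 + 1 / 4"
    using uv by linarith
  \<comment> \<open>The previous line reads
    \<open>norm (Delta \<beta> l) \<ge> X / 2 - 15 / 8\<close>, and this is at least
    \<open>X / 32\<close> exactly from \<open>X = 4\<close> on.\<close>
  then have "X \<le> 32 * norm (Delta \<beta> l)"
    using X4 by linarith
  then show ?thesis
    using n by simp
qed

text \<open>In the remaining annulus \<open>1 \<le> norm l < 2\<close> the left side is at most
  \<open>exp 2 \<le> 7.4\<close>, while the bound near the origin gives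
  \<open>32 * 0.3 = 9.6\<close> on the right.\<close>

lemma Delta_lower:
  assumes \<beta>: "0 \<le> \<beta>" "\<beta> \<le> 1 / 2" and l: "norm l \<ge> 1"
    and Im: "Im (\<alpha> * l) \<le> 0" "Im (\<alpha>\<^sup>2 * l) \<le> 0"
  shows "norm (exp (- \<i> * l)) \<le> 32 * norm (Delta \<beta> l)"
proof (cases "norm l \<ge> 2")
  case False
  have "exp (Im l) \<le> exp 2"
    using abs_Im_le_cmod[of l] False by simp
  then have "exp (Im l) \<le> 7.4" using exp_2_le by linarith
  moreover have "(norm l)\<^sup>2 \<ge> 1"
    using power_mono[OF l, of 2] by simp
  ultimately show ?thesis
    using Delta_lower_near[of \<beta> l] False \<beta> unfolding norm_exp_i by simp
qed (use Delta_lower_far assms in blast)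

section \<open>The functionals and their decay\<close>

definition fhat :: "(real \<Rightarrow> complex) \<Rightarrow> complex \<Rightarrow> complex" where
  "fhat g l = lap 0 1 g (- \<i> * l)"

text \<open>\<open>Fm\<close> and \<open>Fp\<close> are \<open>F\<^sub>\<lambda>\<close> on \<open>\<Gamma>\<^sup>-\<close> and on \<open>\<Gamma>\<^sup>+ \<union> \<Gamma>\<^sub>0\<close>; \<open>numer\<close> is the bracket in \<open>\<phi>\<^sup>-\<close>
  (half of it for Problem 1) with the three Fourier transforms replaced by arbitrary numbers \<open>a\<close>, \<open>b\<close>, \<open>c\<close>.\<close>

definition numer :: "real \<Rightarrow> complex \<Rightarrow> complex \<Rightarrow> complex \<Rightarrow> complex \<Rightarrow> complex" where
  "numer \<beta> l a b c =
     a * (1 + \<beta> * (\<alpha>\<^sup>2 * exp (-\<i>*\<alpha>*l) + \<alpha> * exp (-\<i>*\<alpha>\<^sup>2*l)))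
     + \<alpha> * b * (1 - \<beta> * exp (-\<i>*\<alpha>\<^sup>2*l))
     + \<alpha>\<^sup>2 * c * (1 - \<beta> * exp (-\<i>*\<alpha>*l))"

definition Fm :: "real \<Rightarrow> (real \<Rightarrow> complex) \<Rightarrow> complex \<Rightarrow> complex" where
  "Fm \<beta> g l = - exp (-\<i>*l) / (2 * of_real pi * Delta \<beta> l)
     * numer \<beta> l (fhat g l) (fhat g (\<alpha> * l)) (fhat g (\<alpha>\<^sup>2 * l))"

definition Fp :: "real \<Rightarrow> (real \<Rightarrow> complex) \<Rightarrow> complex \<Rightarrow> complex" where
  "Fp \<beta> g l = fhat g l / (2 * of_real pi) + Fm \<beta> g l"

lemma numer_add: "numer \<beta> l (a + a') (b + b') (c + c') = numer \<beta> l a b c + numer \<beta> l a' b' c'"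
  by (simp add: numer_def algebra_simps)

lemma numer_cmult: "numer \<beta> l (k * a) (k * b) (k * c) = k * numer \<beta> l a b c"
  by (simp add: numer_def algebra_simps)

lemma exp_alpha_product:
  "exp (\<i> * l) = exp (-\<i>*\<alpha>*l) * exp (-\<i>*\<alpha>\<^sup>2*l)"
  "exp (\<i> * \<alpha> * l) = exp (-\<i>*l) * exp (-\<i>*\<alpha>\<^sup>2*l)"
  "exp (\<i> * \<alpha>\<^sup>2 * l) = exp (-\<i>*l) * exp (-\<i>*\<alpha>*l)"
  unfolding exp_add[symmetric] alpha_square by (simp_all add: algebra_simps)

text \<open>With the exponentials of positive exponent rewritten as products of the others, the
  determinant is a polynomial in three quantities, and the identities for the functionals become
  polynomial ones.\<close>

lemma Delta_product:
  "Delta \<beta> l = \<beta> * (exp (-\<i>*\<alpha>*l) * exp (-\<i>*\<alpha>\<^sup>2*l)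
     + \<alpha> * (exp (-\<i>*l) * exp (-\<i>*\<alpha>\<^sup>2*l)) + \<alpha>\<^sup>2 * (exp (-\<i>*l) * exp (-\<i>*\<alpha>*l)))
     + (exp (-\<i>*l) + \<alpha> * exp (-\<i>*\<alpha>*l) + \<alpha>\<^sup>2 * exp (-\<i>*\<alpha>\<^sup>2*l))"
  by (simp only: Delta_def exp_alpha_product)

text \<open>The defining property of the functionals: they see the boundary terms of the
  transformed equation only through the values at the right end point.\<close>

lemma numer_boundary:
  "numer \<beta> l (exp (-\<i>*l) * (h1 + \<i>*l * (of_real \<beta> * k)) - (h0 + \<i>*l * k))
     (exp (-\<i>*\<alpha>*l) * (h1 + \<i>*\<alpha>*l * (of_real \<beta> * k)) - (h0 + \<i>*\<alpha>*l * k))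
     (exp (-\<i>*\<alpha>\<^sup>2*l) * (h1 + \<i>*\<alpha>\<^sup>2*l * (of_real \<beta> * k)) - (h0 + \<i>*\<alpha>\<^sup>2*l * k))
   = Delta \<beta> l * (h1 + \<i>*l * (of_real \<beta> * k))"
proof -
  have a: "\<alpha> * \<alpha> = - 1 - \<alpha>" "\<alpha> * (\<alpha> * w) = - w - \<alpha> * w" for w
    using alpha_square by (simp_all add: power2_eq_square mult.assoc[symmetric] left_diff_distrib)
  \<comment> \<open>With the exponentials as variables the claim is a polynomial identity modulo
    \<open>\<alpha>\<^sup>2 = - 1 - \<alpha>\<close>. The left-end values drop out because the cube
    roots of unity sum to zero.\<close>
  have "numer \<beta> l (E * (h1 + w * (of_real \<beta> * k)) - (h0 + w * k))
     (E1 * (h1 + \<alpha> * w * (of_real \<beta> * k)) - (h0 + \<alpha> * w * k))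
     (E2 * (h1 + \<alpha>\<^sup>2 * w * (of_real \<beta> * k)) - (h0 + \<alpha>\<^sup>2 * w * k))
     = (\<beta> * (E1 * E2 + \<alpha> * (E * E2) + \<alpha>\<^sup>2 * (E * E1)) + (E + \<alpha> * E1 + \<alpha>\<^sup>2 * E2)) * (h1 + w * (of_real \<beta> * k))"
    if "E1 = exp (-\<i>*\<alpha>*l)" "E2 = exp (-\<i>*\<alpha>\<^sup>2*l)" for E E1 E2 w :: complex
    unfolding numer_def that[symmetric]
    by (simp add: power2_eq_square algebra_simps a)
  from this[OF refl refl, of "exp (-\<i>*l)" "\<i> * l"] show ?thesis
    by (simp add: Delta_product mult_ac)
qed

lemma alpha_nonzero [simp]: "\<alpha> \<noteq> 0"
  using norm_alpha by force

lemma holomorphic_fhat: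
  assumes "continuous_on {0..1} g"
  shows "fhat g holomorphic_on UNIV"
  unfolding fhat_def
  by (rule holomorphic_on_compose_gen[OF _ holomorphic_lap[OF assms], unfolded o_def])
    (auto intro!: holomorphic_intros)

lemma analytic_fhat:
  assumes "continuous_on {0..1} g"
  shows "fhat g analytic_on S"
  using holomorphic_fhat[OF assms] analytic_on_holomorphic by blast

lemma analytic_fhat_compose [analytic_intros]:
  assumes "continuous_on {0..1} g" "h analytic_on S"
  shows "(\<lambda>l. fhat g (h l)) analytic_on S"
  using analytic_on_compose_gen[OF assms(2) analytic_fhat[OF assms(1), of UNIV]] by (simp add: o_def)

lemma analytic_Fm:
  assumes "continuous_on {0..1} g" and "\<And>l. l \<in> S \<Longrightarrow> Delta \<beta> l \<noteq> 0"
  shows "Fm \<beta> g analytic_on S"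
proof -
  have D: "Delta \<beta> analytic_on S"
    unfolding Delta_def[abs_def] by (intro analytic_intros)
  have N: "(\<lambda>l. numer \<beta> l (fhat g l) (fhat g (\<alpha> * l)) (fhat g (\<alpha>\<^sup>2 * l))) analytic_on S"
    unfolding numer_def by (intro analytic_intros analytic_fhat assms(1))
  show ?thesis
    unfolding Fm_def[abs_def] by (intro analytic_intros D N) (use assms(2) in auto)
qed

lemma analytic_Fp:
  assumes "continuous_on {0..1} g" and "\<And>l. l \<in> S \<Longrightarrow> Delta \<beta> l \<noteq> 0"
  shows "Fp \<beta> g analytic_on S"
  unfolding Fp_def[abs_def] by (intro analytic_intros analytic_Fm analytic_fhat assms) auto

lemma numer_bound:
  assumes \<beta>: "0 \<le> \<beta>" "\<beta> \<le> 1"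
    and a: "norm a \<le> A" and b: "norm b \<le> B" and c: "norm c \<le> C"
    and u: "exp (Im (\<alpha> * l)) \<le> u" and v: "exp (Im (\<alpha>\<^sup>2 * l)) \<le> v"
  shows "norm (numer \<beta> l a b c) \<le> A * (1 + u + v) + B * (1 + v) + C * (1 + u)"
proof -
  have E1: "norm (exp (-\<i>*\<alpha>*l)) = exp (Im (\<alpha> * l))" and E2: "norm (exp (-\<i>*\<alpha>\<^sup>2*l)) = exp (Im (\<alpha>\<^sup>2 * l))"
    using norm_exp_i(1)[of "\<alpha> * l"] norm_exp_i(1)[of "\<alpha>\<^sup>2 * l"] by (simp_all only: mult.assoc)
  have pos: "0 \<le> A" "0 \<le> B" "0 \<le> C" "0 \<le> u" "0 \<le> v"
    using order_trans[OF norm_ge_zero a] order_trans[OF norm_ge_zero b] order_trans[OF norm_ge_zero c]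
      order_trans[OF exp_ge_zero u] order_trans[OF exp_ge_zero v] by auto
  have le: "\<beta> * x \<le> y" if "0 \<le> x" "x \<le> y" for x y :: real
    using mult_mono[of \<beta> 1 x y] that \<beta> by simp
  have b1: "norm (\<beta> * exp (-\<i>*\<alpha>*l)) \<le> u" and b2: "norm (\<beta> * exp (-\<i>*\<alpha>\<^sup>2*l)) \<le> v"
    unfolding norm_mult norm_of_real abs_of_nonneg[OF \<beta>(1)] E1 E2
    using u v by (auto intro!: le)
  have c0: "norm (1 + \<beta> * (\<alpha>\<^sup>2 * exp (-\<i>*\<alpha>*l) + \<alpha> * exp (-\<i>*\<alpha>\<^sup>2*l))) \<le> 1 + u + v"
  proof -
    have "norm (1 + (\<alpha>\<^sup>2 * (\<beta> * exp (-\<i>*\<alpha>*l)) + \<alpha> * (\<beta> * exp (-\<i>*\<alpha>\<^sup>2*l))))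
      \<le> norm (1::complex) + (norm (\<alpha>\<^sup>2 * (\<beta> * exp (-\<i>*\<alpha>*l))) + norm (\<alpha> * (\<beta> * exp (-\<i>*\<alpha>\<^sup>2*l))))"
      by (intro order_trans[OF norm_triangle_ineq] add_mono order_refl norm_triangle_ineq)
    also have "\<dots> \<le> 1 + (u + v)"
      using b1 b2 by (simp add: norm_mult norm_power)
    finally show ?thesis by (simp add: algebra_simps)
  qed
  have c1: "norm (1 - \<beta> * exp (-\<i>*\<alpha>\<^sup>2*l)) \<le> 1 + v" and c2: "norm (1 - \<beta> * exp (-\<i>*\<alpha>*l)) \<le> 1 + u"
    using b1 b2 by (auto intro: order_trans[OF norm_triangle_ineq4])
  have "norm (numer \<beta> l a b c) \<le> norm (a * (1 + \<beta> * (\<alpha>\<^sup>2 * exp (-\<i>*\<alpha>*l) + \<alpha> * exp (-\<i>*\<alpha>\<^sup>2*l))))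
     + norm (\<alpha> * b * (1 - \<beta> * exp (-\<i>*\<alpha>\<^sup>2*l)))
     + norm (\<alpha>\<^sup>2 * c * (1 - \<beta> * exp (-\<i>*\<alpha>*l)))"
    unfolding numer_def by (intro order_trans[OF norm_triangle_ineq] add_mono order_refl norm_triangle_ineq)
  also have "\<dots> \<le> A * (1 + u + v) + B * (1 + v) + C * (1 + u)"
    unfolding norm_mult[of "_ * _"] norm_mult[of \<alpha>] norm_mult[of "\<alpha>\<^sup>2"] norm_power norm_alpha norm_mult[of a]
      power_one mult_1
    by (intro add_mono mult_mono a b c c0 c1 c2 pos norm_ge_zero)
  finally show ?thesis .
qed

text \<open>The vanishing of \<open>g\<close> at both ends removes the end-point terms of order
  \<open>1 / l\<close>, leaving two full orders of decay.\<close>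

lemma fhat_bound:
  assumes g: "\<And>y. y \<in> {0..1} \<Longrightarrow> (g has_vector_derivative g' y) (at y within {0..1})"
    and g': "\<And>y. y \<in> {0..1} \<Longrightarrow> (g' has_vector_derivative g'' y) (at y within {0..1})"
    and "continuous_on {0..1} g''" and "g 0 = 0" "g 1 = 0"
  obtains C where "C \<ge> 0" "\<And>l. l \<noteq> 0 \<Longrightarrow> norm (fhat g l) \<le> C / (norm l)\<^sup>2 * max 1 (exp (Im l))"
proof -
  obtain C where C: "C \<ge> 0" "\<And>w. norm (w\<^sup>2 * lap 0 1 g w - w * (exp (w * of_real 1) * g 1 - exp (w * of_real 0) * g 0))
       \<le> C * max (exp (Re w * 0)) (exp (Re w * 1))"
    using lap_bound2[of 0 1 g g' g''] assms by auto
  show ?thesis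
  proof (rule that[OF C(1)])
    fix l :: complex assume "l \<noteq> 0"
    have "(norm l)\<^sup>2 * norm (fhat g l) \<le> C * max 1 (exp (Im l))"
      using C(2)[of "- \<i> * l"] assms(4,5) by (simp add: fhat_def norm_mult norm_power)
    then show "norm (fhat g l) \<le> C / (norm l)\<^sup>2 * max 1 (exp (Im l))"
      using \<open>l \<noteq> 0\<close> by (simp add: field_simps)
  qed
qed

text \<open>The estimates of \<open>Fm\<close> and \<open>Fp\<close> see the data only through this
  decay. Zero data with \<open>C = 0\<close> are an instance, which later isolates the non-vanishing
  of the determinant.\<close>

locale decaying_transform =
  fixes \<beta> :: real and g :: "real \<Rightarrow> complex" and C :: real
  assumes \<beta>: "0 \<le> \<beta>" "\<beta> \<le> 1 / 2"
    and C: "0 \<le> C" "\<And>l. l \<noteq> 0 \<Longrightarrow> norm (fhat g l) \<le> C / (norm l)\<^sup>2 * max 1 (exp (Im l))"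
begin

lemma fhat_alpha_bound:
  assumes "l \<noteq> 0"
  shows "norm (fhat g (\<alpha> * l)) \<le> C / (norm l)\<^sup>2 * max 1 (exp (Im (\<alpha> * l)))"
    and "norm (fhat g (\<alpha>\<^sup>2 * l)) \<le> C / (norm l)\<^sup>2 * max 1 (exp (Im (\<alpha>\<^sup>2 * l)))"
  using C(2)[of "\<alpha> * l"] C(2)[of "\<alpha>\<^sup>2 * l"] assms
  by (auto simp: norm_mult norm_power)

text \<open>The prefactor combines to \<open>exp (- \<i> * (1 - x) * l)\<close>, bounded in the
  lower half plane since \<open>x \<le> 1\<close>. Here \<open>M\<close> is the modulus of the
  dominant exponential, common to numerator and determinant, and
  \<open>224 = 7 * 32\<close>.\<close>

lemma Fm_bound_aux:
  assumes x: "0 \<le> x" "x \<le> 1" and Im: "Im l \<le> 0" and l: "norm l \<ge> 1"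
    and M: "M \<le> 32 * norm (Delta \<beta> l)" "M > 0"
    and N: "norm (numer \<beta> l (fhat g l) (fhat g (\<alpha> * l)) (fhat g (\<alpha>\<^sup>2 * l))) \<le> 7 * C / (norm l)\<^sup>2 * M"
  shows "norm (exp (\<i> * l * of_real x) * Fm \<beta> g l) \<le> 224 * C / (norm l)\<^sup>2"
proof -
  have D: "norm (Delta \<beta> l) > 0" using M by linarith
  let ?N = "numer \<beta> l (fhat g l) (fhat g (\<alpha> * l)) (fhat g (\<alpha>\<^sup>2 * l))"
  have "norm (exp (\<i> * l * of_real x) * exp (- \<i> * l)) \<le> 1"
  proof -
    have "exp (\<i> * l * of_real x) * exp (- \<i> * l) = exp (- \<i> * (of_real (1 - x) * l))"
      unfolding exp_add[symmetric] by (simp add: algebra_simps)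
    moreover have "Im (of_real (1 - x) * l) \<le> 0"
      using x Im by (simp add: mult_nonneg_nonpos)
    ultimately show ?thesis
      by (simp only: norm_exp_i) simp
  qed
  moreover have "norm ?N / (2 * pi * norm (Delta \<beta> l)) \<le> 224 * C / (norm l)\<^sup>2"
  proof -
    have "norm ?N \<le> 7 * C / (norm l)\<^sup>2 * M"
      by (rule N)
    also have "\<dots> \<le> 7 * C / (norm l)\<^sup>2 * (32 * norm (Delta \<beta> l))"
      using C M by (intro mult_left_mono) auto
    also have "\<dots> = 224 * C / (norm l)\<^sup>2 * norm (Delta \<beta> l)"
      by simp
    also have "\<dots> \<le> 224 * C / (norm l)\<^sup>2 * (2 * pi * norm (Delta \<beta> l))"
    proof (rule mult_left_mono)
      have "1 \<le> 2 * pi" using pi_gt3 by linarith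
      then show "norm (Delta \<beta> l) \<le> 2 * pi * norm (Delta \<beta> l)"
        using mult_right_mono[of 1 "2 * pi" "norm (Delta \<beta> l)"] by simp
    qed (use C in auto)
    finally show ?thesis
      using D by (subst pos_divide_le_eq) auto
  qed
  ultimately have "norm (exp (\<i> * l * of_real x) * exp (- \<i> * l)) * (norm ?N / (2 * pi * norm (Delta \<beta> l))) \<le> 1 * (224 * C / (norm l)\<^sup>2)"
    by (intro mult_mono) auto
  moreover have "norm (exp (\<i> * l * of_real x) * Fm \<beta> g l)
      = norm (exp (\<i> * l * of_real x) * exp (- \<i> * l)) * (norm ?N / (2 * pi * norm (Delta \<beta> l)))"
    unfolding Fm_def by (simp only: norm_mult norm_divide norm_minus_cancel) simp
  ultimately show ?thesis by simp
qed

text \<open>Rotation by \<alpha> or \<open>\<alpha>\<^sup>2\<close> carries the two lower sectors to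
  the upper one, where \<open>Delta_lower\<close> applies. Only one of the three exponentials, of
  modulus \<open>M\<close>, exceeds 1 there, and the numerator is at most
  \<open>K * (3 + 4 * M)\<close>, hence the factor 7.\<close>

lemma Fm_bound:
  assumes x: "0 \<le> x" "x \<le> 1" and l: "norm l \<ge> 1"
    and Im: "Im l \<le> 0" "Im (\<alpha> * l) \<le> 0 \<or> Im (\<alpha>\<^sup>2 * l) \<le> 0"
  shows "norm (exp (\<i> * l * of_real x) * Fm \<beta> g l) \<le> 224 * C / (norm l)\<^sup>2" and "Delta \<beta> l \<noteq> 0"
proof -
  define K where "K = C / (norm l)\<^sup>2"
  have K: "K \<ge> 0" using C by (simp add: K_def)
  have l0: "l \<noteq> 0" using l by auto
  note b = C(2)[OF l0] fhat_alpha_bound[OF l0]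
  have rot: "norm (Delta \<beta> (\<alpha> * l)) = norm (Delta \<beta> l)" "norm (Delta \<beta> (\<alpha>\<^sup>2 * l)) = norm (Delta \<beta> l)"
    using Delta_rotate[of \<beta> l] Delta_rotate[of \<beta> "\<alpha> * l"]
    by (simp_all add: norm_mult norm_power power2_eq_square mult.assoc)
  have \<beta>1: "\<beta> \<le> 1" using \<beta> by simp
  have b0: "norm (fhat g l) \<le> K"
    using b(1) max_absorb1[of "exp (Im l)" 1] Im by (simp add: K_def)
  have "norm (exp (\<i> * l * of_real x) * Fm \<beta> g l) \<le> 224 * C / (norm l)\<^sup>2 \<and> Delta \<beta> l \<noteq> 0"
    using Im(2)
  proof
    assume Im2: "Im (\<alpha>\<^sup>2 * l) \<le> 0"
    define M where "M = exp (Im (\<alpha> * l))"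
    have "Im (\<alpha> * l) \<ge> 0" using Im Im2 Im_alpha_sum[of l] by linarith
    then have M: "M \<ge> 1" by (simp add: M_def)
    have "\<alpha> * (\<alpha> * l) = \<alpha>\<^sup>2 * l" "\<alpha>\<^sup>2 * (\<alpha> * l) = l"
      using alpha_cube by (simp_all add: power2_eq_square power3_eq_cube mult.assoc[symmetric])
    then have "norm (exp (- \<i> * (\<alpha> * l))) \<le> 32 * norm (Delta \<beta> (\<alpha> * l))"
      using Im Im2 l by (intro Delta_lower \<beta>) (simp_all only: norm_mult norm_alpha mult_1)
    then have D: "M \<le> 32 * norm (Delta \<beta> l)"
      by (simp only: norm_exp_i rot M_def)
    have "norm (numer \<beta> l (fhat g l) (fhat g (\<alpha> * l)) (fhat g (\<alpha>\<^sup>2 * l)))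
        \<le> K * (1 + M + 1) + (K * M) * (1 + 1) + K * (1 + M)"
    proof (rule numer_bound[OF \<beta>(1) \<beta>1 b0])
      have "max 1 (exp (Im (\<alpha>\<^sup>2 * l))) = 1"
        by (rule max_absorb1) (use Im2 in \<open>simp only: exp_le_one_iff\<close>)
      then show "norm (fhat g (\<alpha>\<^sup>2 * l)) \<le> K"
        using b(3) by (simp only: K_def mult_1_right)
      show "norm (fhat g (\<alpha> * l)) \<le> K * M"
        using b(2) M by (simp only: K_def M_def max_absorb2)
    qed (simp_all only: M_def exp_le_one_iff order_refl Im2)
    also have "\<dots> = K * (3 + 4 * M)" by (simp add: algebra_simps)
    also have "\<dots> \<le> K * (7 * M)" using M K by (intro mult_left_mono) auto
    finally have "norm (numer \<beta> l (fhat g l) (fhat g (\<alpha> * l)) (fhat g (\<alpha>\<^sup>2 * l))) \<le> 7 * C / (norm l)\<^sup>2 * M"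
      by (simp add: K_def mult_ac)
    then show ?thesis
      using Fm_bound_aux[OF x Im(1) l D] M D by auto
  next
    assume Im2: "Im (\<alpha> * l) \<le> 0"
    define M where "M = exp (Im (\<alpha>\<^sup>2 * l))"
    have "Im (\<alpha>\<^sup>2 * l) \<ge> 0" using Im Im2 Im_alpha_sum[of l] by linarith
    then have M: "M \<ge> 1" by (simp add: M_def)
    have "\<alpha> * (\<alpha>\<^sup>2 * l) = l" "\<alpha>\<^sup>2 * (\<alpha>\<^sup>2 * l) = \<alpha> * l"
      using alpha_cube by (simp_all add: power2_eq_square power3_eq_cube mult.assoc[symmetric])
    then have "norm (exp (- \<i> * (\<alpha>\<^sup>2 * l))) \<le> 32 * norm (Delta \<beta> (\<alpha>\<^sup>2 * l))"
      using Im Im2 l by (intro Delta_lower \<beta>) (simp_all only: norm_mult norm_power norm_alpha power_one mult_1)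
    then have D: "M \<le> 32 * norm (Delta \<beta> l)"
      by (simp only: norm_exp_i rot M_def)
    have "norm (numer \<beta> l (fhat g l) (fhat g (\<alpha> * l)) (fhat g (\<alpha>\<^sup>2 * l)))
        \<le> K * (1 + 1 + M) + K * (1 + M) + (K * M) * (1 + 1)"
    proof (rule numer_bound[OF \<beta>(1) \<beta>1 b0])
      have "max 1 (exp (Im (\<alpha> * l))) = 1"
        by (rule max_absorb1) (use Im2 in \<open>simp only: exp_le_one_iff\<close>)
      then show "norm (fhat g (\<alpha> * l)) \<le> K"
        using b(2) by (simp only: K_def mult_1_right)
      show "norm (fhat g (\<alpha>\<^sup>2 * l)) \<le> K * M"
        using b(3) M by (simp only: K_def M_def max_absorb2)
    qed (simp_all only: M_def exp_le_one_iff order_refl Im2)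
    also have "\<dots> = K * (3 + 4 * M)" by (simp add: algebra_simps)
    also have "\<dots> \<le> K * (7 * M)" using M K by (intro mult_left_mono) auto
    finally have "norm (numer \<beta> l (fhat g l) (fhat g (\<alpha> * l)) (fhat g (\<alpha>\<^sup>2 * l))) \<le> 7 * C / (norm l)\<^sup>2 * M"
      by (simp add: K_def mult_ac)
    then show ?thesis
      using Fm_bound_aux[OF x Im(1) l D] M D by auto
  qed
  then show "norm (exp (\<i> * l * of_real x) * Fm \<beta> g l) \<le> 224 * C / (norm l)\<^sup>2" "Delta \<beta> l \<noteq> 0"
    by auto
qed

text \<open>In the upper sector \<open>fhat g l\<close> may be as large as
  \<open>K * norm E\<close>, so the two summands of \<open>Fp\<close> cannot be estimated
  separately. Over the common denominator every product of \<open>fhat g l\<close> with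
  \<open>E\<close> cancels; what is left, \<open>?R\<close>, is at most
  \<open>(3 + 4) * K * norm E\<close>.\<close>

lemma Fp_bound:
  assumes x: "0 \<le> x" and l: "norm l \<ge> 1"
    and Im: "Im (\<alpha> * l) \<le> 0" "Im (\<alpha>\<^sup>2 * l) \<le> 0"
  shows "norm (exp (\<i> * l * of_real x) * Fp \<beta> g l) \<le> 224 * C / (norm l)\<^sup>2" and "Delta \<beta> l \<noteq> 0"
proof -
  define K where "K = C / (norm l)\<^sup>2"
  have K: "K \<ge> 0" using C by (simp add: K_def)
  have l0: "l \<noteq> 0" using l by auto
  note b = C(2)[OF l0] fhat_alpha_bound[OF l0]
  define E E1 E2 where "E = exp (-\<i>*l)" and "E1 = exp (-\<i>*\<alpha>*l)" and "E2 = exp (-\<i>*\<alpha>\<^sup>2*l)"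
  have n: "norm E = exp (Im l)" "norm E1 = exp (Im (\<alpha> * l))" "norm E2 = exp (Im (\<alpha>\<^sup>2 * l))"
    unfolding E_def E1_def E2_def by (simp_all only: mult.assoc norm_exp_i)
  have Im0: "Im l \<ge> 0" using Im Im_alpha_sum[of l] by linarith
  have nE: "norm E \<ge> 1" "norm E1 \<le> 1" "norm E2 \<le> 1"
    using n Im Im0 by auto
  have D: "norm E \<le> 32 * norm (Delta \<beta> l)"
    unfolding E_def by (rule Delta_lower[OF \<beta> l Im])
  then show D0: "Delta \<beta> l \<noteq> 0" using nE by auto
  have f: "norm (fhat g l) \<le> K * norm E" "norm (fhat g (\<alpha> * l)) \<le> K" "norm (fhat g (\<alpha>\<^sup>2 * l)) \<le> K"
    using b Im Im0 n by (auto simp: K_def max_def split: if_splits)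
  let ?R = "fhat g l * (\<beta> * (E1 * E2) + \<alpha> * E1 + \<alpha>\<^sup>2 * E2)
    - E * (\<alpha> * fhat g (\<alpha> * l) * (1 - \<beta> * E2) + \<alpha>\<^sup>2 * fhat g (\<alpha>\<^sup>2 * l) * (1 - \<beta> * E1))"
  have "2 * pi * Delta \<beta> l * Fp \<beta> g l = fhat g l * Delta \<beta> l - E * numer \<beta> l (fhat g l) (fhat g (\<alpha> * l)) (fhat g (\<alpha>\<^sup>2 * l))"
    using D0 unfolding Fp_def Fm_def E_def by (simp add: field_simps)
  also have "\<dots> = ?R"
    unfolding Delta_product numer_def E_def[symmetric] E1_def[symmetric] E2_def[symmetric]
    by (simp add: algebra_simps)
  finally have eq: "2 * pi * Delta \<beta> l * Fp \<beta> g l = ?R" .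
  have t1: "norm (\<beta> * (E1 * E2) + \<alpha> * E1 + \<alpha>\<^sup>2 * E2) \<le> 3"
  proof -
    have "norm (\<beta> * (E1 * E2) + \<alpha> * E1 + \<alpha>\<^sup>2 * E2) \<le> norm (\<beta> * (E1 * E2)) + norm (\<alpha> * E1) + norm (\<alpha>\<^sup>2 * E2)"
      by (intro order_trans[OF norm_triangle_ineq] add_mono order_refl norm_triangle_ineq)
    moreover have "norm (\<beta> * (E1 * E2)) \<le> 1 * (1 * 1)"
      unfolding norm_mult using nE \<beta> by (intro mult_mono) auto
    ultimately show ?thesis using nE by (simp add: norm_mult norm_power)
  qed
  have t2: "norm (1 - \<beta> * w) \<le> 2" if "norm w \<le> 1" for w :: complex
  proof -
    have "norm (\<beta> * w) \<le> 1 * 1"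
      unfolding norm_mult using that \<beta> by (intro mult_mono) auto
    then show ?thesis
      using norm_triangle_ineq4[of 1 "\<beta> * w"] by simp
  qed
  have "norm ?R \<le> norm (fhat g l) * norm (\<beta> * (E1 * E2) + \<alpha> * E1 + \<alpha>\<^sup>2 * E2)
    + norm E * (norm (fhat g (\<alpha> * l)) * norm (1 - \<beta> * E2) + norm (fhat g (\<alpha>\<^sup>2 * l)) * norm (1 - \<beta> * E1))"
  proof -
    have "norm (\<alpha> * fhat g (\<alpha> * l) * (1 - \<beta> * E2) + \<alpha>\<^sup>2 * fhat g (\<alpha>\<^sup>2 * l) * (1 - \<beta> * E1))
      \<le> norm (fhat g (\<alpha> * l)) * norm (1 - \<beta> * E2) + norm (fhat g (\<alpha>\<^sup>2 * l)) * norm (1 - \<beta> * E1)"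
      by (rule order_trans[OF norm_triangle_ineq]) (simp add: norm_mult norm_power)
    then show ?thesis
      by (intro order_trans[OF norm_triangle_ineq4] add_mono) (auto simp: norm_mult intro!: mult_left_mono)
  qed
  also have "\<dots> \<le> (K * norm E) * 3 + norm E * (K * 2 + K * 2)"
    using f nE K by (intro add_mono mult_mono t1 t2) auto
  also have "\<dots> = 7 * K * norm E" by simp
  also have "\<dots> \<le> 7 * K * (32 * norm (Delta \<beta> l))"
    using D K by (intro mult_left_mono) auto
  finally have R: "norm ?R \<le> 224 * K * norm (Delta \<beta> l)" by simp
  have "norm (Delta \<beta> l) * norm (Fp \<beta> g l) \<le> 2 * pi * (norm (Delta \<beta> l) * norm (Fp \<beta> g l))"
    using pi_gt3 mult_right_mono[of 1 "2 * pi" "norm (Delta \<beta> l) * norm (Fp \<beta> g l)"] by simp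
  also have "\<dots> = norm ?R"
    unfolding eq[symmetric] by (simp add: norm_mult)
  also note R
  finally have "norm (Fp \<beta> g l) \<le> 224 * K"
    using D0 by (simp add: mult.commute)
  moreover have "norm (exp (\<i> * l * of_real x)) \<le> 1"
    using Im0 x by simp
  ultimately have "norm (exp (\<i> * l * of_real x)) * norm (Fp \<beta> g l) \<le> 1 * (224 * K)"
    by (intro mult_mono) auto
  then show "norm (exp (\<i> * l * of_real x) * Fp \<beta> g l) \<le> 224 * C / (norm l)\<^sup>2"
    by (simp add: norm_mult K_def)
qed

end

section \<open>Fourier inversion by contour deformation\<close>

lemma sin_le_zero_interval:
  "pi \<le> x \<Longrightarrow> x \<le> 2 * pi \<Longrightarrow> sin x \<le> 0" "- pi \<le> x \<Longrightarrow> x \<le> 0 \<Longrightarrow> sin x \<le> 0"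
  using sin_ge_zero[of "x - pi"] sin_ge_zero[of "- x"] sin_periodic_pi[of "x - pi"] by auto

lemma sector_Im:
  "l \<in> polar_region {1..} {pi / 3..2 * pi / 3} \<Longrightarrow> norm l \<ge> 1 \<and> Im (\<alpha> * l) \<le> 0 \<and> Im (\<alpha>\<^sup>2 * l) \<le> 0"
  "l \<in> polar_region {1..} {- pi..- 2 * pi / 3} \<Longrightarrow> norm l \<ge> 1 \<and> Im l \<le> 0 \<and> Im (\<alpha> * l) \<le> 0"
  "l \<in> polar_region {1..} {- pi / 3..0} \<Longrightarrow> norm l \<ge> 1 \<and> Im l \<le> 0 \<and> Im (\<alpha>\<^sup>2 * l) \<le> 0"
proof -
  have Im: "Im (of_real r * cis \<theta>) = r * sin \<theta>" "norm (of_real r * cis \<theta>) = r" if "1 \<le> r" for r \<theta>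
    using that by (auto simp: norm_mult)
  have le: "r * sin \<theta> \<le> 0" if "1 \<le> r" "(pi \<le> \<theta> \<and> \<theta> \<le> 2 * pi) \<or> (- pi \<le> \<theta> \<and> \<theta> \<le> 0)" for r \<theta>
    using that sin_le_zero_interval[of \<theta>] by (intro mult_nonneg_nonpos) auto
  show "norm l \<ge> 1 \<and> Im (\<alpha> * l) \<le> 0 \<and> Im (\<alpha>\<^sup>2 * l) \<le> 0" if "l \<in> polar_region {1..} {pi / 3..2 * pi / 3}"
  proof -
    obtain r \<theta> where "l = of_real r * cis \<theta>" "1 \<le> r" "pi / 3 \<le> \<theta>" "\<theta> \<le> 2 * pi / 3"
      using \<open>l \<in> _\<close> by (auto simp: polar_region_def)
    then show ?thesis
      by (auto simp only: alpha_polar Im intro!: le)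
  qed
  show "norm l \<ge> 1 \<and> Im l \<le> 0 \<and> Im (\<alpha> * l) \<le> 0" if "l \<in> polar_region {1..} {- pi..- 2 * pi / 3}"
  proof -
    obtain r \<theta> where "l = of_real r * cis \<theta>" "1 \<le> r" "- pi \<le> \<theta>" "\<theta> \<le> - 2 * pi / 3"
      using \<open>l \<in> _\<close> by (auto simp: polar_region_def)
    moreover have "0 < pi" by simp
    ultimately show ?thesis
      by (auto simp only: alpha_polar Im intro!: le)
  qed
  show "norm l \<ge> 1 \<and> Im l \<le> 0 \<and> Im (\<alpha>\<^sup>2 * l) \<le> 0" if "l \<in> polar_region {1..} {- pi / 3..0}"
  proof -
    obtain r \<theta> where "l = of_real r * cis \<theta>" "1 \<le> r" "- pi / 3 \<le> \<theta>" "\<theta> \<le> 0"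
      using \<open>l \<in> _\<close> by (auto simp: polar_region_def)
    moreover have "0 < pi" by simp
    ultimately show ?thesis
      by (auto simp only: alpha_polar Im intro!: le)
  qed
qed

lemma arc_integrable:
  assumes "a < b" and "continuous_on (polar_region {r} {a..b}) h"
  shows "h contour_integrable_on part_circlepath 0 r a b"
proof -
  have "path_image (part_circlepath 0 r a b) = polar_region {r} {a..b}"
    using \<open>a < b\<close> by (auto simp: path_image_part_circlepath' polar_region_def closed_segment_eq_real_ivl)
  then show ?thesis
    using assms(2) by (intro contour_integrable_continuous_part_circlepath) simp
qed

lemma arc_join:
  assumes "a < b" "b < c" and h: "continuous_on (polar_region {r} {a..c}) h"
  shows "contour_integral (part_circlepath 0 r a b) h + contour_integral (part_circlepath 0 r b c) h
     = contour_integral (part_circlepath 0 r a c) h"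
proof -
  let ?f = "\<lambda>t. h (0 + r * cis t) * r * \<i> * cis t"
  have f: "?f integrable_on {a..c}"
    by (intro integrable_continuous_interval continuous_intros continuous_on_compose2[OF h]) auto
  have eq: "contour_integral (part_circlepath 0 r p q) h = integral {p..q} ?f"
    if "p < q" "{p..q} \<subseteq> {a..c}" for p q
    using has_contour_integral_part_circlepath_iff[OF \<open>p < q\<close>] contour_integral_unique
      integrable_integral[OF integrable_on_subinterval[OF f that(2)]] by blast
  show ?thesis
    using assms Henstock_Kurzweil_Integration.integral_combine[OF _ _ f, of b] by (simp add: eq)
qed

lemma exp_i_2pi: "exp (\<i> * (2 * complex_of_real pi)) = 1"
  by (metis exp_two_pi_i mult.commute)

text \<open>The lower half circle arises with angles in \<open>{- pi..0}\<close>; shifted to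
  \<open>{pi..2 * pi}\<close> it can be joined to the upper one.\<close>

lemma part_circlepath_shift:
  "part_circlepath c r (a + 2 * pi) (b + 2 * pi) = part_circlepath c r a b"
proof
  fix x
  have "linepath (a + 2 * pi) (b + 2 * pi) x = linepath a b x + 2 * pi"
    by (simp add: linepath_def algebra_simps)
  then show "part_circlepath c r (a + 2 * pi) (b + 2 * pi) x = part_circlepath c r a b x"
    unfolding part_circlepath_def by (simp add: distrib_left exp_add exp_i_2pi)
qed

lemma closed_arc_zero:
  assumes "h holomorphic_on UNIV"
  shows "(h has_contour_integral 0) (part_circlepath 0 r a (a + 2 * pi))"
proof (rule Cauchy_theorem_convex_simple[OF assms])
  show "pathfinish (part_circlepath 0 r a (a + 2 * pi)) = pathstart (part_circlepath 0 r a (a + 2 * pi))"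
    by (simp add: distrib_left exp_add exp_i_2pi)
qed auto

lemma has_ray_integral_add:
  assumes g: "has_ray_integral g I a" and h: "has_ray_integral h J a"
    and cont: "continuous_on (polar_region {1..} {a}) g" "continuous_on (polar_region {1..} {a}) h"
  shows "has_ray_integral (\<lambda>l. g l + h l) (I + J) a"
proof -
  have int: "f contour_integrable_on linepath (cis a) (of_real R * cis a)"
    if "continuous_on (polar_region {1..} {a}) f" "R \<ge> 1" for f R
    using that segment_ray_subset[of 1 1 R R a "{a}"] polar_region_mono[of "{1..R}" "{1..}" "{a}" "{a}"]
    by (auto intro!: contour_integrable_continuous_linepath continuous_on_subset[OF that(1)])
  have "((\<lambda>R. contour_integral (linepath (cis a) (of_real R * cis a)) g
      + contour_integral (linepath (cis a) (of_real R * cis a)) h) \<longlongrightarrow> I + J) at_top"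
    using g h unfolding has_ray_integral_def by (rule tendsto_add)
  moreover have "eventually (\<lambda>R. contour_integral (linepath (cis a) (of_real R * cis a)) g
      + contour_integral (linepath (cis a) (of_real R * cis a)) h
      = contour_integral (linepath (cis a) (of_real R * cis a)) (\<lambda>l. g l + h l)) at_top"
    by (rule eventually_mono[OF eventually_ge_at_top[of 1]]) (simp add: contour_integral_add int cont)
  ultimately show ?thesis
    unfolding has_ray_integral_def by (rule Lim_transform_eventually)
qed

text \<open>Splitting the transform at \<open>x\<close> yields one function that decays in the upper and one that
  decays in the lower half plane, up to the term \<open>\<plusminus>i g(x)/l\<close>, which is integrated over
  half circles.\<close>

lemma fourier_inversion:
  assumes g: "\<And>y. y \<in> {0..1} \<Longrightarrow> (g has_vector_derivative g' y) (at y within {0..1})"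
    and g': "\<And>y. y \<in> {0..1} \<Longrightarrow> (g' has_vector_derivative g'' y) (at y within {0..1})"
    and cont: "continuous_on {0..1} g''" and ends: "g 0 = 0" "g 1 = 0" and x: "0 \<le> x" "x \<le> 1"
    and I: "has_ray_integral (\<lambda>l. exp (\<i> * l * of_real x) * fhat g l) I 0"
    and J: "has_ray_integral (\<lambda>l. exp (\<i> * l * of_real x) * fhat g l) J pi"
  shows "I - J - contour_integral (part_circlepath 0 1 0 pi) (\<lambda>l. exp (\<i> * l * of_real x) * fhat g l)
    = 2 * of_real pi * g x"
proof -
  define A where "A = (\<lambda>l. exp (\<i> * l * of_real x) * lap 0 x g (- \<i> * l))"
  define B where "B = (\<lambda>l. exp (\<i> * l * of_real x) * lap x 1 g (- \<i> * l))"
  have contg: "continuous_on {0..1} g"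
    using continuous_on_vector_derivative g by blast
  have h: "exp (\<i> * l * of_real x) * fhat g l = A l + B l" for l
    unfolding A_def B_def fhat_def using lap_combine[OF contg x] by (metis distrib_left)
  have sub: "{0..x} \<subseteq> {0..1}" "{x..1} \<subseteq> {0..1}" using x by auto
  have holo: "(\<lambda>l. exp (\<i> * l * of_real x) * lap p q g (- \<i> * l)) holomorphic_on UNIV"
    if "{p..q} \<subseteq> {0..1}" for p q
  proof -
    have "(\<lambda>l. lap p q g (- \<i> * l)) holomorphic_on UNIV"
      by (rule holomorphic_on_compose_gen[OF _ holomorphic_lap[OF continuous_on_subset[OF contg that]], unfolded o_def])
        (auto intro!: holomorphic_intros)
    then show ?thesis by (intro holomorphic_intros)
  qed
  have hA: "A holomorphic_on UNIV" and hB: "B holomorphic_on UNIV"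
    unfolding A_def B_def using holo sub by auto
  have cA: "continuous_on S A" and cB: "continuous_on S B" for S
    using hA hB holomorphic_on_imp_continuous_on continuous_on_subset by blast+
  have aA: "A analytic_on S" and aB: "B analytic_on S" for S
    using hA hB analytic_on_holomorphic by blast+
  have v: "(g has_vector_derivative g' y) (at y within {p..q})"
    and v': "(g' has_vector_derivative g'' y) (at y within {p..q})"
    if "{p..q} \<subseteq> {0..1}" "y \<in> {p..q}" for y p q
    using that by (auto intro: has_vector_derivative_within_subset[OF g] has_vector_derivative_within_subset[OF g'])
  obtain CA where CA: "CA \<ge> 0"
    "\<And>w. norm (w\<^sup>2 * lap 0 x g w - w * (exp (w * of_real x) * g x - exp (w * of_real 0) * g 0))
       \<le> CA * max (exp (Re w * 0)) (exp (Re w * x))"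
    using lap_bound2[OF x(1) v[OF sub(1)] v'[OF sub(1)] continuous_on_subset[OF cont sub(1)]] by blast
  obtain CB where CB: "CB \<ge> 0"
    "\<And>w. norm (w\<^sup>2 * lap x 1 g w - w * (exp (w * of_real 1) * g 1 - exp (w * of_real x) * g x))
       \<le> CB * max (exp (Re w * x)) (exp (Re w * 1))"
    using lap_bound2[OF x(2) v[OF sub(2)] v'[OF sub(2)] continuous_on_subset[OF cont sub(2)]] by blast
  \<comment> \<open>In the upper half plane the transform over \<open>{0..x}\<close> grows at most
    like \<open>exp (Im l * x)\<close>, which the factor \<open>exp (\<i> * l * x)\<close>
    compensates exactly; this is why the split is made at \<open>x\<close>.\<close>
  have bA: "norm (l * A l - \<i> * g x) \<le> CA / norm l" if l: "l \<in> polar_region {1..} {0..pi}" for l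
  proof -
    have l0: "norm l > 0" and Im: "Im l \<ge> 0"
      using l by (auto simp: polar_region_def norm_mult intro!: mult_nonneg_nonneg sin_ge_zero)
    have "norm (exp (\<i> * l * of_real x)) = exp (- (Im l * x))" by simp
    let ?w = "- \<i> * l"
    have "l * (l * A l - \<i> * g x) = - (exp (\<i> * l * of_real x) * (?w\<^sup>2 * lap 0 x g ?w
        - ?w * (exp (?w * of_real x) * g x - exp (?w * of_real 0) * g 0)))"
    proof -
      have "exp (\<i> * l * of_real x) * exp (?w * of_real x) = 1"
        unfolding exp_add[symmetric] by simp
      then have e: "exp (\<i> * l * of_real x) * (exp (?w * of_real x) * g x) = g x"
        by (simp add: mult.assoc[symmetric])
      have "- (exp (\<i> * l * of_real x) * (?w\<^sup>2 * lap 0 x g ?w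
        - ?w * (exp (?w * of_real x) * g x - exp (?w * of_real 0) * g 0)))
        = - (?w\<^sup>2 * (exp (\<i> * l * of_real x) * lap 0 x g ?w))
          + ?w * (exp (\<i> * l * of_real x) * (exp (?w * of_real x) * g x))"
        using ends by (simp add: algebra_simps)
      also have "\<dots> = l * (l * A l - \<i> * g x)"
        unfolding e A_def by (simp add: power2_eq_square algebra_simps)
      finally show ?thesis ..
    qed
    then have "norm l * norm (l * A l - \<i> * g x) = exp (- (Im l * x)) * norm (?w\<^sup>2 * lap 0 x g ?w
        - ?w * (exp (?w * of_real x) * g x - exp (?w * of_real 0) * g 0))"
      by (metis norm_minus_cancel norm_mult \<open>norm (exp (\<i> * l * of_real x)) = exp (- (Im l * x))\<close>)
    also have "\<dots> \<le> exp (- (Im l * x)) * (CA * max (exp (Re ?w * 0)) (exp (Re ?w * x)))"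
      by (intro mult_left_mono CA) auto
    also have "\<dots> = CA * (exp (- (Im l * x)) * exp (Im l * x))"
      using Im x by (subst max_absorb2) auto
    also have "\<dots> = CA"
      unfolding exp_add[symmetric] by simp
    finally show ?thesis
      using l0 by (simp add: field_simps)
  qed
  have bB: "norm (l * B l - (- \<i> * g x)) \<le> CB / norm l" if l: "l \<in> polar_region {1..} {- pi..0}" for l
  proof -
    have l0: "norm l > 0" and Im: "Im l \<le> 0"
      using l by (auto simp: polar_region_def norm_mult intro!: mult_nonneg_nonpos sin_le_zero_interval(2))
    have n: "norm (exp (\<i> * l * of_real x)) = exp (- (Im l * x))" by simp
    let ?w = "- \<i> * l"
    have "l * (l * B l - (- \<i> * g x)) = - (exp (\<i> * l * of_real x) * (?w\<^sup>2 * lap x 1 g ?w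
        - ?w * (exp (?w * of_real 1) * g 1 - exp (?w * of_real x) * g x)))"
    proof -
      have "exp (\<i> * l * of_real x) * exp (?w * of_real x) = 1"
        unfolding exp_add[symmetric] by simp
      then have e: "exp (\<i> * l * of_real x) * (exp (?w * of_real x) * g x) = g x"
        by (simp add: mult.assoc[symmetric])
      have "- (exp (\<i> * l * of_real x) * (?w\<^sup>2 * lap x 1 g ?w
        - ?w * (exp (?w * of_real 1) * g 1 - exp (?w * of_real x) * g x)))
        = - (?w\<^sup>2 * (exp (\<i> * l * of_real x) * lap x 1 g ?w))
          - ?w * (exp (\<i> * l * of_real x) * (exp (?w * of_real x) * g x))"
        using ends by (simp add: algebra_simps)
      also have "\<dots> = l * (l * B l - (- \<i> * g x))"
        unfolding e B_def by (simp add: power2_eq_square algebra_simps)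
      finally show ?thesis ..
    qed
    then have "norm l * norm (l * B l - (- \<i> * g x)) = exp (- (Im l * x)) * norm (?w\<^sup>2 * lap x 1 g ?w
        - ?w * (exp (?w * of_real 1) * g 1 - exp (?w * of_real x) * g x))"
      by (metis norm_minus_cancel norm_mult n)
    also have "\<dots> \<le> exp (- (Im l * x)) * (CB * max (exp (Re ?w * x)) (exp (Re ?w * 1)))"
      by (intro mult_left_mono CB) auto
    also have "\<dots> = CB * (exp (- (Im l * x)) * exp (Im l * x))"
    proof -
      have "Im l * 1 \<le> Im l * x" using Im x by (intro mult_left_mono_neg) auto
      then show ?thesis by (subst max_absorb1) auto
    qed
    also have "\<dots> = CB"
      unfolding exp_add[symmetric] by simp
    finally show ?thesis
      using l0 by (simp add: field_simps)
  qed
  let ?ray = "\<lambda>f a R. contour_integral (linepath (cis a) (of_real R * cis a)) f"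
  let ?arc = "\<lambda>f a b. contour_integral (part_circlepath 0 1 a b) f"
  have cis: "cis (- pi) = cis pi" by (simp add: complex_eq_iff)
  \<comment> \<open>Here \<open>m = \<i> * g x\<close>, so \<open>- m * \<i> * pi\<close> equals
    \<open>pi * g x\<close>. For \<open>B\<close> the sign of \<open>m\<close> is reversed.\<close>
  have limA: "((\<lambda>R. ?ray A 0 R - ?ray A pi R) \<longlongrightarrow> ?arc A 0 pi + of_real pi * g x) at_top"
    using sector_Cauchy[of 0 pi, OF _ aA bA] by (simp add: mult_ac)
  have limB: "((\<lambda>R. ?ray B (- pi) R - ?ray B 0 R) \<longlongrightarrow> ?arc B (- pi) 0 - of_real pi * g x) at_top"
    using sector_Cauchy[of "- pi" 0, OF _ aB bB] by (simp add: mult_ac)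
  \<comment> \<open>\<open>B\<close> is entire, so its integral over the full circle vanishes and
    the lower half circle can be flipped to the upper one.\<close>
  have arcB: "?arc B (- pi) 0 = - ?arc B 0 pi"
    using arc_join[OF _ _ cB, of "- pi" 0 pi 1] contour_integral_unique[OF closed_arc_zero[OF hB, of 1 "- pi"]]
    by (simp add: eq_neg_iff_add_eq_0)
  \<comment> \<open>The rays of \<open>A\<close> and of \<open>B\<close> have \<open>1 / l\<close>
    tails that may prevent convergence one by one. At a common radius they recombine into rays of
    \<open>A + B\<close>, whose limits are \<open>I\<close> and \<open>J\<close>, and the two
    half-circle contributions add up to \<open>2 * pi * g x\<close>.\<close>
  have "((\<lambda>R. (?ray A 0 R - ?ray A pi R) - (?ray B (- pi) R - ?ray B 0 R)) \<longlongrightarrow>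
     (?arc A 0 pi + of_real pi * g x) - (?arc B (- pi) 0 - of_real pi * g x)) at_top"
    by (intro tendsto_diff limA limB)
  also have "(\<lambda>R. (?ray A 0 R - ?ray A pi R) - (?ray B (- pi) R - ?ray B 0 R))
     = (\<lambda>R. ?ray (\<lambda>l. A l + B l) 0 R - ?ray (\<lambda>l. A l + B l) pi R)"
    unfolding cis
    by (simp add: contour_integral_add contour_integrable_continuous_linepath cA cB algebra_simps)
  also have "(?arc A 0 pi + of_real pi * g x) - (?arc B (- pi) 0 - of_real pi * g x)
     = ?arc (\<lambda>l. A l + B l) 0 pi + 2 * of_real pi * g x"
    unfolding arcB
    by (simp add: contour_integral_add contour_integrable_continuous_part_circlepath cA cB algebra_simps)
  finally have "((\<lambda>R. ?ray (\<lambda>l. A l + B l) 0 R - ?ray (\<lambda>l. A l + B l) pi R)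
     \<longlongrightarrow> ?arc (\<lambda>l. A l + B l) 0 pi + 2 * of_real pi * g x) at_top" .
  moreover have "((\<lambda>R. ?ray (\<lambda>l. A l + B l) 0 R - ?ray (\<lambda>l. A l + B l) pi R) \<longlongrightarrow> I - J) at_top"
    using I J unfolding has_ray_integral_def h by (rule tendsto_diff)
  ultimately have "I - J = ?arc (\<lambda>l. A l + B l) 0 pi + 2 * of_real pi * g x"
    using tendsto_unique trivial_limit_at_top_linorder by blast
  then show ?thesis
    by (simp add: h)
qed

section \<open>The inversion theorem\<close>

text \<open>In the sectors this is a by-product of the decay estimates, read off from the zero
  function; in the punctured unit disc it is the Taylor estimate.\<close>

lemma Delta_nonzero:
  assumes \<beta>: "0 \<le> \<beta>" "\<beta> \<le> 1 / 2"
    and l: "0 < norm l \<and> norm l \<le> 1 \<or> l \<in> polar_region {1..} {pi / 3..2 * pi / 3}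
      \<or> l \<in> polar_region {1..} {- pi..- 2 * pi / 3} \<or> l \<in> polar_region {1..} {- pi / 3..0}"
  shows "Delta \<beta> l \<noteq> 0"
proof -
  interpret decaying_transform \<beta> "\<lambda>_. 0" 0
    using \<beta> by unfold_locales (auto simp: fhat_def lap_def)
  have "Delta \<beta> l \<noteq> 0" if "0 < norm l" "norm l \<le> 1"
    using Delta_lower_near[of \<beta> l] that \<beta> by (auto simp: field_simps)
  then show ?thesis
    using l Fp_bound(2)[of 0 l] Fm_bound(2)[of 0 l] sector_Im[of l] by fastforce
qed

lemma inversion:
  assumes \<beta>: "0 \<le> \<beta>" "\<beta> \<le> 1 / 2"
    and g: "\<And>y. y \<in> {0..1} \<Longrightarrow> (g has_vector_derivative g' y) (at y within {0..1})"
    and g': "\<And>y. y \<in> {0..1} \<Longrightarrow> (g' has_vector_derivative g'' y) (at y within {0..1})"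
    and cont: "continuous_on {0..1} g''" and ends: "g 0 = 0" "g 1 = 0" and x: "0 \<le> x" "x \<le> 1"
  defines "P \<equiv> \<lambda>l. exp (\<i> * l * of_real x) * Fp \<beta> g l"
    and "M \<equiv> \<lambda>l. exp (\<i> * l * of_real x) * Fm \<beta> g l"
  obtains J0 J1 J2 J3 where
    "(P has_contour_integral J0) (circlepath 0 (1/2))"
    "has_sector_integral P J1 0 (pi/3)" "has_sector_integral P J2 (2*pi/3) pi"
    "has_sector_integral M J3 (-2*pi/3) (-pi/3)"
    "g x = J0 + (J1 + J2) + J3"
proof -
  obtain C where C: "C \<ge> 0" "\<And>l. l \<noteq> 0 \<Longrightarrow> norm (fhat g l) \<le> C / (norm l)\<^sup>2 * max 1 (exp (Im l))"
    using fhat_bound[OF g g' cont ends] by blast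
  interpret decaying_transform \<beta> g C
    using \<beta> C by unfold_locales
  have contg: "continuous_on {0..1} g"
    using continuous_on_vector_derivative g by blast
  define h where "h = (\<lambda>l. exp (\<i> * l * of_real x) * fhat g l)"
  define k where "k = (\<lambda>l. h l * (1 / (2 * of_real pi)))"
  have h: "h holomorphic_on UNIV"
    unfolding h_def by (intro holomorphic_intros holomorphic_fhat contg)
  have k: "k holomorphic_on UNIV"
    unfolding k_def by (intro holomorphic_intros h)
  have ck: "continuous_on S k" and ch: "continuous_on S h" for S
    using h k holomorphic_on_imp_continuous_on continuous_on_subset by blast+
  have P: "P = (\<lambda>l. M l + k l)"
    by (simp add: P_def M_def k_def h_def Fp_def algebra_simps)
  \<comment> \<open>The index counts sextants counterclockwise from the positive real axis; the odd
    ones are those with \<open>Im (l ^ 3) > 0\<close> inside.\<close>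
  let ?S2 = "polar_region {1..} {pi / 3..2 * pi / 3}"
  let ?S4 = "polar_region {1..} {- pi..- 2 * pi / 3}"
  let ?S6 = "polar_region {1..} {- pi / 3..0}"
  \<comment> \<open>The punctured unit disc is included so that the unit circle can be shrunk to the
    radius 1/2 of \<open>Gamma_zero\<close>.\<close>
  define Z where "Z = {l. 0 < norm l \<and> norm l \<le> 1} \<union> ?S2 \<union> ?S4 \<union> ?S6"
  have Z0: "Delta \<beta> l \<noteq> 0" if "l \<in> Z" for l
    using that Delta_nonzero[OF \<beta>, of l] unfolding Z_def by blast
  have aM: "M analytic_on Z" and aP: "P analytic_on Z"
    unfolding M_def P_def by (intro analytic_intros analytic_Fm analytic_Fp contg Z0; simp)+
  have cM: "continuous_on S M" and cP: "continuous_on S P" if "S \<subseteq> Z" for S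
    using aM aP that analytic_imp_holomorphic holomorphic_on_imp_continuous_on continuous_on_subset by blast+
  have unit: "polar_region {1} B \<subseteq> Z" for B
    by (auto simp: polar_region_def Z_def norm_mult)
  have cis: "cis (- pi) = cis pi" by (simp add: complex_eq_iff)
  have polar_pi: "polar_region {1..} {pi} = polar_region {1..} {- pi}"
    by (simp add: polar_region_def cis)
  have in_Z: "polar_region {1..} {pi / 3} \<subseteq> Z" "polar_region {1..} {2 * pi / 3} \<subseteq> Z" "polar_region {1..} {- pi} \<subseteq> Z"
    "polar_region {1..} {- 2 * pi / 3} \<subseteq> Z" "polar_region {1..} {- pi / 3} \<subseteq> Z" "polar_region {1..} {0} \<subseteq> Z"
    "polar_region {1..} {pi} \<subseteq> Z"
    using polar_region_mono[of "{1..}" "{1..}" "{pi / 3}" "{pi / 3..2 * pi / 3}"]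
      polar_region_mono[of "{1..}" "{1..}" "{2 * pi / 3}" "{pi / 3..2 * pi / 3}"]
      polar_region_mono[of "{1..}" "{1..}" "{- pi}" "{- pi..- 2 * pi / 3}"]
      polar_region_mono[of "{1..}" "{1..}" "{- 2 * pi / 3}" "{- pi..- 2 * pi / 3}"]
      polar_region_mono[of "{1..}" "{1..}" "{- pi / 3}" "{- pi / 3..0}"]
      polar_region_mono[of "{1..}" "{1..}" "{0}" "{- pi / 3..0}"]
    unfolding Z_def polar_pi by auto
  define K where "K = 224 * C"
  have bP: "norm (P l) \<le> K / (norm l)\<^sup>2" if "l \<in> ?S2" for l
    unfolding P_def K_def using Fp_bound(1)[of x l] sector_Im(1)[OF that] x by blast
  have bM4: "norm (M l) \<le> K / (norm l)\<^sup>2" if "l \<in> ?S4" for l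
    unfolding M_def K_def using Fm_bound(1)[of x l] sector_Im(2)[OF that] x by blast
  have bM6: "norm (M l) \<le> K / (norm l)\<^sup>2" if "l \<in> ?S6" for l
    unfolding M_def K_def using Fm_bound(1)[of x l] sector_Im(3)[OF that] x by blast
  have bh: "norm (h l) \<le> C / (norm l)\<^sup>2" if "Im l = 0" "l \<noteq> 0" for l
    using C(2)[OF that(2)] that(1) by (simp add: h_def norm_mult)
  have sub: "polar_region {1..} {a} \<subseteq> polar_region {1..} {b..c}" if "a \<in> {b..c}" for a b c
    using that by (intro polar_region_mono) auto
  obtain p1 where p1: "has_ray_integral P p1 (pi / 3)"
    by (rule ray_integral_exists[OF cP[OF in_Z(1)] bP]) (use sub[of "pi / 3" "pi / 3" "2 * pi / 3"] in auto)
  obtain p2 where p2: "has_ray_integral P p2 (2 * pi / 3)"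
    by (rule ray_integral_exists[OF cP[OF in_Z(2)] bP]) (use sub[of "2 * pi / 3" "pi / 3" "2 * pi / 3"] in auto)
  obtain m1 where m1: "has_ray_integral M m1 (- pi)"
    by (rule ray_integral_exists[OF cM[OF in_Z(3)] bM4]) (use sub[of "- pi" "- pi" "- 2 * pi / 3"] in auto)
  obtain m2 where m2: "has_ray_integral M m2 (- 2 * pi / 3)"
    by (rule ray_integral_exists[OF cM[OF in_Z(4)] bM4]) (use sub[of "- 2 * pi / 3" "- pi" "- 2 * pi / 3"] in auto)
  obtain m3 where m3: "has_ray_integral M m3 (- pi / 3)"
    by (rule ray_integral_exists[OF cM[OF in_Z(5)] bM6]) (use sub[of "- pi / 3" "- pi / 3" 0] in auto)
  obtain m0 where m0: "has_ray_integral M m0 0"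
    by (rule ray_integral_exists[OF cM[OF in_Z(6)] bM6]) (use sub[of 0 "- pi / 3" 0] in auto)
  obtain h0 where h0: "has_ray_integral h h0 0"
    by (rule ray_integral_exists[OF ch bh]) (auto simp: polar_region_def)
  obtain h1 where h1: "has_ray_integral h h1 pi"
    by (rule ray_integral_exists[OF ch bh]) (auto simp: polar_region_def)
  have kray: "has_ray_integral k (I / (2 * of_real pi)) a" if "has_ray_integral h I a" for I a
  proof -
    have "contour_integral (linepath (cis a) (of_real R * cis a)) k
      = contour_integral (linepath (cis a) (of_real R * cis a)) h * (1 / (2 * of_real pi))" for R
      unfolding k_def by (intro contour_integral_rmul contour_integrable_continuous_linepath ch)
    then show ?thesis
      using tendsto_mult_right[OF that[unfolded has_ray_integral_def], of "1 / (2 * of_real pi)"]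
      by (simp add: has_ray_integral_def)
  qed
  define k0 k1 where "k0 = h0 / (2 * of_real pi)" and "k1 = h1 / (2 * of_real pi)"
  \<comment> \<open>The estimate \<open>bP\<close> does not reach the real axis. There
    \<open>P\<close> is split as \<open>M + k\<close>, with \<open>M\<close> controlled from the
    adjacent lower sector and \<open>k\<close> by the decay of the Fourier transform for real
    \<open>l\<close>. The same is done on the ray at \<open>pi\<close>.\<close>
  have P0: "has_ray_integral P (m0 + k0) 0"
    unfolding P k0_def by (intro has_ray_integral_add m0 kray h0 cM in_Z ck)
  have "has_ray_integral M m1 pi"
    using m1 by (simp add: has_ray_integral_def cis)
  then have P1: "has_ray_integral P (m1 + k1) pi"
    unfolding P k1_def by (intro has_ray_integral_add kray h1 cM in_Z ck)
  let ?arc = "\<lambda>f a b. contour_integral (part_circlepath 0 1 a b) f"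
  have s1: "has_sector_integral P (m0 + k0 - p1 - ?arc P 0 (pi/3)) 0 (pi/3)"
    by (rule has_sector_integralI[OF _ _ P0 p1]) (simp, unfold sector_boundary_def, intro cP Un_least in_Z unit)
  have s2: "has_sector_integral P (p2 - (m1 + k1) - ?arc P (2*pi/3) pi) (2*pi/3) pi"
    by (rule has_sector_integralI[OF _ _ p2 P1]) (simp, unfold sector_boundary_def, intro cP Un_least in_Z unit)
  have s3: "has_sector_integral M (m2 - m3 - ?arc M (- 2*pi/3) (- pi/3)) (- 2*pi/3) (- pi/3)"
    by (rule has_sector_integralI[OF _ _ m2 m3]) (simp, unfold sector_boundary_def, intro cM Un_least in_Z unit)
  have z2: "p1 - p2 = ?arc P (pi/3) (2*pi/3)"
    by (rule sector_Cauchy_zero[OF _ analytic_on_subset[OF aP] bP p1 p2]) (auto simp: Z_def)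
  have z4: "m1 - m2 = ?arc M (- pi) (- 2*pi/3)"
    by (rule sector_Cauchy_zero[OF _ analytic_on_subset[OF aM] bM4 m1 m2]) (auto simp: Z_def)
  have z6: "m3 - m0 = ?arc M (- pi/3) 0"
    by (rule sector_Cauchy_zero[OF _ analytic_on_subset[OF aM] bM6 m3 m0]) (auto simp: Z_def)
  have F: "k0 - k1 - ?arc k 0 pi = g x"
  proof -
    have "?arc k 0 pi = ?arc h 0 pi * (1 / (2 * of_real pi))"
      unfolding k_def by (intro contour_integral_rmul contour_integrable_continuous_part_circlepath ch)
    moreover have "h0 - h1 - ?arc h 0 pi = 2 * of_real pi * g x"
      using fourier_inversion[OF g g' cont ends x] h0 h1 unfolding h_def by blast
    ultimately show ?thesis
      by (simp add: k0_def k1_def field_simps)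
  qed
  have aP3: "?arc P 0 (pi/3) + ?arc P (pi/3) (2*pi/3) + ?arc P (2*pi/3) pi = ?arc P 0 pi"
    using arc_join[OF _ _ cP[OF unit], of 0 "pi/3" "2*pi/3"] arc_join[OF _ _ cP[OF unit], of 0 "2*pi/3" pi] by simp
  have aM3: "?arc M (- pi) (- 2*pi/3) + ?arc M (- 2*pi/3) (- pi/3) + ?arc M (- pi/3) 0 = ?arc M (- pi) 0"
    using arc_join[OF _ _ cM[OF unit], of "- pi" "- 2*pi/3" "- pi/3"] arc_join[OF _ _ cM[OF unit], of "- pi" "- pi/3" 0] by simp
  have aPk: "?arc P 0 pi = ?arc M 0 pi + ?arc k 0 pi"
    unfolding P by (intro contour_integral_add arc_integrable cM unit ck) auto
  have shift: "?arc M (- pi) 0 = ?arc M pi (2 * pi)"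
    using part_circlepath_shift[of 0 1 "- pi" 0] by simp
  have circ: "?arc M 0 pi + ?arc M (- pi) 0 = ?arc M 0 (2 * pi)"
    unfolding shift using arc_join[OF _ _ cM[OF unit], of 0 pi "2*pi"] by simp
  have half: "polar_region {1/2..1} B \<subseteq> Z" for B
    by (auto simp: polar_region_def Z_def norm_mult)
  \<comment> \<open>The annular sector is opened to a full turn; its two straight sides coincide and
    cancel.\<close>
  have "contour_integral (part_circlepath 0 (1/2) 0 (2 * pi)) M = ?arc M 0 (2 * pi)"
    using polar_Cauchy[of "1/2" 1 0 "2 * pi" M] analytic_on_subset[OF aM half] by simp
  moreover have "M contour_integrable_on part_circlepath 0 (1/2) 0 (2 * pi)"
    by (intro arc_integrable cM order_trans[OF polar_region_mono half]) auto
  ultimately have "(M has_contour_integral ?arc M 0 (2 * pi)) (part_circlepath 0 (1/2) 0 (2 * pi))"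
    using has_contour_integral_integral by metis
  from has_contour_integral_add[OF this closed_arc_zero[OF k, of "1/2" 0, simplified]]
  have s0: "(P has_contour_integral ?arc M 0 (2 * pi)) (circlepath 0 (1/2))"
    unfolding P circlepath_def by simp
  show ?thesis
  proof (rule that[OF s0 s1 s2 s3])
    have p: "p1 = p2 + ?arc P (pi/3) (2*pi/3)" and m1: "m1 = m2 + ?arc M (- pi) (- 2*pi/3)"
      and m3: "m3 = m0 + ?arc M (- pi/3) 0"
      using z2 z4 z6 by (simp_all only: diff_eq_eq add.commute)
    have k: "?arc k 0 pi = ?arc P 0 (pi/3) + ?arc P (pi/3) (2*pi/3) + ?arc P (2*pi/3) pi - ?arc M 0 pi"
      unfolding aP3 aPk by simp
    \<comment> \<open>All rays except \<open>k0\<close> and \<open>k1\<close> cancel in pairs. The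
      arcs assemble to minus the unit circle for \<open>M\<close>, cancelled by \<open>J0\<close>,
      and minus the upper half circle for \<open>k\<close>, which completes
      \<open>F\<close>.\<close>
    show "g x = ?arc M 0 (2 * pi) + (m0 + k0 - p1 - ?arc P 0 (pi/3) + (p2 - (m1 + k1) - ?arc P (2*pi/3) pi))
        + (m2 - m3 - ?arc M (- 2*pi/3) (- pi/3))"
      unfolding F[symmetric] circ[symmetric] aM3[symmetric] p m1 m3 k by simp
  qed
qed

section \<open>Evolution of the transforms\<close>

lemma smooth_onD:
  assumes "smooth_on S u"
  shows smooth_onD_continuous: "continuous_on S u"
    and smooth_onD_differentiable: "u differentiable_on S"
    and smooth_onD_frechet: "smooth_on S (\<lambda>p. frechet_derivative u (at p within S) v)"
proof -
  have "times_differentiable_on 0 S u" and *: "times_differentiable_on (Suc n) S u" for n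
    using assms unfolding smooth_on_def by blast+
  then show "continuous_on S u" "u differentiable_on S"
    using *[of 0] by simp_all
  show "smooth_on S (\<lambda>p. frechet_derivative u (at p within S) v)"
    unfolding smooth_on_def using * by simp
qed

text \<open>The chain rule within \<open>S\<close>: it turns the Frechet derivatives of
  \<open>smooth_on\<close> into one-sided partial derivatives along coordinate lines, up to the
  boundary.\<close>

lemma smooth_on_line_derivative:
  fixes u :: "'a::real_normed_vector \<Rightarrow> 'b::real_normed_vector" and c :: "real \<Rightarrow> 'a"
  assumes u: "smooth_on S u" and c: "(c has_vector_derivative v) (at s within I)"
    and I: "c ` I \<subseteq> S" "s \<in> I"
  shows "((\<lambda>r. u (c r)) has_vector_derivative frechet_derivative u (at (c s) within S) v) (at s within I)"
proof -
  let ?L = "frechet_derivative u (at (c s) within S)"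
  have "u differentiable (at (c s) within S)"
    using smooth_onD_differentiable[OF u] I unfolding differentiable_on_def by blast
  then have L: "(u has_derivative ?L) (at (c s) within S)"
    using frechet_derivative_works by blast
  have "((\<lambda>r. u (c r)) has_derivative (\<lambda>h. ?L (h *\<^sub>R v))) (at s within I)"
    using c unfolding has_vector_derivative_def
    by (rule has_derivative_in_compose) (rule has_derivative_subset[OF L I(1)])
  then show ?thesis
    unfolding has_vector_derivative_def
    using linear_cmul[OF has_derivative_linear[OF L]] by simp
qed

lemma deriv01_eq:
  assumes "(g has_vector_derivative d) (at x within {0..1})" "x \<in> {0..1}"
  shows "deriv01 g x = d"
  unfolding deriv01_def using vector_derivative_within_cbox[of 0 1 x g d] assms by simp

text \<open>\<open>q1\<close>, \<open>q2\<close>, \<open>q3\<close> are the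
  \<open>x\<close>-derivatives and \<open>qt\<close>, \<open>q1t\<close>, \<open>q2t\<close> the
  time derivatives of \<open>q\<close>, \<open>q1\<close>, \<open>q2\<close>. The last two serve to
  integrate by parts in time at the ends of the interval.\<close>

locale regular_solution =
  fixes T :: real and q q1 q2 q3 qt q1t q2t :: "real \<Rightarrow> real \<Rightarrow> complex"
  assumes T: "0 < T"
    and dx: "\<And>x t. x \<in> {0..1} \<Longrightarrow> t \<in> {0..T} \<Longrightarrow> ((\<lambda>y. q y t) has_vector_derivative q1 x t) (at x within {0..1})"
      "\<And>x t. x \<in> {0..1} \<Longrightarrow> t \<in> {0..T} \<Longrightarrow> ((\<lambda>y. q1 y t) has_vector_derivative q2 x t) (at x within {0..1})"
      "\<And>x t. x \<in> {0..1} \<Longrightarrow> t \<in> {0..T} \<Longrightarrow> ((\<lambda>y. q2 y t) has_vector_derivative q3 x t) (at x within {0..1})"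
    and dt: "\<And>x t. x \<in> {0..1} \<Longrightarrow> t \<in> {0..T} \<Longrightarrow> (q x has_vector_derivative qt x t) (at t within {0..T})"
      "\<And>x t. x \<in> {0..1} \<Longrightarrow> t \<in> {0..T} \<Longrightarrow> (q1 x has_vector_derivative q1t x t) (at t within {0..T})"
      "\<And>x t. x \<in> {0..1} \<Longrightarrow> t \<in> {0..T} \<Longrightarrow> (q2 x has_vector_derivative q2t x t) (at t within {0..T})"
    and cont: "continuous_on ({0..1} \<times> {0..T}) (\<lambda>(x, t). qt x t)"
      "continuous_on ({0..1} \<times> {0..T}) (\<lambda>(x, t). q3 x t)"
      "continuous_on ({0..1} \<times> {0..T}) (\<lambda>(x, t). q1t x t)"
      "continuous_on ({0..1} \<times> {0..T}) (\<lambda>(x, t). q2t x t)"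
    and pde: "\<And>x t. x \<in> {0..1} \<Longrightarrow> t \<in> {0..T} \<Longrightarrow> qt x t = - q3 x t"

lemma solves_ivp_regular:
  assumes "T > 0" and q: "solves_ivp T f q"
  obtains q1 q2 q3 qt q1t q2t where "regular_solution T q q1 q2 q3 qt q1t q2t"
    "\<And>x t. x \<in> {0..1} \<Longrightarrow> t \<in> {0..T} \<Longrightarrow> partial_x q x t = q1 x t"
proof -
  define S :: "(real \<times> real) set" where "S = {0..1} \<times> {0..T}"
  define D where "D = (\<lambda>v (u :: real \<times> real \<Rightarrow> complex) p. frechet_derivative u (at p within S) v)"
  define u where "u = (\<lambda>(x, t). q x t)"
  have u: "smooth_on S u"
    using q by (simp add: solves_ivp_def S_def u_def)
  have D: "smooth_on S (D v w)" if "smooth_on S w" for v w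
    unfolding D_def by (rule smooth_onD_frechet[OF that])
  have Dx: "((\<lambda>y. w (y, t)) has_vector_derivative D (1, 0) w (x, t)) (at x within {0..1})"
    if "smooth_on S w" "x \<in> {0..1}" "t \<in> {0..T}" for w x t
    unfolding D_def
    by (rule smooth_on_line_derivative[OF that(1)])
      (use that in \<open>auto simp: S_def has_vector_derivative_def intro!: derivative_eq_intros\<close>)
  have Dt: "((\<lambda>s. w (x, s)) has_vector_derivative D (0, 1) w (x, t)) (at t within {0..T})"
    if "smooth_on S w" "x \<in> {0..1}" "t \<in> {0..T}" for w x t
    unfolding D_def
    by (rule smooth_on_line_derivative[OF that(1)])
      (use that in \<open>auto simp: S_def has_vector_derivative_def intro!: derivative_eq_intros\<close>)
  define u1 u2 u3 where "u1 = D (1, 0) u" and "u2 = D (1, 0) u1" and "u3 = D (1, 0) u2"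
  have smooth: "smooth_on S u1" "smooth_on S u2" "smooth_on S u3"
    unfolding u1_def u2_def u3_def by (intro D u)+
  have px1: "partial_x q x t = u1 (x, t)" if "x \<in> {0..1}" "t \<in> {0..T}" for x t
    using deriv01_eq[OF Dx[OF u that] that(1)] by (simp add: partial_x_def u_def u1_def)
  have px2: "partial_x (partial_x q) x t = u2 (x, t)" if "x \<in> {0..1}" "t \<in> {0..T}" for x t
  proof -
    have "((\<lambda>y. partial_x q y t) has_vector_derivative u2 (x, t)) (at x within {0..1})"
      unfolding u2_def
      by (rule has_vector_derivative_transform[OF that(1) _ Dx[OF smooth(1) that]]) (use px1 that in auto)
    from deriv01_eq[OF this that(1)] show ?thesis
      by (simp add: partial_x_def[of "partial_x q"])
  qed
  have px3: "partial_x (partial_x (partial_x q)) x t = u3 (x, t)" if "x \<in> {0..1}" "t \<in> {0..T}" for x t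
  proof -
    have "((\<lambda>y. partial_x (partial_x q) y t) has_vector_derivative u3 (x, t)) (at x within {0..1})"
      unfolding u3_def
      by (rule has_vector_derivative_transform[OF that(1) _ Dx[OF smooth(2) that]]) (use px2 that in auto)
    from deriv01_eq[OF this that(1)] show ?thesis
      by (simp add: partial_x_def[of "partial_x (partial_x q)"])
  qed
  have pt: "partial_t T q x t = D (0, 1) u (x, t)" if "x \<in> {0..1}" "t \<in> {0..T}" for x t
    using vector_derivative_within_cbox[of 0 T t "\<lambda>s. q x s" "D (0, 1) u (x, t)"] Dt[OF u that] that \<open>T > 0\<close>
    by (simp add: partial_t_def u_def)
  \<comment> \<open>The equation is given in the open rectangle only. Continuity extends it to the
    closed one, where the integrations in \<open>x\<close> and in time take place.\<close>
  have pde: "D (0, 1) u p + u3 p = 0" if "p \<in> S" for p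
  proof (rule continuous_constant_on_closure[of "{0<..<1} \<times> {0<..<T}" "\<lambda>p. D (0, 1) u p + u3 p"])
    have cl: "closure ({0<..<1::real} \<times> {0<..<T}) = S"
      using \<open>T > 0\<close> by (simp add: closure_Times S_def)
    show "continuous_on (closure ({0<..<1} \<times> {0<..<T})) (\<lambda>p. D (0, 1) u p + u3 p)"
      unfolding cl by (intro continuous_intros smooth_onD_continuous smooth D u)
    show "p \<in> closure ({0<..<1} \<times> {0<..<T})"
      unfolding cl by (rule that)
    fix p :: "real \<times> real" assume "p \<in> {0<..<1} \<times> {0<..<T}"
    then show "D (0, 1) u p + u3 p = 0"
      using q pt px3 unfolding solves_ivp_def by (cases p) auto
  qed
  show ?thesis
  proof (rule that[of "\<lambda>x t. u1 (x, t)" "\<lambda>x t. u2 (x, t)" "\<lambda>x t. u3 (x, t)" "\<lambda>x t. D (0, 1) u (x, t)"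
        "\<lambda>x t. D (0, 1) u1 (x, t)" "\<lambda>x t. D (0, 1) u2 (x, t)"])
    show "regular_solution T q (\<lambda>x t. u1 (x, t)) (\<lambda>x t. u2 (x, t)) (\<lambda>x t. u3 (x, t))
        (\<lambda>x t. D (0, 1) u (x, t)) (\<lambda>x t. D (0, 1) u1 (x, t)) (\<lambda>x t. D (0, 1) u2 (x, t))"
    proof
      show "((\<lambda>y. q y t) has_vector_derivative u1 (x, t)) (at x within {0..1})"
        if "x \<in> {0..1}" "t \<in> {0..T}" for x t
        using Dx[OF u that] by (simp add: u_def u1_def)
      show "(q x has_vector_derivative D (0, 1) u (x, t)) (at t within {0..T})"
        if "x \<in> {0..1}" "t \<in> {0..T}" for x t
        using Dt[OF u that] by (simp add: u_def)
      show "D (0, 1) u (x, t) = - u3 (x, t)" if "x \<in> {0..1}" "t \<in> {0..T}" for x t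
        using pde[of "(x, t)"] that by (simp add: S_def eq_neg_iff_add_eq_0)
    qed (use \<open>T > 0\<close> Dx[OF smooth(1)] Dx[OF smooth(2)] Dt[OF smooth(1)] Dt[OF smooth(2)]
        smooth_onD_continuous[OF smooth(3)] smooth_onD_continuous[OF D[OF u]]
        smooth_onD_continuous[OF D[OF smooth(1)]] smooth_onD_continuous[OF D[OF smooth(2)]]
        in \<open>simp_all add: u2_def[symmetric] u3_def[symmetric] S_def[symmetric] case_prod_beta'\<close>)
    show "partial_x q x t = u1 (x, t)" if "x \<in> {0..1}" "t \<in> {0..T}" for x t
      by (rule px1[OF that])
  qed
qed

context regular_solution
begin

lemma continuous_section:
  fixes r :: "real \<Rightarrow> real \<Rightarrow> complex"
  assumes "continuous_on ({0..1} \<times> {0..T}) (\<lambda>(x, t). r x t)" "t \<in> {0..T}"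
  shows "continuous_on {0..1} (\<lambda>x. r x t)"
proof -
  have c: "continuous_on {0..1} (\<lambda>x::real. (x, t))" "(\<lambda>x::real. (x, t)) ` {0..1} \<subseteq> {0..1} \<times> {0..T}"
    using assms(2) by (auto intro!: continuous_on_Pair)
  show ?thesis
    using continuous_on_compose2[of "{0..1} \<times> {0..T}" "\<lambda>(x, t). r x t" "{0..1}" "\<lambda>x. (x, t)", OF assms(1) c] by simp
qed

lemma continuous_boundary:
  assumes "j \<in> {0..1}" "t \<in> {0..T}"
  shows "continuous_on {0..t} (q2 j)" "continuous_on {0..t} (q1 j)"
proof -
  have "continuous_on {0..T} (q2 j)" "continuous_on {0..T} (q1 j)"
    by (rule continuous_on_vector_derivative[of _ _ "q2t j"], erule dt(3)[OF assms(1)])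
      (rule continuous_on_vector_derivative[of _ _ "q1t j"], erule dt(2)[OF assms(1)])
  then show "continuous_on {0..t} (q2 j)" "continuous_on {0..t} (q1 j)"
    using assms by (auto elim: continuous_on_subset)
qed

text \<open>Three integrations by parts in \<open>x\<close> turn the equation into the linear
  ordinary differential equation \<open>y' = w ^ 3 * y - b\<close>, solved with the factor
  \<open>exp (- (w ^ 3) * s)\<close>. The Dirichlet conditions remove the boundary terms with
  \<open>w\<^sup>2\<close>.\<close>

lemma evolution:
  assumes t: "t \<in> {0..T}" and ends: "\<And>s. s \<in> {0..T} \<Longrightarrow> q 0 s = 0" "\<And>s. s \<in> {0..T} \<Longrightarrow> q 1 s = 0"
  shows "exp (- (w ^ 3) * of_real t) * lap 0 1 (\<lambda>x. q x t) w = lap 0 1 (\<lambda>x. q x 0) w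
    - (exp w * (lap 0 t (q2 1) (- (w ^ 3)) - w * lap 0 t (q1 1) (- (w ^ 3)))
       - (lap 0 t (q2 0) (- (w ^ 3)) - w * lap 0 t (q1 0) (- (w ^ 3))))"
proof -
  define y where "y = (\<lambda>s. lap 0 1 (\<lambda>x. q x s) w)"
  define b where "b = (\<lambda>s. exp w * (q2 1 s - w * q1 1 s) - (q2 0 s - w * q1 0 s))"
  have cq: "continuous_on {0..1} (\<lambda>x. q x s)" if "s \<in> {0..T}" for s
    by (rule continuous_on_vector_derivative[of "{0..1}" _ "\<lambda>x. q1 x s"]) (rule dx(1)[OF _ that])
  have y': "(y has_vector_derivative w ^ 3 * y s - b s) (at s within {0..T})" if s: "s \<in> {0..T}" for s
  proof -
    have "((\<lambda>s. integral (cbox 0 1) (\<lambda>x. exp (w * of_real x) * q x s)) has_vector_derivative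
        integral (cbox 0 1) (\<lambda>x. exp (w * of_real x) * qt x s)) (at s within {0..T})"
    proof (rule leibniz_rule_vector_derivative)
      show "((\<lambda>s. exp (w * of_real x) * q x s) has_vector_derivative exp (w * of_real x) * qt x s) (at s within {0..T})"
        if "s \<in> {0..T}" "x \<in> cbox 0 1" for s x
        using that by (intro has_vector_derivative_mult_right dt(1)) auto
      show "(\<lambda>x. exp (w * of_real x) * q x s) integrable_on cbox 0 1" if "s \<in> {0..T}" for s
        using lap_integrable[OF cq[OF that]] by simp
      have "continuous_on ({0..T} \<times> {0..1}) (\<lambda>p. (case (snd p, fst p) of (x, t) \<Rightarrow> qt x t))"
        by (rule continuous_on_compose2[OF cont(1)]) (auto intro!: continuous_intros)
      then show "continuous_on ({0..T} \<times> cbox 0 1) (\<lambda>(s, x). exp (w * of_real x) * qt x s)"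
        by (auto simp: case_prod_beta' intro!: continuous_intros)
    qed (use s in auto)
    then have "(y has_vector_derivative lap 0 1 (\<lambda>x. qt x s) w) (at s within {0..T})"
      by (simp add: y_def lap_def)
    moreover have "lap 0 1 (\<lambda>x. qt x s) w = w ^ 3 * y s - b s"
    proof -
      have c: "continuous_on {0..1} (\<lambda>x. q1 x s)" "continuous_on {0..1} (\<lambda>x. q2 x s)" "continuous_on {0..1} (\<lambda>x. q3 x s)"
        by (rule continuous_on_vector_derivative[of _ _ "\<lambda>x. q2 x s"], erule dx(2)[OF _ s],
            rule continuous_on_vector_derivative[of _ _ "\<lambda>x. q3 x s"], erule dx(3)[OF _ s],
            rule continuous_section[OF cont(2) s])
      have e: "w * y s = - lap 0 1 (\<lambda>x. q1 x s) w"
        unfolding y_def using lap_by_parts[OF _ dx(1)[OF _ s] c(1), of w] ends s by simp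
      have e1: "w * lap 0 1 (\<lambda>x. q1 x s) w = exp w * q1 1 s - q1 0 s - lap 0 1 (\<lambda>x. q2 x s) w"
        using lap_by_parts[OF _ dx(2)[OF _ s] c(2), of w] by simp
      have e2: "w * lap 0 1 (\<lambda>x. q2 x s) w = exp w * q2 1 s - q2 0 s - lap 0 1 (\<lambda>x. q3 x s) w"
        using lap_by_parts[OF _ dx(3)[OF _ s] c(3), of w] by simp
      have e3: "lap 0 1 (\<lambda>x. qt x s) w = - lap 0 1 (\<lambda>x. q3 x s) w"
      proof -
        have "lap 0 1 (\<lambda>x. qt x s) w = lap 0 1 (\<lambda>x. (- 1) * q3 x s) w"
          by (rule lap_cong) (simp add: pde[OF _ s])
        then show ?thesis
          unfolding lap_cmult by simp
      qed
      show ?thesis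
      proof -
        have "w ^ 3 * y s = w * (w * (w * y s))"
          by (simp add: power3_eq_cube mult.assoc)
        also have "\<dots> = - (w * (exp w * q1 1 s - q1 0 s) - w * lap 0 1 (\<lambda>x. q2 x s) w)"
          unfolding e mult_minus_right e1 by (simp add: algebra_simps)
        finally show ?thesis
          unfolding e2 e3 b_def by (simp add: algebra_simps)
      qed
    qed
    ultimately show ?thesis by simp
  qed
  note cb = continuous_boundary[OF _ t]
  have "((\<lambda>s. - (exp (- (w ^ 3) * of_real s) * b s)) has_integral
      exp (- (w ^ 3) * of_real t) * y t - exp (- (w ^ 3) * of_real 0) * y 0) {0..t}"
  proof (rule fundamental_theorem_of_calculus)
    fix s assume s: "s \<in> {0..t}"
    then have "(y has_vector_derivative w ^ 3 * y s - b s) (at s within {0..t})"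
      using t by (intro has_vector_derivative_within_subset[OF y']) auto
    moreover have "((\<lambda>s. exp (- (w ^ 3) * of_real s)) has_vector_derivative - (w ^ 3) * exp (- (w ^ 3) * of_real s))
        (at s within {0..t})"
      by (rule has_vector_derivative_real_field) (auto intro!: derivative_eq_intros)
    ultimately have "((\<lambda>s. exp (- (w ^ 3) * of_real s) * y s) has_vector_derivative
        exp (- (w ^ 3) * of_real s) * (w ^ 3 * y s - b s) + (- (w ^ 3) * exp (- (w ^ 3) * of_real s)) * y s)
        (at s within {0..t})"
      by (intro has_vector_derivative_mult)
    then show "((\<lambda>s. exp (- (w ^ 3) * of_real s) * y s) has_vector_derivative - (exp (- (w ^ 3) * of_real s) * b s))
        (at s within {0..t})"
      by (simp add: algebra_simps)
  qed (use t in auto)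
  then have "integral {0..t} (\<lambda>s. - (exp (- (w ^ 3) * of_real s) * b s))
      = exp (- (w ^ 3) * of_real t) * y t - exp (- (w ^ 3) * of_real 0) * y 0"
    by (rule integral_unique)
  then have "exp (- (w ^ 3) * of_real t) * y t - y 0 = - lap 0 t b (- (w ^ 3))"
    unfolding lap_def Henstock_Kurzweil_Integration.integral_neg by simp
  moreover have "lap 0 t b (- (w ^ 3)) =
     exp w * (lap 0 t (q2 1) (- (w ^ 3)) - w * lap 0 t (q1 1) (- (w ^ 3)))
       - (lap 0 t (q2 0) (- (w ^ 3)) - w * lap 0 t (q1 0) (- (w ^ 3)))"
  proof -
    have "b = (\<lambda>s. (exp w * q2 1 s + (- (exp w * w)) * q1 1 s) + ((- 1) * q2 0 s + w * q1 0 s))"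
      by (auto simp: b_def algebra_simps)
    moreover have "continuous_on {0..t} (\<lambda>s. exp w * q2 1 s)" "continuous_on {0..t} (\<lambda>s. - (exp w * w) * q1 1 s)"
      "continuous_on {0..t} (\<lambda>s. (- 1) * q2 0 s)" "continuous_on {0..t} (\<lambda>s. w * q1 0 s)"
      by (intro continuous_on_mult continuous_on_const cb; simp)+
    ultimately have "lap 0 t b (- (w ^ 3)) = (exp w * lap 0 t (q2 1) (- (w ^ 3)) + (- (exp w * w)) * lap 0 t (q1 1) (- (w ^ 3)))
        + ((- 1) * lap 0 t (q2 0) (- (w ^ 3)) + w * lap 0 t (q1 0) (- (w ^ 3)))"
      by (simp only: lap_add lap_cmult continuous_on_add)
    then show ?thesis by (simp add: algebra_simps)
  qed
  ultimately show ?thesis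
    by (simp add: y_def algebra_simps)
qed

end

section \<open>The contours and the solution formula\<close>

lemma Im_polar_cube: "Im ((of_real r * cis \<theta>) ^ 3) = r ^ 3 * sin (3 * \<theta>)"
  by (simp add: power_mult_distrib Complex.DeMoivre flip: of_real_power)

text \<open>Polar coordinates are continuous, so they map the closed parameter rectangle into the
  closure of the image of the open one.\<close>

lemma polar_region_closure:
  assumes "a < b" and D: "polar_region {1<..} {a<..<b} \<subseteq> D"
  shows "polar_region {1..} {a..b} \<subseteq> closure D"
proof -
  let ?f = "\<lambda>p. of_real (fst p) * cis (snd p) :: complex"
  have im: "polar_region A B = ?f ` (A \<times> B)" for A B
    by (force simp: polar_region_def)
  have cl: "closure ({1::real<..} \<times> {a<..<b}) = {1..} \<times> {a..b}"
    using \<open>a < b\<close> closure_halfspace_gt[of "1 :: real" 1] by (simp add: closure_Times greaterThan_def atLeast_def)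
  have "?f ` closure ({1<..} \<times> {a<..<b}) \<subseteq> closure D"
  proof (rule image_closure_subset)
    show "?f ` ({1<..} \<times> {a<..<b}) \<subseteq> closure D"
      using D closure_subset unfolding im by blast
  qed (auto intro!: continuous_intros)
  then show ?thesis
    unfolding im cl .
qed

lemma sector_boundary_cases:
  assumes "l \<in> sector_boundary a b" "a \<le> b"
  shows "l \<in> polar_region {1..} {a..b}"
    and "norm l = 1 \<or> l \<in> polar_region {1..} {a} \<or> l \<in> polar_region {1..} {b}"
proof -
  have "polar_region {1..} {a} \<subseteq> polar_region {1..} {a..b}" "polar_region {1..} {b} \<subseteq> polar_region {1..} {a..b}"
    "polar_region {1} {a..b} \<subseteq> polar_region {1..} {a..b}"
    using assms(2) by (intro polar_region_mono; simp)+
  then show "l \<in> polar_region {1..} {a..b}"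
    using assms(1) unfolding sector_boundary_def by blast
  have "norm l = 1" if "l \<in> polar_region {1} {a..b}"
    using that by (auto simp: polar_region_def)
  then show "norm l = 1 \<or> l \<in> polar_region {1..} {a} \<or> l \<in> polar_region {1..} {b}"
    using assms(1) unfolding sector_boundary_def by blast
qed

text \<open>A point of the boundary has \<open>Im (l ^ 3) = 0\<close> or modulus 1, so it is outside
  the domain, yet in its closure. \<open>Q\<close> stands for either half-plane condition.\<close>

lemma sector_boundary_frontier:
  assumes "a < b" and sin: "sin (3 * a) = 0" "sin (3 * b) = 0"
    and D: "polar_region {1<..} {a<..<b} \<subseteq> {l. Q l \<and> Im (l ^ 3) > 0 \<and> norm l > 1}"
  shows "sector_boundary a b \<subseteq> frontier {l. Q l \<and> Im (l ^ 3) > 0 \<and> norm l > 1}"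
proof
  fix l assume l: "l \<in> sector_boundary a b"
  have "Im (l ^ 3) = 0" if "l \<in> polar_region {1..} {a} \<or> l \<in> polar_region {1..} {b}"
    using that sin by (auto simp only: polar_region_def Im_polar_cube mem_Collect_eq singleton_iff mult_zero_right)
  then have "l \<notin> {l. Q l \<and> Im (l ^ 3) > 0 \<and> norm l > 1}"
    using sector_boundary_cases(2)[OF l] \<open>a < b\<close> by auto
  then show "l \<in> frontier {l. Q l \<and> Im (l ^ 3) > 0 \<and> norm l > 1}"
    using polar_region_closure[OF \<open>a < b\<close> D] sector_boundary_cases(1)[OF l] \<open>a < b\<close> interior_subset
    unfolding frontier_def by fastforce
qed

lemma polar_sectors:
  "l \<in> polar_region {1..} {0..pi/3} \<union> polar_region {1..} {2*pi/3..pi} \<Longrightarrow> norm l \<ge> 1 \<and> Im l \<ge> 0 \<and> Im (l ^ 3) \<ge> 0"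
  "l \<in> polar_region {1..} {-2*pi/3..-pi/3} \<Longrightarrow> norm l \<ge> 1 \<and> Im l < 0 \<and> Im (l ^ 3) \<ge> 0"
proof -
  have Im: "Im (of_real r * cis \<theta>) = r * sin \<theta>" "norm (of_real r * cis \<theta>) = r" if "1 \<le> r" for r \<theta>
    using that by (auto simp: norm_mult)
  have shift: "sin (\<theta> - 2 * pi) = sin \<theta>" "sin (\<theta> + 2 * pi) = sin \<theta>" for \<theta>
    using sin_periodic[of "\<theta> - 2 * pi"] sin_periodic[of \<theta>] by auto
  show "norm l \<ge> 1 \<and> Im l \<ge> 0 \<and> Im (l ^ 3) \<ge> 0"
    if "l \<in> polar_region {1..} {0..pi/3} \<union> polar_region {1..} {2*pi/3..pi}"
  proof -
    obtain r \<theta> where l: "l = of_real r * cis \<theta>" "1 \<le> r"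
      and \<theta>: "0 \<le> \<theta> \<and> \<theta> \<le> pi/3 \<or> 2*pi/3 \<le> \<theta> \<and> \<theta> \<le> pi"
      using \<open>l \<in> _\<close> by (auto simp: polar_region_def)
    have p: "0 < pi" by simp
    have "0 \<le> \<theta>" "\<theta> \<le> pi" using \<theta> p by auto
    then have "sin \<theta> \<ge> 0" by (rule sin_ge_zero)
    moreover have "sin (3 * \<theta>) \<ge> 0"
      using \<theta> sin_ge_zero[of "3 * \<theta>"] sin_ge_zero[of "3 * \<theta> - 2 * pi"] shift(1)[of "3 * \<theta>"] p by auto
    ultimately show ?thesis
      unfolding l(1) Im_polar_cube Im[OF l(2)] using l(2) by auto
  qed
  show "norm l \<ge> 1 \<and> Im l < 0 \<and> Im (l ^ 3) \<ge> 0" if "l \<in> polar_region {1..} {-2*pi/3..-pi/3}"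
  proof -
    obtain r \<theta> where l: "l = of_real r * cis \<theta>" "1 \<le> r" and \<theta>: "-2*pi/3 \<le> \<theta>" "\<theta> \<le> -pi/3"
      using \<open>l \<in> _\<close> by (auto simp: polar_region_def)
    have p: "0 < pi" by simp
    have "0 < - \<theta>" "- \<theta> < pi" using \<theta> p by linarith+
    then have "sin (- \<theta>) > 0" by (rule sin_gt_zero)
    moreover have "sin (3 * \<theta>) \<ge> 0"
      using \<theta> sin_ge_zero[of "3 * \<theta> + 2 * pi"] shift(2)[of "3 * \<theta>"] p by auto
    ultimately show ?thesis
      unfolding l(1) Im_polar_cube Im[OF l(2)] using l(2) by (auto simp: mult_pos_neg)
  qed
qed

text \<open>These inclusions decide which branch of \<open>transform\<close> is taken. It tests
  \<open>Gamma_plus \<union> Gamma_zero\<close> first, so on the lower contour that set must be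
  excluded; there \<open>Im l < 0\<close> and \<open>norm l \<ge> 1\<close>.\<close>

lemma sector_boundary_subset_Gamma:
  "sector_boundary 0 (pi/3) \<subseteq> Gamma_plus" "sector_boundary (2*pi/3) pi \<subseteq> Gamma_plus"
  "sector_boundary (-2*pi/3) (-pi/3) \<subseteq> Gamma_minus - (Gamma_plus \<union> Gamma_zero)"
proof -
  have p: "0 < pi" by simp
  have shift: "sin (\<theta> - 2 * pi) = sin \<theta>" "sin (\<theta> + 2 * pi) = sin \<theta>" for \<theta>
    using sin_periodic[of "\<theta> - 2 * pi"] sin_periodic[of \<theta>] by auto
  \<comment> \<open>The sign \<open>s\<close> is 1 for the upper and -1 for the lower half
    plane.\<close>
  have in_D: "polar_region {1<..} {a<..<b} \<subseteq> {l. 0 < s * Im l \<and> 0 < Im (l ^ 3) \<and> 1 < norm l}"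
    if "\<And>\<theta>. a < \<theta> \<Longrightarrow> \<theta> < b \<Longrightarrow> 0 < s * sin \<theta> \<and> 0 < sin (3 * \<theta>)" for a b s :: real
  proof
    fix l assume "l \<in> polar_region {1<..} {a<..<b}"
    then obtain r \<theta> where l: "l = of_real r * cis \<theta>" "1 < r" "a < \<theta>" "\<theta> < b"
      by (auto simp: polar_region_def)
    have "Im l = r * sin \<theta>" "norm l = r" "0 < r"
      using l by (auto simp: norm_mult)
    moreover have "0 < r * (s * sin \<theta>)" "0 < r ^ 3 * sin (3 * \<theta>)"
      using that[OF l(3,4)] l by simp_all
    moreover have "Im (l ^ 3) = r ^ 3 * sin (3 * \<theta>)"
      unfolding l(1) by (rule Im_polar_cube)
    ultimately show "l \<in> {l. 0 < s * Im l \<and> 0 < Im (l ^ 3) \<and> 1 < norm l}"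
      using l(2) by (simp add: mult.left_commute)
  qed
  have s3: "sin (3 * \<theta>) = 0" if "\<theta> \<in> {0, pi/3, 2*pi/3, pi, -2*pi/3, -pi/3}" for \<theta>
    using that sin_npi[of 3] by (auto simp: mult.commute)
  have G: "Gamma_plus = frontier {l. 0 < 1 * Im l \<and> Im (l ^ 3) > 0 \<and> norm l > 1}"
    "Gamma_minus = frontier {l. 0 < (- 1) * Im l \<and> Im (l ^ 3) > 0 \<and> norm l > 1}"
    by (simp_all add: Gamma_plus_def Gamma_minus_def)
  show "sector_boundary 0 (pi/3) \<subseteq> Gamma_plus"
    unfolding G by (intro sector_boundary_frontier s3 in_D) (use p in \<open>auto intro!: sin_gt_zero\<close>)
  show "sector_boundary (2*pi/3) pi \<subseteq> Gamma_plus"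
    unfolding G
  proof (intro sector_boundary_frontier s3 in_D)
    show "0 < 1 * sin \<theta> \<and> 0 < sin (3 * \<theta>)" if "2*pi/3 < \<theta>" "\<theta> < pi" for \<theta>
      using that p sin_gt_zero[of \<theta>] sin_gt_zero[of "3 * \<theta> - 2 * pi"] shift(1)[of "3 * \<theta>"] by auto
  qed auto
  have minus: "sector_boundary (-2*pi/3) (-pi/3) \<subseteq> Gamma_minus"
    unfolding G
  proof (intro sector_boundary_frontier s3 in_D)
    show "0 < (- 1) * sin \<theta> \<and> 0 < sin (3 * \<theta>)" if "-2*pi/3 < \<theta>" "\<theta> < -pi/3" for \<theta>
      using that p sin_gt_zero[of "- \<theta>"] sin_gt_zero[of "3 * \<theta> + 2 * pi"] shift(2)[of "3 * \<theta>"] by auto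
  qed auto
  have "Im l \<ge> 0" if "l \<in> Gamma_plus" for l
  proof -
    have "Gamma_plus \<subseteq> closure {l. 0 < Im l \<and> Im (l ^ 3) > 0 \<and> norm l > 1}"
      by (simp add: Gamma_plus_def frontier_def)
    also have "\<dots> \<subseteq> {l. Im l \<ge> 0}"
      by (intro closure_minimal closed_halfspace_Im_ge) auto
    finally show ?thesis using that by blast
  qed
  then show "sector_boundary (-2*pi/3) (-pi/3) \<subseteq> Gamma_minus - (Gamma_plus \<union> Gamma_zero)"
    using minus polar_sectors(2)[OF sector_boundary_cases(1)] p by (fastforce simp: Gamma_zero_def)
qed

text \<open>The rays of the contours also bound the complementary sectors, and the arcs and the
  small circle lie in the punctured unit disc, so the earlier non-vanishing covers them.\<close>

lemma Delta_nonzero_boundary: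
  assumes \<beta>: "0 \<le> \<beta>" "\<beta> \<le> 1 / 2"
    and l: "l \<in> sector_boundary 0 (pi/3) \<union> sector_boundary (2*pi/3) pi \<union> sector_boundary (-2*pi/3) (-pi/3) \<union> Gamma_zero"
  shows "Delta \<beta> l \<noteq> 0"
proof -
  have p: "0 < pi" by simp
  have "cis (- pi) = cis pi" by (simp add: complex_eq_iff)
  then have polar_pi: "polar_region {1..} {pi} = polar_region {1..} {- pi}"
    by (simp add: polar_region_def)
  have sub: "polar_region {1..} {a} \<subseteq> polar_region {1..} {b..c}" if "a \<in> {b..c}" for a b c
    using that by (intro polar_region_mono) auto
  have rays: "polar_region {1..} {0} \<subseteq> polar_region {1..} {- pi / 3..0}" "polar_region {1..} {-pi/3} \<subseteq> polar_region {1..} {- pi / 3..0}"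
    "polar_region {1..} {pi/3} \<subseteq> polar_region {1..} {pi / 3..2 * pi / 3}" "polar_region {1..} {2*pi/3} \<subseteq> polar_region {1..} {pi / 3..2 * pi / 3}"
    "polar_region {1..} {pi} \<subseteq> polar_region {1..} {- pi..- 2 * pi / 3}" "polar_region {1..} {-2*pi/3} \<subseteq> polar_region {1..} {- pi..- 2 * pi / 3}"
    unfolding polar_pi by (intro sub; use p in simp)+
  have "norm l = 1 \<or> norm l = 1/2 \<or> l \<in> polar_region {1..} {0} \<or> l \<in> polar_region {1..} {pi/3}
     \<or> l \<in> polar_region {1..} {2*pi/3} \<or> l \<in> polar_region {1..} {pi} \<or> l \<in> polar_region {1..} {-2*pi/3} \<or> l \<in> polar_region {1..} {-pi/3}"
    using l sector_boundary_cases(2)[of l 0 "pi/3"] sector_boundary_cases(2)[of l "2*pi/3" pi]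
      sector_boundary_cases(2)[of l "-2*pi/3" "-pi/3"] p unfolding Gamma_zero_def by auto
  moreover have "0 < norm l \<and> norm l \<le> 1" if "norm l = 1 \<or> norm l = 1/2"
    using that by (elim disjE; intro conjI; linarith)
  ultimately show ?thesis
    using rays Delta_nonzero[OF \<beta>, of l] by blast
qed

section \<open>Boundary terms of the evolution and the solution formula\<close>

context regular_solution
begin

text \<open>The boundary values at the end \<open>j\<close>, transformed in time up to
  \<open>t\<close>. The slope is always taken at the left end, with weight \<open>k\<close>:
  \<open>k = 1\<close> for \<open>j = 0\<close>, and \<open>k = \<beta>\<close> for
  \<open>j = 1\<close> by the boundary condition.\<close>

definition bdry :: "real \<Rightarrow> real \<Rightarrow> real \<Rightarrow> complex \<Rightarrow> complex" where
  "bdry k j t l = exp (\<i> * l ^ 3 * of_real t) * (lap 0 t (q2 j) (- (\<i> * l ^ 3)) + \<i> * l * of_real k * lap 0 t (q1 0) (- (\<i> * l ^ 3)))"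

lemma analytic_bdry:
  assumes "j \<in> {0..1}" "t \<in> {0..T}"
  shows "bdry k j t analytic_on S"
proof -
  have "(\<lambda>l. lap 0 t (q2 j) (- (\<i> * l ^ 3))) holomorphic_on UNIV" "(\<lambda>l. lap 0 t (q1 0) (- (\<i> * l ^ 3))) holomorphic_on UNIV"
    using continuous_boundary[OF assms] continuous_boundary[of 0, OF _ assms(2)]
    by (auto intro!: holomorphic_intros holomorphic_on_compose_gen[OF _ holomorphic_lap, of "\<lambda>l. - (\<i> * l ^ 3)", unfolded o_def])
  then have "bdry k j t holomorphic_on UNIV"
    unfolding bdry_def by (intro holomorphic_intros)
  then show ?thesis
    using analytic_on_holomorphic by blast
qed

lemma continuous_dt:
  assumes "j \<in> {0..1}"
  shows "continuous_on {0..T} (q1t j)" "continuous_on {0..T} (q2t j)"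
proof -
  have c: "continuous_on {0..T} (\<lambda>t::real. (j, t))" "(\<lambda>t::real. (j, t)) ` {0..T} \<subseteq> {0..1} \<times> {0..T}"
    using assms by (auto intro!: continuous_on_Pair)
  show "continuous_on {0..T} (q1t j)" "continuous_on {0..T} (q2t j)"
    using continuous_on_compose2[of "{0..1} \<times> {0..T}" "\<lambda>(x, t). q1t x t" "{0..T}" "\<lambda>t. (j, t)", OF cont(3) c]
      continuous_on_compose2[of "{0..1} \<times> {0..T}" "\<lambda>(x, t). q2t x t" "{0..T}" "\<lambda>t. (j, t)", OF cont(4) c] by simp_all
qed

text \<open>Where \<open>Im (l ^ 3) \<ge> 0\<close> the factor \<open>exp (\<i> * l ^ 3 * t)\<close>
  compensates the growth of the time transforms. One integration by parts gives
  \<open>1 / norm l ^ 3\<close>, of which the factor \<open>l\<close> in front of the slope uses up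
  one power.\<close>

lemma bdry_bound:
  assumes j: "j \<in> {0..1}" and t: "t \<in> {0..T}" and k: "0 \<le> k" "k \<le> 1"
  obtains C where "\<And>l. norm l \<ge> 1 \<Longrightarrow> Im (l ^ 3) \<ge> 0 \<Longrightarrow> norm (bdry k j t l) \<le> C / (norm l)\<^sup>2"
proof -
  have sub: "{0..t} \<subseteq> {0..T}" using t by auto
  have t0: "0 \<le> t" using t by simp
  have v2: "(q2 j has_vector_derivative q2t j y) (at y within {0..t})" if "y \<in> {0..t}" for y
    by (rule has_vector_derivative_within_subset[OF dt(3)[OF j] sub]) (use that sub in auto)
  have v1: "(q1 0 has_vector_derivative q1t 0 y) (at y within {0..t})" if "y \<in> {0..t}" for y
    by (rule has_vector_derivative_within_subset[OF dt(2) sub]) (use that sub in auto)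
  obtain C2 where C2: "C2 \<ge> 0" "\<And>w. norm (w * lap 0 t (q2 j) w) \<le> C2 * max (exp (Re w * 0)) (exp (Re w * t))"
    using lap_bound1[OF t0 v2 continuous_on_subset[OF continuous_dt(2)[OF j] sub]] by blast
  obtain C1 where C1: "C1 \<ge> 0" "\<And>w. norm (w * lap 0 t (q1 0) w) \<le> C1 * max (exp (Re w * 0)) (exp (Re w * t))"
    using lap_bound1[OF t0 v1 continuous_on_subset[OF continuous_dt(1)[of 0] sub]] by auto
  have decay: "norm (exp (\<i> * l ^ 3 * of_real t)) * norm (lap 0 t p (- (\<i> * l ^ 3))) \<le> C / norm l ^ 3"
    if C: "C \<ge> 0" "\<And>w. norm (w * lap 0 t p w) \<le> C * max (exp (Re w * 0)) (exp (Re w * t))"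
      and l: "norm l \<ge> 1" "Im (l ^ 3) \<ge> 0" for p C l
  proof -
    define I where "I = Im (l ^ 3)"
    have n: "norm (exp (\<i> * l ^ 3 * of_real t)) = exp (- (I * t))"
      unfolding norm_exp_eq_Re by (simp add: I_def mult.assoc del: times_complex.sel) (simp add: mult.commute)
    have R: "Re (- (\<i> * l ^ 3)) = I" by (simp add: I_def)
    have I0: "I \<ge> 0" using l by (simp add: I_def)
    have "norm l ^ 3 * norm (lap 0 t p (- (\<i> * l ^ 3))) = norm ((- (\<i> * l ^ 3)) * lap 0 t p (- (\<i> * l ^ 3)))"
      by (simp add: norm_mult norm_power)
    also have "\<dots> \<le> C * max (exp (I * 0)) (exp (I * t))"
      using C(2)[of "- (\<i> * l ^ 3)"] unfolding R .
    also have "max (exp (I * 0)) (exp (I * t)) = exp (I * t)"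
      using I0 t0 by (intro max_absorb2) simp
    finally have "exp (- (I * t)) * (norm l ^ 3 * norm (lap 0 t p (- (\<i> * l ^ 3)))) \<le> exp (- (I * t)) * (C * exp (I * t))"
      by (rule mult_left_mono) simp
    also have "\<dots> = C" by (simp add: exp_minus)
    finally have "norm l ^ 3 * (exp (- (I * t)) * norm (lap 0 t p (- (\<i> * l ^ 3)))) \<le> C"
      by (simp add: mult_ac)
    moreover have "norm l ^ 3 > 0" using l(1) by (intro zero_less_power) linarith
    ultimately show ?thesis
      unfolding n by (simp add: pos_le_divide_eq mult.commute)
  qed
  show ?thesis
  proof (rule that[of "C2 + C1"])
    fix l :: complex assume l: "norm l \<ge> 1" "Im (l ^ 3) \<ge> 0"
    let ?e = "norm (exp (\<i> * l ^ 3 * of_real t))"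
    have l2: "(norm l)\<^sup>2 > 0" using l(1) by (intro zero_less_power) linarith
    have "norm (bdry k j t l) \<le> ?e * norm (lap 0 t (q2 j) (- (\<i> * l ^ 3)))
        + norm l * k * (?e * norm (lap 0 t (q1 0) (- (\<i> * l ^ 3))))"
    proof -
      have "norm (bdry k j t l) \<le> ?e * (norm (lap 0 t (q2 j) (- (\<i> * l ^ 3)))
        + norm (\<i> * l * of_real k * lap 0 t (q1 0) (- (\<i> * l ^ 3))))"
        unfolding bdry_def norm_mult[of "exp _"] by (intro mult_left_mono norm_triangle_ineq) simp
      also have "norm (\<i> * l * of_real k * lap 0 t (q1 0) (- (\<i> * l ^ 3))) = norm l * k * norm (lap 0 t (q1 0) (- (\<i> * l ^ 3)))"
        using k by (simp only: norm_mult norm_ii norm_of_real abs_of_nonneg mult_1)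
      finally show ?thesis by (simp only: distrib_left mult.left_commute mult.assoc)
    qed
    also have "\<dots> \<le> C2 / norm l ^ 3 + norm l * 1 * (C1 / norm l ^ 3)"
      using k by (intro add_mono mult_mono decay C1 C2 l) (auto simp: C1)
    also have "norm l * 1 * (C1 / norm l ^ 3) = C1 / (norm l)\<^sup>2"
      using l2 by (simp add: power2_eq_square power3_eq_cube)
    also have "C2 / norm l ^ 3 \<le> C2 / (norm l)\<^sup>2"
      using C2(1) l l2 power_increasing[of 2 3 "norm l"] by (intro divide_left_mono) auto
    finally show "norm (bdry k j t l) \<le> (C2 + C1) / (norm l)\<^sup>2"
      by (simp add: add_divide_distrib)
  qed
qed

text \<open>By \<open>numer_boundary\<close> the boundary terms collapse to
  \<open>Delta \<beta> l\<close> times right-end values, and the determinant cancels, leaving an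
  entire function. Adding the evolved Fourier transform at \<open>l\<close> exchanges the right-end
  values for the left-end ones.\<close>

lemma transform_evolution:
  assumes t: "t \<in> {0..T}" and ends: "\<And>s. s \<in> {0..T} \<Longrightarrow> q 0 s = 0" "\<And>s. s \<in> {0..T} \<Longrightarrow> q 1 s = 0"
    and slope: "\<And>s. s \<in> {0..T} \<Longrightarrow> q1 1 s = of_real \<beta> * q1 0 s" and D: "Delta \<beta> l \<noteq> 0"
  shows "exp (\<i> * l ^ 3 * of_real t) * Fm \<beta> (\<lambda>x. q x 0) l
      = Fm \<beta> (\<lambda>x. q x t) l - exp (- \<i> * l) * (1 / (2 * of_real pi)) * bdry \<beta> 1 t l" (is ?m)
    and "exp (\<i> * l ^ 3 * of_real t) * Fp \<beta> (\<lambda>x. q x 0) l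
      = Fp \<beta> (\<lambda>x. q x t) l - (1 / (2 * of_real pi)) * bdry 1 0 t l" (is ?p)
proof -
  define e where "e = exp (\<i> * l ^ 3 * of_real t)"
  define f where "f = (\<lambda>x. q x 0)"
  define g where "g = (\<lambda>x. q x t)"
  define H0 H1 K where "H0 = lap 0 t (q2 0) (- (\<i> * l ^ 3))" and "H1 = lap 0 t (q2 1) (- (\<i> * l ^ 3))"
    and "K = lap 0 t (q1 0) (- (\<i> * l ^ 3))"
  have K1: "lap 0 t (q1 1) (- (\<i> * l ^ 3)) = of_real \<beta> * K"
    unfolding K_def lap_cmult[symmetric] by (rule lap_cong) (use slope t in auto)
  have ee: "e * exp (- (\<i> * l ^ 3) * of_real t) = 1"
    unfolding e_def exp_add[symmetric] by simp
  \<comment> \<open>The points \<open>l\<close>, \<open>\<alpha> * l\<close> and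
    \<open>\<alpha>\<^sup>2 * l\<close> have the same cube, so all three transforms share the factor
    \<open>e\<close> and the quantities \<open>H0\<close>, \<open>H1\<close>,
    \<open>K\<close>.\<close>
  have ev: "e * fhat f m = fhat g m + e * (exp (- \<i> * m) * (H1 + \<i> * m * (of_real \<beta> * K)) - (H0 + \<i> * m * K))"
    if "m ^ 3 = l ^ 3" for m
  proof -
    have c: "(- \<i> * m) ^ 3 = \<i> * l ^ 3"
    proof -
      have "(- \<i>) ^ 3 = \<i>" by (simp add: power3_eq_cube)
      then show ?thesis by (simp only: power_mult_distrib that)
    qed
    have "exp (- (\<i> * l ^ 3) * of_real t) * fhat g m = fhat f m - (exp (- \<i> * m) * (H1 + \<i> * m * (of_real \<beta> * K)) - (H0 + \<i> * m * K))"
      using evolution[OF t ends, of "- \<i> * m"] unfolding c K1 H0_def[symmetric] H1_def[symmetric] K_def[symmetric]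
      by (simp add: fhat_def f_def g_def)
    then have "e * (exp (- (\<i> * l ^ 3) * of_real t) * fhat g m)
        = e * fhat f m - e * (exp (- \<i> * m) * (H1 + \<i> * m * (of_real \<beta> * K)) - (H0 + \<i> * m * K))"
      by (simp only: right_diff_distrib)
    then show ?thesis
      unfolding mult.assoc[symmetric] ee by (simp add: algebra_simps)
  qed
  have cube: "(\<alpha> * l) ^ 3 = l ^ 3" "(\<alpha>\<^sup>2 * l) ^ 3 = l ^ 3"
  proof -
    have "(\<alpha>\<^sup>2) ^ 3 = (\<alpha> ^ 3)\<^sup>2" by (simp flip: power_mult)
    then show "(\<alpha> * l) ^ 3 = l ^ 3" "(\<alpha>\<^sup>2 * l) ^ 3 = l ^ 3"
      by (simp_all add: power_mult_distrib alpha_cube)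
  qed
  let ?N = "\<lambda>f. numer \<beta> l (fhat f l) (fhat f (\<alpha> * l)) (fhat f (\<alpha>\<^sup>2 * l))"
  have "e * ?N f = ?N g + e * (Delta \<beta> l * (H1 + \<i> * l * (of_real \<beta> * K)))"
    unfolding numer_boundary[symmetric, of _ _ _ _ H0] numer_cmult[symmetric] numer_add[symmetric]
      ev[OF refl] ev[OF cube(1)] ev[OF cube(2)] by (simp only: mult.assoc)
  then have "- exp (- \<i> * l) / (2 * of_real pi * Delta \<beta> l) * (e * ?N f)
    = - exp (- \<i> * l) / (2 * of_real pi * Delta \<beta> l) * ?N g
      - exp (- \<i> * l) / (2 * of_real pi * Delta \<beta> l) * (e * (Delta \<beta> l * (H1 + \<i> * l * (of_real \<beta> * K))))"
    by (simp add: algebra_simps)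
  moreover have "exp (- \<i> * l) / (2 * of_real pi * Delta \<beta> l) * (e * (Delta \<beta> l * (H1 + \<i> * l * (of_real \<beta> * K))))
      = exp (- \<i> * l) * (1 / (2 * of_real pi)) * (e * (H1 + \<i> * l * (of_real \<beta> * K)))"
    using D by simp
  ultimately have m: "e * Fm \<beta> f l = Fm \<beta> g l - exp (- \<i> * l) * (1 / (2 * of_real pi)) * (e * (H1 + \<i> * l * (of_real \<beta> * K)))"
    unfolding Fm_def by (simp only: mult.left_commute)
  then show ?m
    unfolding bdry_def e_def[symmetric] f_def[symmetric] g_def[symmetric] H1_def[symmetric] K_def[symmetric]
    by (simp only: mult.assoc)
  have "e * Fp \<beta> f l = Fp \<beta> g l - (1 / (2 * of_real pi)) * (e * (H0 + \<i> * l * of_real 1 * K))"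
    unfolding Fp_def distrib_left m times_divide_eq_right ev[OF refl] by (simp add: field_simps)
  then show ?p
    unfolding bdry_def e_def[symmetric] f_def[symmetric] g_def[symmetric] H0_def[symmetric] K_def[symmetric] .
qed

text \<open>\<open>F\<close> is constrained only at contour points where the determinant does not
  vanish, which is what the case distinction in \<open>transform\<close> provides.\<close>

lemma inverse_transform:
  assumes \<beta>: "0 \<le> \<beta>" "\<beta> \<le> 1 / 2"
    and t: "t \<in> {0..T}" and x: "x \<in> {0..1}"
    and ends: "\<And>s. s \<in> {0..T} \<Longrightarrow> q 0 s = 0" "\<And>s. s \<in> {0..T} \<Longrightarrow> q 1 s = 0"
    and slope: "\<And>s. s \<in> {0..T} \<Longrightarrow> q1 1 s = of_real \<beta> * q1 0 s"
    and Fp: "\<And>l. Delta \<beta> l \<noteq> 0 \<Longrightarrow> l \<in> Gamma_plus \<union> Gamma_zero \<Longrightarrow> F l = Fp \<beta> (\<lambda>x. q x 0) l"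
    and Fm: "\<And>l. Delta \<beta> l \<noteq> 0 \<Longrightarrow> l \<in> Gamma_minus \<Longrightarrow> l \<notin> Gamma_plus \<union> Gamma_zero \<Longrightarrow> F l = Fm \<beta> (\<lambda>x. q x 0) l"
  shows "has_inverse_transform (\<lambda>l. exp (\<i> * l ^ 3 * of_real t) * F l) x (q x t)"
proof -
  have t0: "0 \<le> t" using t by simp
  have x01: "0 \<le> x" "x \<le> 1" using x by auto
  define g where "g = (\<lambda>x. q x t)"
  define h where "h = (\<lambda>l. exp (\<i> * l * of_real x) * (exp (\<i> * l ^ 3 * of_real t) * F l))"
  define P where "P = (\<lambda>l. exp (\<i> * l * of_real x) * Fp \<beta> g l)"
  define M where "M = (\<lambda>l. exp (\<i> * l * of_real x) * Fm \<beta> g l)"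
  \<comment> \<open>\<open>A\<close> is the correction on the upper contour and the circle, bounded
    through \<open>exp (\<i> * l * x)\<close> in the upper half plane. In \<open>B\<close> the extra
    \<open>exp (- \<i> * l)\<close> makes the prefactor bounded in the lower half plane.\<close>
  define A where "A = (\<lambda>l. exp (\<i> * l * of_real x) * (- (1 / (2 * of_real pi)) * bdry 1 0 t l))"
  define B where "B = (\<lambda>l. exp (\<i> * l * of_real x) * (exp (- \<i> * l) * (- (1 / (2 * of_real pi))) * bdry \<beta> 1 t l))"
  have c: "continuous_on {0..1} (\<lambda>x. q2 x t)"
    by (rule continuous_on_vector_derivative[of _ _ "\<lambda>x. q3 x t"]) (rule dx(3)[OF _ t])
  obtain J0 J1 J2 J3 where J:
    "(P has_contour_integral J0) (circlepath 0 (1/2))"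
    "has_sector_integral P J1 0 (pi/3)" "has_sector_integral P J2 (2*pi/3) pi"
    "has_sector_integral M J3 (-2*pi/3) (-pi/3)"
    "g x = J0 + (J1 + J2) + J3"
    using inversion[OF \<beta> dx(1)[OF _ t] dx(2)[OF _ t] c ends(1)[OF t] ends(2)[OF t] x01]
    unfolding P_def M_def g_def by blast
  have hP: "h l = P l + A l" if "Delta \<beta> l \<noteq> 0" "l \<in> Gamma_plus \<union> Gamma_zero" for l
  proof -
    have e: "exp (\<i> * l ^ 3 * of_real t) * Fp \<beta> (\<lambda>x. q x 0) l
      = Fp \<beta> (\<lambda>x. q x t) l - (1 / (2 * of_real pi)) * bdry 1 0 t l"
      by (rule transform_evolution(2)[OF t ends slope that(1)])
    show ?thesis
      unfolding h_def Fp[OF that] e P_def A_def g_def by (simp add: algebra_simps)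
  qed
  have hM: "h l = M l + B l" if "Delta \<beta> l \<noteq> 0" "l \<in> Gamma_minus" "l \<notin> Gamma_plus \<union> Gamma_zero" for l
  proof -
    have e: "exp (\<i> * l ^ 3 * of_real t) * Fm \<beta> (\<lambda>x. q x 0) l
      = Fm \<beta> (\<lambda>x. q x t) l - exp (- \<i> * l) * (1 / (2 * of_real pi)) * bdry \<beta> 1 t l"
      by (rule transform_evolution(1)[OF t ends slope that(1)])
    show ?thesis
      unfolding h_def Fm[OF that] e M_def B_def g_def by (simp add: algebra_simps)
  qed
  have aA: "A analytic_on S" and aB: "B analytic_on S" for S
    unfolding A_def B_def by (intro analytic_intros analytic_bdry t; simp)+
  have pi1: "norm (- (1 / (2 * of_real pi)) :: complex) \<le> 1"
    using pi_gt3 by (simp add: norm_divide)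
  obtain C0 where C0: "\<And>l. norm l \<ge> 1 \<Longrightarrow> Im (l ^ 3) \<ge> 0 \<Longrightarrow> norm (bdry 1 0 t l) \<le> C0 / (norm l)\<^sup>2"
    using bdry_bound[of 0 t 1] t by auto
  obtain C1 where C1: "\<And>l. norm l \<ge> 1 \<Longrightarrow> Im (l ^ 3) \<ge> 0 \<Longrightarrow> norm (bdry \<beta> 1 t l) \<le> C1 / (norm l)\<^sup>2"
    using bdry_bound[of 1 t \<beta>] t \<beta> by auto
  have bA: "norm (A l) \<le> C0 / (norm l)\<^sup>2" if "norm l \<ge> 1" "Im l \<ge> 0" "Im (l ^ 3) \<ge> 0" for l
  proof -
    have "norm (exp (\<i> * l * of_real x)) \<le> 1"
      using that(2) x01 by simp
    then have "norm (A l) \<le> 1 * (1 * norm (bdry 1 0 t l))"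
      unfolding A_def norm_mult by (intro mult_mono pi1) auto
    then show ?thesis using C0[OF that(1,3)] by simp
  qed
  have bB: "norm (B l) \<le> C1 / (norm l)\<^sup>2" if "norm l \<ge> 1" "Im l \<le> 0" "Im (l ^ 3) \<ge> 0" for l
  proof -
    have "exp (\<i> * l * of_real x) * exp (- \<i> * l) = exp (- \<i> * (of_real (1 - x) * l))"
      unfolding exp_add[symmetric] by (simp add: algebra_simps)
    moreover have "Im (of_real (1 - x) * l) \<le> 0"
      using x01 that(2) by (simp add: mult_nonneg_nonpos)
    ultimately have e: "norm (exp (\<i> * l * of_real x) * exp (- \<i> * l)) \<le> 1"
      by (simp only: norm_exp_i) simp
    have "B l = (exp (\<i> * l * of_real x) * exp (- \<i> * l)) * (- (1 / (2 * of_real pi)) * bdry \<beta> 1 t l)"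
      by (simp only: B_def mult.assoc)
    also have "norm \<dots> \<le> 1 * (1 * norm (bdry \<beta> 1 t l))"
      unfolding norm_mult[of "exp _ * exp _"] norm_mult[of "- (1 / _)"] by (intro mult_mono e pi1) auto
    finally show ?thesis using C1[OF that(1,3)] by simp
  qed
  have z1: "has_sector_integral A 0 0 (pi/3)"
    by (rule has_sector_integral_zero[OF _ aA bA]) (use polar_sectors(1) in auto)
  have z2: "has_sector_integral A 0 (2*pi/3) pi"
    by (rule has_sector_integral_zero[OF _ aA bA]) (use polar_sectors(1) in auto)
  have z3: "has_sector_integral B 0 (-2*pi/3) (-pi/3)"
    by (rule has_sector_integral_zero[OF _ aB bB]) (use polar_sectors(2) in force)+
  have p: "0 < pi" by simp
  have "has_sector_integral h (J1 + 0) 0 (pi/3)"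
    by (rule has_sector_integral_cong[OF _ _ has_sector_integral_add[OF J(2) z1]])
      (use hP sector_boundary_subset_Gamma(1) Delta_nonzero_boundary[OF \<beta>] in auto)
  moreover have "has_sector_integral h (J2 + 0) (2*pi/3) pi"
    by (rule has_sector_integral_cong[OF _ _ has_sector_integral_add[OF J(3) z2]])
      (use hP sector_boundary_subset_Gamma(2) Delta_nonzero_boundary[OF \<beta>] in auto)
  moreover have "has_sector_integral h (J3 + 0) (-2*pi/3) (-pi/3)"
  proof (rule has_sector_integral_cong[OF _ _ has_sector_integral_add[OF J(4) z3]])
    show "h l = M l + B l" if "l \<in> sector_boundary (-2*pi/3) (-pi/3)" for l
      using that sector_boundary_subset_Gamma(3) by (intro hM Delta_nonzero_boundary[OF \<beta>]) auto
  qed (use p in simp)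
  moreover have "(h has_contour_integral (J0 + 0)) (circlepath 0 (1/2))"
  proof (rule has_contour_integral_eq)
    have "(A has_contour_integral 0) (circlepath 0 (1/2))"
      unfolding circlepath_def using closed_arc_zero[OF analytic_imp_holomorphic[OF aA], of "1/2" 0] by simp
    then show "((\<lambda>l. P l + A l) has_contour_integral (J0 + 0)) (circlepath 0 (1/2))"
      by (rule has_contour_integral_add[OF J(1)])
    show "P l + A l = h l" if "l \<in> path_image (circlepath 0 (1/2))" for l
    proof -
      have "l \<in> Gamma_zero" using that by (simp add: Gamma_zero_def)
      then show ?thesis using hP[of l] Delta_nonzero_boundary[OF \<beta>, of l] by simp
    qed
  qed
  ultimately show ?thesis
    using J(5) unfolding has_inverse_transform_def Let_def has_Gamma_zero_integral_def has_Gamma_plus_integral_def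
      has_Gamma_minus_integral_def h_def[symmetric] g_def
    by (intro exI[of _ J0] exI[of _ "J1 + J2"] exI[of _ J3]) auto
qed

end

section \<open>The explicit kernels of the two problems\<close>

lemma integral_exp_combination:
  assumes "continuous_on {0..1} f"
  shows "integral {0..1} (\<lambda>x. k * (exp (- \<i> * l * of_real x) * a + exp (- \<i> * \<alpha> * l * of_real x) * b
      + exp (- \<i> * \<alpha>\<^sup>2 * l * of_real x) * c) * f x)
    = k * (fhat f l * a + fhat f (\<alpha> * l) * b + fhat f (\<alpha>\<^sup>2 * l) * c)"
proof -
  have i: "((\<lambda>x. exp (m * of_real x) * f x) has_integral lap 0 1 f m) {0..1}" for m
    unfolding lap_def by (rule integrable_integral[OF lap_integrable[OF assms]])
  have "((\<lambda>x. k * ((exp (- \<i> * l * of_real x) * f x) * a + (exp (- \<i> * (\<alpha> * l) * of_real x) * f x) * b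
      + (exp (- \<i> * (\<alpha>\<^sup>2 * l) * of_real x) * f x) * c)) has_integral
      k * (fhat f l * a + fhat f (\<alpha> * l) * b + fhat f (\<alpha>\<^sup>2 * l) * c)) {0..1}"
    unfolding fhat_def by (intro has_integral_mult_right has_integral_add has_integral_mult_left i)
  also have "(\<lambda>x. k * ((exp (- \<i> * l * of_real x) * f x) * a + (exp (- \<i> * (\<alpha> * l) * of_real x) * f x) * b
      + (exp (- \<i> * (\<alpha>\<^sup>2 * l) * of_real x) * f x) * c))
    = (\<lambda>x. k * (exp (- \<i> * l * of_real x) * a + exp (- \<i> * \<alpha> * l * of_real x) * b
      + exp (- \<i> * \<alpha>\<^sup>2 * l * of_real x) * c) * f x)"
    by (rule ext) (simp add: algebra_simps)
  finally show ?thesis by (rule integral_unique)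
qed

lemma Delta1_eq: "\<Delta>1 l = 2 * Delta (1/2) l"
  by (simp add: \<Delta>1_def Delta_def)

lemma Delta2_eq: "\<Delta>2 l = Delta 0 l"
  by (simp add: \<Delta>2_def Delta_def)

text \<open>After clearing the denominators these are polynomial identities in the three
  exponentials and the three Fourier transforms. For Problem 1 both the determinant and the bracket
  carry an extra factor 2, which cancels.\<close>

lemma phi_transforms:
  assumes f: "continuous_on {0..1} f"
  shows "Delta (1/2) l \<noteq> 0 \<Longrightarrow> integral {0..1} (\<lambda>x. \<phi>1p x l * f x) = Fp (1/2) f l"
    and "Delta (1/2) l \<noteq> 0 \<Longrightarrow> integral {0..1} (\<lambda>x. \<phi>1m x l * f x) = Fm (1/2) f l"
    and "Delta 0 l \<noteq> 0 \<Longrightarrow> integral {0..1} (\<lambda>x. \<phi>2p x l * f x) = Fp 0 f l"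
    and "Delta 0 l \<noteq> 0 \<Longrightarrow> integral {0..1} (\<lambda>x. \<phi>2m x l * f x) = Fm 0 f l"
proof -
  define E E1 E2 where "E = exp (-\<i>*l)" and "E1 = exp (-\<i>*\<alpha>*l)" and "E2 = exp (-\<i>*\<alpha>\<^sup>2*l)"
  define a b c where "a = fhat f l" and "b = fhat f (\<alpha> * l)" and "c = fhat f (\<alpha>\<^sup>2 * l)"
  note folds = E_def[symmetric] E1_def[symmetric] E2_def[symmetric] a_def[symmetric] b_def[symmetric] c_def[symmetric]
  note eval = integral_exp_combination[OF f]
  have pi: "of_real pi \<noteq> (0 :: complex)" by simp
  have Fp: "2 * of_real pi * Delta \<beta> l * Fp \<beta> f l = a * Delta \<beta> l - E * numer \<beta> l a b c"
    and Fm: "2 * of_real pi * Delta \<beta> l * Fm \<beta> f l = - E * numer \<beta> l a b c" if "Delta \<beta> l \<noteq> 0" for \<beta>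
    using that pi unfolding Fp_def Fm_def folds by (simp_all add: field_simps)
  have cancel: "1 / (2 * of_real pi * d) * w = F" if "2 * of_real pi * d * F = w" "d \<noteq> 0" for d w F :: complex
    using that pi by (auto simp: field_simps)
  show "integral {0..1} (\<lambda>x. \<phi>1p x l * f x) = Fp (1/2) f l" if D: "Delta (1/2) l \<noteq> 0"
    unfolding \<phi>1p_def eval
  proof (rule cancel)
    show "2 * of_real pi * \<Delta>1 l * Fp (1/2) f l =
      fhat f l * (exp (\<i>*l) + 2*\<alpha> * exp (-\<i>*\<alpha>*l) + 2*\<alpha>^2 * exp (-\<i>*\<alpha>^2*l))
      + fhat f (\<alpha> * l) * (\<alpha> * exp (\<i>*\<alpha>*l) - 2*\<alpha> * exp (-\<i>*l))
      + fhat f (\<alpha>\<^sup>2 * l) * (\<alpha>^2 * exp (\<i>*\<alpha>^2*l) - 2*\<alpha>^2 * exp (-\<i>*l))"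
    proof -
      have "2 * of_real pi * \<Delta>1 l * Fp (1/2) f l = 2 * (a * Delta (1/2) l - E * numer (1/2) l a b c)"
        unfolding Fp[OF D, symmetric] Delta1_eq by simp
      then show ?thesis
        unfolding exp_alpha_product folds Delta_product numer_def by (simp add: algebra_simps)
    qed
  qed (use D in \<open>simp add: Delta1_eq\<close>)
  show "integral {0..1} (\<lambda>x. \<phi>2p x l * f x) = Fp 0 f l" if D: "Delta 0 l \<noteq> 0"
  proof -
    have "integral {0..1} (\<lambda>x. \<phi>2p x l * f x) = integral {0..1} (\<lambda>x. 1 / (2 * of_real pi * \<Delta>2 l)
       * (exp (- \<i> * l * of_real x) * (\<alpha> * E1 + \<alpha>\<^sup>2 * E2) + exp (- \<i> * \<alpha> * l * of_real x) * (- \<alpha> * E)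
      + exp (- \<i> * \<alpha>\<^sup>2 * l * of_real x) * (- (\<alpha>\<^sup>2) * E)) * f x)"
      unfolding \<phi>2p_def folds by (intro Henstock_Kurzweil_Integration.integral_cong) (simp add: algebra_simps)
    also have "\<dots> = Fp 0 f l"
      unfolding eval
    proof (rule cancel)
      show "2 * of_real pi * \<Delta>2 l * Fp 0 f l = fhat f l * (\<alpha> * E1 + \<alpha>\<^sup>2 * E2) + fhat f (\<alpha> * l) * (- \<alpha> * E)
         + fhat f (\<alpha>\<^sup>2 * l) * (- (\<alpha>\<^sup>2) * E)"
        using Fp[OF D] unfolding Delta2_eq folds Delta_product numer_def by (simp add: algebra_simps)
    qed (use D in \<open>simp add: Delta2_eq\<close>)
    finally show ?thesis .
  qed
  show "integral {0..1} (\<lambda>x. \<phi>1m x l * f x) = Fm (1/2) f l" if D: "Delta (1/2) l \<noteq> 0"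
  proof -
    have "integral {0..1} (\<lambda>x. \<phi>1m x l * f x) = integral {0..1} (\<lambda>x. 1 / (2 * of_real pi * \<Delta>1 l)
       * (exp (- \<i> * l * of_real x) * (- E * (2 + \<alpha>\<^sup>2 * E1 + \<alpha> * E2)) + exp (- \<i> * \<alpha> * l * of_real x) * (- E * \<alpha> * (2 - E2))
      + exp (- \<i> * \<alpha>\<^sup>2 * l * of_real x) * (- E * \<alpha>\<^sup>2 * (2 - E1))) * f x)"
      unfolding \<phi>1m_def folds by (intro Henstock_Kurzweil_Integration.integral_cong) (simp add: algebra_simps)
    also have "\<dots> = Fm (1/2) f l"
      unfolding eval
    proof (rule cancel)
      show "2 * of_real pi * \<Delta>1 l * Fm (1/2) f l = fhat f l * (- E * (2 + \<alpha>\<^sup>2 * E1 + \<alpha> * E2)) + fhat f (\<alpha> * l) * (- E * \<alpha> * (2 - E2))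
         + fhat f (\<alpha>\<^sup>2 * l) * (- E * \<alpha>\<^sup>2 * (2 - E1))"
      proof -
        have "2 * of_real pi * \<Delta>1 l * Fm (1/2) f l = 2 * (- E * numer (1/2) l a b c)"
          unfolding Fm[OF D, symmetric] Delta1_eq by simp
        then show ?thesis
          unfolding folds numer_def by (simp add: algebra_simps)
      qed
    qed (use D in \<open>simp add: Delta1_eq\<close>)
    finally show ?thesis .
  qed
  show "integral {0..1} (\<lambda>x. \<phi>2m x l * f x) = Fm 0 f l" if D: "Delta 0 l \<noteq> 0"
  proof -
    have "integral {0..1} (\<lambda>x. \<phi>2m x l * f x) = integral {0..1} (\<lambda>x. 1 / (2 * of_real pi * \<Delta>2 l)
       * (exp (- \<i> * l * of_real x) * (- E) + exp (- \<i> * \<alpha> * l * of_real x) * (- E * \<alpha>)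
      + exp (- \<i> * \<alpha>\<^sup>2 * l * of_real x) * (- E * \<alpha>\<^sup>2)) * f x)"
      unfolding \<phi>2m_def folds by (intro Henstock_Kurzweil_Integration.integral_cong) (simp add: algebra_simps)
    also have "\<dots> = Fm 0 f l"
      unfolding eval
    proof (rule cancel)
      show "2 * of_real pi * \<Delta>2 l * Fm 0 f l = fhat f l * (- E) + fhat f (\<alpha> * l) * (- E * \<alpha>) + fhat f (\<alpha>\<^sup>2 * l) * (- E * \<alpha>\<^sup>2)"
        using Fm[OF D] unfolding Delta2_eq folds numer_def by (simp add: algebra_simps)
    qed (use D in \<open>simp add: Delta2_eq\<close>)
    finally show ?thesis .
  qed
qed

text \<open>The initial datum is tied to \<open>q\<close> at time 0 on \<open>{0..1}\<close> only,
  so replacing one by the other needs agreement on the interval to suffice.\<close>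

lemma transform_cong:
  assumes "\<And>x. x \<in> {0..1} \<Longrightarrow> f x = g x"
  shows "Fp \<beta> f l = Fp \<beta> g l" "Fm \<beta> f l = Fm \<beta> g l"
  unfolding Fp_def Fm_def fhat_def by (simp_all only: lap_cong[OF assms])

text \<open>The common core of both problems: the kernels enter through the two hypotheses
  identifying their integrals with \<open>Fp\<close> and \<open>Fm\<close>, the boundary condition
  through \<beta>.\<close>

lemma solution_inverse_transform:
  assumes "T > 0" and q: "solves_ivp T f q" and f: "continuous_on {0..1} f"
    and \<beta>: "0 \<le> \<beta>" "\<beta> \<le> 1 / 2" and t: "t \<in> {0..T}" and x: "x \<in> {0..1}"
    and bc: "\<And>s. s \<in> {0..T} \<Longrightarrow> q 0 s = 0 \<and> q 1 s = 0 \<and> partial_x q 1 s = of_real \<beta> * partial_x q 0 s"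
    and p: "\<And>l. Delta \<beta> l \<noteq> 0 \<Longrightarrow> integral {0..1} (\<lambda>x. \<phi>p x l * f x) = Fp \<beta> f l"
    and m: "\<And>l. Delta \<beta> l \<noteq> 0 \<Longrightarrow> integral {0..1} (\<lambda>x. \<phi>m x l * f x) = Fm \<beta> f l"
  shows "has_inverse_transform (\<lambda>l. exp (\<i> * l ^ 3 * of_real t) * transform \<phi>p \<phi>m l f) x (q x t)"
proof -
  obtain q1 q2 q3 qt q1t q2t where "regular_solution T q q1 q2 q3 qt q1t q2t"
    and q1: "\<And>x t. x \<in> {0..1} \<Longrightarrow> t \<in> {0..T} \<Longrightarrow> partial_x q x t = q1 x t"
    using solves_ivp_regular[OF \<open>T > 0\<close> q] by blast
  then interpret regular_solution T q q1 q2 q3 qt q1t q2t by simp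
  have init: "f x = q x 0" if "x \<in> {0..1}" for x
    using q that unfolding solves_ivp_def by simp
  show ?thesis
  proof (rule inverse_transform[OF \<beta> t x])
    show "q 0 s = 0" "q 1 s = 0" if "s \<in> {0..T}" for s
      using bc[OF that] by simp_all
    show "q1 1 s = of_real \<beta> * q1 0 s" if "s \<in> {0..T}" for s
      using bc[OF that] q1[OF _ that, of 0] q1[OF _ that, of 1] by simp
    show "transform \<phi>p \<phi>m l f = Fp \<beta> (\<lambda>x. q x 0) l" if "Delta \<beta> l \<noteq> 0" "l \<in> Gamma_plus \<union> Gamma_zero" for l
      using that p transform_cong(1)[OF init] by (simp add: transform_def)
    show "transform \<phi>p \<phi>m l f = Fm \<beta> (\<lambda>x. q x 0) l"
      if "Delta \<beta> l \<noteq> 0" "l \<in> Gamma_minus" "l \<notin> Gamma_plus \<union> Gamma_zero" for l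
      using that m transform_cong(2)[OF init] by (simp add: transform_def)
  qed
qed

theorem proposition3p1:
  fixes T :: real
  assumes "T > 0"
  shows
    "(\<forall>(f :: real \<Rightarrow> complex) (q :: real \<Rightarrow> real \<Rightarrow> complex).
        smooth_on {0..1} f \<and> f 0 = 0 \<and> f 1 = 0 \<and> deriv01 f 0 = 2 * deriv01 f 1 \<and>
        solution1 T f q \<longrightarrow>
        (\<forall>x\<in>{0<..<1}. \<forall>t\<in>{0<..<T}.
           has_inverse_transform
             (\<lambda>l. exp (\<i> * l ^ 3 * of_real t) * transform1 l f) x (q x t))) \<and>
     (\<forall>(f :: real \<Rightarrow> complex) (q :: real \<Rightarrow> real \<Rightarrow> complex).
        smooth_on {0..1} f \<and> f 0 = 0 \<and> f 1 = 0 \<and> deriv01 f 1 = 0 \<and>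
        solution2 T f q \<longrightarrow>
        (\<forall>x\<in>{0<..<1}. \<forall>t\<in>{0<..<T}.
           has_inverse_transform
             (\<lambda>l. exp (\<i> * l ^ 3 * of_real t) * transform2 l f) x (q x t)))"
proof (intro conjI allI impI ballI; elim conjE)
  fix f q and x t :: real
  assume f: "smooth_on {0..1} f" and q: "solution1 T f q" and xt: "x \<in> {0<..<1}" "t \<in> {0<..<T}"
  show "has_inverse_transform (\<lambda>l. exp (\<i> * l ^ 3 * of_real t) * transform1 l f) x (q x t)"
    unfolding transform1_def
    by (rule solution_inverse_transform[OF assms _ smooth_onD_continuous[OF f], where \<beta> = "1/2"])
      (use q xt phi_transforms[OF smooth_onD_continuous[OF f]] in \<open>auto simp: solution1_def\<close>)
next
  fix f q and x t :: real
  assume f: "smooth_on {0..1} f" and q: "solution2 T f q" and xt: "x \<in> {0<..<1}" "t \<in> {0<..<T}"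
  show "has_inverse_transform (\<lambda>l. exp (\<i> * l ^ 3 * of_real t) * transform2 l f) x (q x t)"
    unfolding transform2_def
    by (rule solution_inverse_transform[OF assms _ smooth_onD_continuous[OF f], where \<beta> = 0])
      (use q xt phi_transforms[OF smooth_onD_continuous[OF f]] in \<open>auto simp: solution2_def\<close>)
qed

end
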